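(* Let $d\ge 3$. For every $p\in[1,\infty)$, the parallelly sliced spherical Wasserstein distance $\mathrm{PSW}_p$ is a metric on $\mathcal P(\mathbb S^{d-1})$, which induces the same topology on $\mathcal P(\mathbb S^{d-1})$ as the spherical Wasserstein distance $\mathrm W_p$. There exist constants $c_{d,p},C_{d,p}>0$ (depending only on $d$ and $p$) such that $$c_{d,p}\,\mathrm{PSW}_p(\mu,\nu)\le \mathrm W_p(\mu,\nu)\le C_{d,p}\,\mathrm{PSW}_p(\mu,\nu)^{\frac{1}{p(d+1)}}\qquad\text{for all }\mu,\nu\in\mathcal P(\mathbb S^{d-1}).$$ Moreover, $\mathrm{PSW}_p$ is rotationally invariant: for every $\mu,\nu\in\mathcal P(\mathbb S^{d-1})$ and every $Q\in\mathrm{SO}(d)$, $$\mathrm{PSW}_p(\mu,\nu)=\mathrm{PSW}_p(\mu\circ Q,\nu\circ Q).$$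
   Context: $\mathbb S^{d-1}=\{x\in\mathbb R^d:\|x\|=1\}$ with geodesic distance $d(\xi,\eta)=\arccos\langle\xi,\eta\rangle$; $u_{\mathbb S^{d-1}}$ is the uniform (normalized surface) probability measure on $\mathbb S^{d-1}$; $\mathcal P(\mathbb X)$ is the set of Borel probability measures on $\mathbb X$; $\mathbb I=[-1,1]$ with distance $|x-y|$. For a compact metric space $(\mathbb X,d)$ and $p\in[1,\infty)$ the Wasserstein distance is $\mathrm W_p^p(\mu,\nu)=\min_{\pi\in\Pi(\mu,\nu)}\int_{\mathbb X^2}d(x,y)^p\,\mathrm d\pi(x,y)$, where $\Pi(\mu,\nu)$ is the set of couplings of $\mu,\nu\in\mathcal P(\mathbb X)$. For $\psi\in\mathbb S^{d-1}$ let $\mathcal S_\psi\colon\mathbb S^{d-1}\to\mathbb I$, $\mathcal S_\psi(\xi)=\langle\xi,\psi\rangle$, and for a measure $\mu$ on $\mathbb S^{d-1}$ let $\mathcal U_\psi\mu=(\mathcal S_\psi)_\#\mu$ be the push-forward measure on $\mathbb I$. The parallelly sliced spherical Wasserstein distance is $$\mathrm{PSW}_p^p(\mu,\nu)=\int_{\mathbb S^{d-1}}\mathrm W_p^p(\mathcal U_\psi\mu,\mathcal U_\psi\nu)\,\mathrm du_{\mathbb S^{d-1}}(\psi),\qquad \mu,\nu\in\mathcal P(\mathbb S^{d-1}),$$ where $\mathrm W_p$ inside the integral is taken on $\mathbb I$. For $Q\in\mathrm{SO}(d)$, $\mu\circ Q$ denotes the measure $B\mapsto\mu(QB)$. *)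

theory Defs
  imports "HOL-Probability.Probability"
begin

definition borel_probs :: "'a::topological_space set \<Rightarrow> 'a measure set" where
  "borel_probs X = space (prob_algebra (restrict_space borel X))"

definition couplings :: "'a measure \<Rightarrow> 'b measure \<Rightarrow> ('a \<times> 'b) measure set" where
  "couplings \<mu> \<nu> =
     {\<pi>. sets \<pi> = sets (\<mu> \<Otimes>\<^sub>M \<nu>) \<and> distr \<pi> \<mu> fst = \<mu> \<and> distr \<pi> \<nu> snd = \<nu>}"

text \<open>The distance \<open>d\<close> is an argument because the sphere carries its geodesic distance and
  not the one inherited from the ambient space. For Borel probability measures on a compact
  metric space the infimum is attained, so it is the minimum over all couplings.\<close>

definition wasserstein ::
    "('a \<Rightarrow> 'a \<Rightarrow> real) \<Rightarrow> real \<Rightarrow> 'a measure \<Rightarrow> 'a measure \<Rightarrow> real" where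
  "wasserstein d p \<mu> \<nu> =
     (INF \<pi>\<in>couplings \<mu> \<nu>. LINT z|\<pi>. d (fst z) (snd z) powr p) powr (1 / p)"

abbreviation unit_sphere :: "'a::euclidean_space set" where
  "unit_sphere \<equiv> sphere 0 1"

definition geodesic_dist :: "'a::euclidean_space \<Rightarrow> 'a \<Rightarrow> real" where
  "geodesic_dist \<xi> \<eta> = arccos (\<xi> \<bullet> \<eta>)"

text \<open>Surface measure on the unit sphere in dimension \<open>n\<close>: the area of \<open>A\<close> is \<open>n\<close> times the
  Lebesgue measure of the cone \<open>{t *\<^sub>R x | 0 < t \<le> 1, x \<in> A}\<close>, as in integration in polar
  coordinates (see \<open>emeasure_sphere_surface_measure\<close>). The map \<open>sgn\<close> is \<open>x \<mapsto> x / norm x\<close>.\<close>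

definition sphere_surface_measure :: "'a::euclidean_space measure" where
  "sphere_surface_measure =
     scale_measure (of_nat DIM('a))
       (distr (restrict_space lborel (cball 0 1 - {0})) (restrict_space borel unit_sphere) sgn)"

definition sphere_uniform :: "'a::euclidean_space measure" where
  "sphere_uniform = uniform_measure sphere_surface_measure unit_sphere"

definition slice :: "'a::euclidean_space \<Rightarrow> 'a \<Rightarrow> real" where
  "slice \<psi> \<xi> = \<xi> \<bullet> \<psi>"

definition sliced :: "'a::euclidean_space \<Rightarrow> 'a measure \<Rightarrow> real measure" where
  "sliced \<psi> \<mu> = distr \<mu> (restrict_space borel {-1..1}) (slice \<psi>)"

definition PSW :: "real \<Rightarrow> 'a::euclidean_space measure \<Rightarrow> 'a measure \<Rightarrow> real" where
  "PSW p \<mu> \<nu> =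
     (LINT \<psi>|sphere_uniform. wasserstein dist p (sliced \<psi> \<mu>) (sliced \<psi> \<nu>) powr p) powr (1 / p)"

definition rotated :: "(real ^ 'n) measure \<Rightarrow> real ^ 'n ^ 'n \<Rightarrow> (real ^ 'n) measure" where
  "rotated \<mu> Q = measure_of (space \<mu>) (sets \<mu>) (\<lambda>B. emeasure \<mu> ((\<lambda>x. Q *v x) ` B))"

lemma sgn_measurable_sphere:
  "sgn \<in> restrict_space lborel (cball 0 1 - {0}) \<rightarrow>\<^sub>M
     restrict_space borel (unit_sphere :: 'a::euclidean_space set)"
proof (rule measurable_restrict_space2)
  show "sgn \<in> space (restrict_space lborel (cball 0 1 - {0})) \<rightarrow> (unit_sphere :: 'a set)"
    by (auto simp: space_restrict_space norm_sgn)
  show "sgn \<in> restrict_space lborel (cball (0::'a) 1 - {0}) \<rightarrow>\<^sub>M borel"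
    unfolding sgn_div_norm
    by (rule measurable_restrict_space1) measurable
qed

lemma emeasure_sphere_surface_measure:
  fixes A :: "'a::euclidean_space set"
  assumes "A \<in> sets (restrict_space borel unit_sphere)"
  shows "emeasure sphere_surface_measure A =
    of_nat DIM('a) * emeasure lborel {t *\<^sub>R x | t x. 0 < t \<and> t \<le> 1 \<and> x \<in> A}"
proof -
  let ?S = "cball (0::'a) 1 - {0}"
  have sub: "A \<subseteq> unit_sphere"
    using sets.sets_into_space[OF assms] by (simp add: space_restrict_space)
  have "sgn -` A \<inter> ?S = {t *\<^sub>R x | t x. 0 < t \<and> t \<le> 1 \<and> x \<in> A}"
  proof (intro set_eqI iffI)
    fix y assume y: "y \<in> sgn -` A \<inter> ?S"
    then have "y = norm y *\<^sub>R sgn y" "0 < norm y" "norm y \<le> 1" "sgn y \<in> A"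
      by (auto simp: sgn_div_norm)
    then show "y \<in> {t *\<^sub>R x | t x. 0 < t \<and> t \<le> 1 \<and> x \<in> A}" by blast
  next
    fix y assume "y \<in> {t *\<^sub>R x | t x. 0 < t \<and> t \<le> 1 \<and> x \<in> A}"
    then obtain t x where "y = t *\<^sub>R x" "0 < t" "t \<le> 1" "x \<in> A" by blast
    moreover from this sub have "norm x = 1" by auto
    ultimately show "y \<in> sgn -` A \<inter> ?S"
      by (auto simp: sgn_scaleR sgn_div_norm)
  qed
  moreover have "emeasure (restrict_space lborel ?S) (sgn -` A \<inter> ?S) = emeasure lborel (sgn -` A \<inter> ?S)"
    by (rule emeasure_restrict_space) auto
  ultimately show ?thesis
    unfolding sphere_surface_measure_def emeasure_scale_measure
      emeasure_distr[OF sgn_measurable_sphere assms]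
    by (simp add: space_restrict_space)
qed

lemma emeasure_sphere_surface_measure_sphere:
  "emeasure sphere_surface_measure (unit_sphere :: 'a::euclidean_space set) =
    ennreal (DIM('a) * unit_ball_vol DIM('a))"
proof -
  have "{t *\<^sub>R x | t x. 0 < t \<and> t \<le> 1 \<and> x \<in> (unit_sphere :: 'a set)} = cball 0 1 - {0}"
  proof (intro set_eqI iffI)
    fix y :: 'a assume "y \<in> cball 0 1 - {0}"
    then have "y = norm y *\<^sub>R sgn y" "0 < norm y" "norm y \<le> 1" "sgn y \<in> unit_sphere"
      by (auto simp: sgn_div_norm)
    then show "y \<in> {t *\<^sub>R x | t x. 0 < t \<and> t \<le> 1 \<and> x \<in> unit_sphere}" by blast
  qed auto
  moreover have "(unit_sphere :: 'a set) \<in> sets (restrict_space borel unit_sphere)"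
    by (simp add: sets_restrict_space_iff)
  moreover have "emeasure lborel (cball (0::'a) 1 - {0}) = emeasure lborel (cball (0::'a) 1)"
    by (rule emeasure_Diff_null_set) (auto intro: finite_imp_null_set_lborel)
  ultimately show ?thesis
    by (simp add: emeasure_sphere_surface_measure emeasure_cball
        ennreal_of_nat_eq_real_of_nat ennreal_mult)
qed

lemma prob_space_sphere_uniform: "prob_space (sphere_uniform :: 'a::euclidean_space measure)"
  unfolding sphere_uniform_def
  by (rule prob_space_uniform_measure)
     (auto simp: emeasure_sphere_surface_measure_sphere unit_ball_vol_pos
       ennreal_eq_0_iff not_le)

end

theory Submission
  imports Defs
begin

text \<open>
The slices of a measure are its images under the maps \<open>x \<mapsto> x \<bullet> \<psi>\<close>, so \<^const>\<open>PSW\<close> is the sliced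
Wasserstein distance of Euclidean space, restricted to measures on the unit sphere, where geodesic
and Euclidean distance differ by a factor of at most \<open>pi / 2\<close>.

Pushing a coupling forward by a slice does not increase distances. This gives
\<open>PSW \<le> W\<close> (\<open>PSW_le_wasserstein\<close>), so the lower constant can be taken to be 1.

For the upper bound let \<open>n\<close> be the dimension of the ambient space and smooth both measures by a
Gaussian kernel of width \<open>e\<close>. Smoothing moves mass by a distance of order \<open>e\<close>, and the two
smoothed densities differ in total variation by at most a constant times \<open>e + PSW / e ^ n\<close>. From
these two facts \<open>kernel_coupling\<close> builds an explicit coupling of the original measures, whose cost
shows \<open>W powr p \<le> C * (e + PSW / e ^ n)\<close> (\<open>wasserstein_powr_le_scale\<close>). The choice
\<open>e = PSW powr (1 / (n + 1))\<close> makes both terms equal and gives the exponent \<open>1 / (p * (n + 1))\<close>.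

The bound on the total variation is the heart of the matter. In polar coordinates the Fourier
integral of the Gaussian becomes an average over all directions \<open>\<theta>\<close> of ridge functions
\<open>x \<mapsto> g (x \<bullet> \<theta>)\<close> (\<open>gauss_ridge_decomposition\<close>). A ridge function sees a measure only through
one slice, so the difference of the smoothed densities is an average of one-dimensional convolutions
of \<open>g\<close> with differences of slices. The derivative of \<open>g\<close> is integrable by two integrations by parts
(\<open>sine_moment_decay\<close>); hence shifting \<open>g\<close> by \<open>h\<close> changes it by at most a multiple of \<open>\<bar>h\<bar>\<close> in the
\<open>L\<^sup>1\<close> norm, at every scale \<open>e\<close>, and the convolution is bounded by the cost of any coupling of the
two slices. Only the normalization of the kernel contributes a power of \<open>e\<close>, namely \<open>e ^ n\<close>;
estimating the densities pointwise would cost a further factor \<open>e\<close> and miss the exponent.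

The triangle inequality for \<^const>\<open>wasserstein\<close> glues near-optimal couplings along the cells of a
fine countable partition (\<open>conditionally_independent_coupling\<close>). For \<^const>\<open>PSW\<close> it follows by Minkowski's inequality over the
directions, and definiteness follows from the upper bound. The two bounds together identify the
topologies. Finally, the slice of a rotated measure is the slice of the original one in the rotated
direction, and the uniform measure on the sphere is invariant under rotations.
\<close>

section \<open>Convexity of powers\<close>

text \<open>Young's inequality for the product \<open>a powr (p - 1) * x\<close> is a tangent-line inequality in disguise.
Unlike convexity on the open half-line it covers \<open>x = 0\<close>.\<close>

lemma powr_ge_tangent:
  fixes x a p :: real
  assumes "p \<ge> 1" "x \<ge> 0" "a > 0"
  shows "a powr p + p * a powr (p - 1) * (x - a) \<le> x powr p"
proof (cases "x = 0")
  case True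
  have "a powr (p - 1) * a = a powr p"
    using assms by (simp add: powr_mult_base mult.commute)
  then have "a powr p + p * a powr (p - 1) * (x - a) = (1 - p) * a powr p"
    using True by (simp add: algebra_simps)
  also have "\<dots> \<le> 0" using assms by (simp add: mult_nonpos_nonneg)
  finally show ?thesis using True by simp
next
  case False
  have "(a powr p) powr ((p - 1) / p) * (x powr p) powr (1 / p)
      \<le> ((p - 1) / p) * a powr p + (1 / p) * x powr p"
    using assms False by (intro Youngs_inequality_0) (auto simp: field_simps)
  then have "a powr (p - 1) * x \<le> ((p - 1) / p) * a powr p + (1 / p) * x powr p"
    using assms False by (simp add: powr_powr)
  then have "p * (a powr (p - 1) * x) \<le> (p - 1) * a powr p + x powr p"
    using assms by (simp add: field_simps)
  moreover have "a powr (p - 1) * a = a powr p"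
    using assms by (simp add: powr_mult_base mult.commute)
  ultimately show ?thesis by (simp add: algebra_simps)
qed

lemma powr_convex_combination_le:
  fixes x y s t p :: real
  assumes "p \<ge> 1" "x \<ge> 0" "y \<ge> 0" "s > 0" "t > 0" "s + t = 1"
  shows "(s * x + t * y) powr p \<le> s * x powr p + t * y powr p"
proof (cases "s * x + t * y = 0")
  case True
  then show ?thesis using assms by (auto intro!: add_nonneg_nonneg)
next
  case False
  define a where "a = s * x + t * y"
  have a: "a > 0" using False assms unfolding a_def by (simp add: order_less_le)
  have "s * (a powr p + p * a powr (p - 1) * (x - a)) + t * (a powr p + p * a powr (p - 1) * (y - a))
     \<le> s * x powr p + t * y powr p"
    using powr_ge_tangent[OF assms(1,2) a] powr_ge_tangent[OF assms(1,3) a] assms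
    by (intro add_mono mult_left_mono) auto
  moreover have "s * (a powr p + p * a powr (p - 1) * (x - a)) + t * (a powr p + p * a powr (p - 1) * (y - a))
     = (s + t) * a powr p + p * a powr (p - 1) * (s * x + t * y - (s + t) * a)"
    by (simp add: algebra_simps)
  ultimately show ?thesis using assms by (simp add: a_def)
qed

lemma (in prob_space) integrable_powr_bounded:
  fixes f :: "'a \<Rightarrow> real"
  assumes "f \<in> borel_measurable M" "\<And>x. x \<in> space M \<Longrightarrow> 0 \<le> f x" "\<And>x. x \<in> space M \<Longrightarrow> f x \<le> B" "p \<ge> 0"
  shows "integrable M (\<lambda>x. f x powr p)"
  by (rule integrable_const_bound[where B="B powr p"])
     (use assms in \<open>auto intro!: AE_I2 powr_mono2\<close>)

text \<open>Integrate the tangent inequality at the mean of \<open>f\<close>.\<close>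

lemma (in prob_space) powr_expectation_le:
  fixes f :: "'a \<Rightarrow> real"
  assumes f: "f \<in> borel_measurable M" "\<And>x. x \<in> space M \<Longrightarrow> 0 \<le> f x" "\<And>x. x \<in> space M \<Longrightarrow> f x \<le> B"
    and p: "p \<ge> 1"
  shows "expectation f powr p \<le> expectation (\<lambda>x. f x powr p)"
proof (cases "expectation f = 0")
  case True
  then show ?thesis by simp
next
  case False
  define a where "a = expectation f"
  have a: "a > 0"
    using False integral_nonneg_AE[of f M] f by (auto simp: a_def order_less_le intro!: AE_I2)
  have int: "integrable M f"
    by (rule integrable_const_bound[where B=B]) (use f in auto)
  have "a powr p = expectation (\<lambda>x. a powr p + p * a powr (p - 1) * (f x - a))"
    using int by (simp add: a_def prob_space)
  also have "\<dots> \<le> expectation (\<lambda>x. f x powr p)"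
    using int f p a
    by (intro integral_mono integrable_powr_bounded[OF f] powr_ge_tangent) auto
  finally show ?thesis by (simp add: a_def)
qed

text \<open>Minkowski's inequality, stated with positive upper bounds \<open>A\<close> and \<open>B\<close> for the two norms: in this
form it applies to norms that vanish and to infima that are only approached. As \<open>(f + g) / (A + B)\<close> is
a convex combination of \<open>f / A\<close> and \<open>g / B\<close>, it reduces to convexity of the power.\<close>

lemma (in prob_space) minkowski_powr_le:
  fixes f g :: "'a \<Rightarrow> real"
  assumes f: "f \<in> borel_measurable M" "\<And>x. x \<in> space M \<Longrightarrow> 0 \<le> f x" "\<And>x. x \<in> space M \<Longrightarrow> f x \<le> F"
    and g: "g \<in> borel_measurable M" "\<And>x. x \<in> space M \<Longrightarrow> 0 \<le> g x" "\<And>x. x \<in> space M \<Longrightarrow> g x \<le> G"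
    and p: "p \<ge> 1"
    and A: "A > 0" "expectation (\<lambda>x. f x powr p) \<le> A powr p"
    and B: "B > 0" "expectation (\<lambda>x. g x powr p) \<le> B powr p"
  shows "expectation (\<lambda>x. (f x + g x) powr p) \<le> (A + B) powr p"
proof -
  define s t where "s = A / (A + B)" and "t = B / (A + B)"
  have st: "s > 0" "t > 0" "s + t = 1"
    using A B by (auto simp: s_def t_def simp flip: add_divide_distrib)
  have pw: "(f x + g x) powr p
      \<le> (A + B) powr p * (s * (f x powr p / A powr p) + t * (g x powr p / B powr p))"
    if x: "x \<in> space M" for x
  proof -
    have "(A + B) * s = A" "(A + B) * t = B"
      using A B by (auto simp: s_def t_def)
    then have "(A + B) * (s * (f x / A) + t * (g x / B)) = A * (f x / A) + B * (g x / B)"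
      by (simp add: distrib_left flip: mult.assoc)
    then have "f x + g x = (A + B) * (s * (f x / A) + t * (g x / B))"
      using A B by simp
    then have "(f x + g x) powr p = (A + B) powr p * (s * (f x / A) + t * (g x / B)) powr p"
      using A B st f(2)[OF x] g(2)[OF x] by (simp add: powr_mult)
    also have "(s * (f x / A) + t * (g x / B)) powr p
        \<le> s * (f x / A) powr p + t * (g x / B) powr p"
      using A B st f(2)[OF x] g(2)[OF x] p by (intro powr_convex_combination_le) auto
    finally show ?thesis
      using A B f(2)[OF x] g(2)[OF x] by (simp add: powr_divide)
  qed
  have if_: "integrable M (\<lambda>x. f x powr p)" and ig: "integrable M (\<lambda>x. g x powr p)"
    using integrable_powr_bounded[OF f] integrable_powr_bounded[OF g] p by auto
  have "expectation (\<lambda>x. (f x + g x) powr p)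
     \<le> expectation (\<lambda>x. (A + B) powr p * (s * (f x powr p / A powr p) + t * (g x powr p / B powr p)))"
  proof (rule integral_mono)
    show "integrable M (\<lambda>x. (f x + g x) powr p)"
      using f g p by (intro integrable_powr_bounded[where B="F + G"]) (auto intro: add_mono)
  qed (use if_ ig pw in auto)
  also have "\<dots> = (A + B) powr p * (s * (expectation (\<lambda>x. f x powr p) / A powr p)
      + t * (expectation (\<lambda>x. g x powr p) / B powr p))"
    using if_ ig by simp
  also have "\<dots> \<le> (A + B) powr p * (s * 1 + t * 1)"
    using A B st by (intro mult_left_mono add_mono) auto
  finally show ?thesis using st by simp
qed

section \<open>Couplings given by densities\<close>

lemma density_in_couplings:
  assumes "prob_space \<mu>" "prob_space \<nu>"
    and k[measurable]: "k \<in> borel_measurable (\<mu> \<Otimes>\<^sub>M \<nu>)"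
    and 1: "AE y in \<mu>. (\<integral>\<^sup>+z. k (y, z) \<partial>\<nu>) = 1"
    and 2: "AE z in \<nu>. (\<integral>\<^sup>+y. k (y, z) \<partial>\<mu>) = 1"
  shows "density (\<mu> \<Otimes>\<^sub>M \<nu>) k \<in> couplings \<mu> \<nu>"
proof -
  interpret \<mu>: prob_space \<mu> by fact
  interpret \<nu>: prob_space \<nu> by fact
  interpret P: pair_prob_space \<mu> \<nu> ..
  have "distr (density (\<mu> \<Otimes>\<^sub>M \<nu>) k) \<mu> fst = \<mu>"
  proof (rule measure_eqI)
    fix A assume "A \<in> sets (distr (density (\<mu> \<Otimes>\<^sub>M \<nu>) k) \<mu> fst)"
    then have A[measurable]: "A \<in> sets \<mu>" by simp
    have "emeasure (distr (density (\<mu> \<Otimes>\<^sub>M \<nu>) k) \<mu> fst) A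
        = (\<integral>\<^sup>+w. k w * indicator (fst -` A \<inter> space (\<mu> \<Otimes>\<^sub>M \<nu>)) w \<partial>(\<mu> \<Otimes>\<^sub>M \<nu>))"
      by (simp add: emeasure_distr emeasure_density)
    also have "\<dots> = (\<integral>\<^sup>+w. k w * indicator A (fst w) \<partial>(\<mu> \<Otimes>\<^sub>M \<nu>))"
      by (intro nn_integral_cong) (auto split: split_indicator)
    also have "\<dots> = (\<integral>\<^sup>+y. (\<integral>\<^sup>+z. k (y, z) * indicator A y \<partial>\<nu>) \<partial>\<mu>)"
      by (subst \<nu>.nn_integral_fst[symmetric]) auto
    also have "\<dots> = (\<integral>\<^sup>+y. indicator A y \<partial>\<mu>)"
      using 1 by (intro nn_integral_cong_AE) (auto simp: nn_integral_multc)
    finally show "emeasure (distr (density (\<mu> \<Otimes>\<^sub>M \<nu>) k) \<mu> fst) A = emeasure \<mu> A"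
      by simp
  qed simp
  moreover have "distr (density (\<mu> \<Otimes>\<^sub>M \<nu>) k) \<nu> snd = \<nu>"
  proof (rule measure_eqI)
    fix A assume "A \<in> sets (distr (density (\<mu> \<Otimes>\<^sub>M \<nu>) k) \<nu> snd)"
    then have A[measurable]: "A \<in> sets \<nu>" by simp
    have "emeasure (distr (density (\<mu> \<Otimes>\<^sub>M \<nu>) k) \<nu> snd) A
        = (\<integral>\<^sup>+w. k w * indicator (snd -` A \<inter> space (\<mu> \<Otimes>\<^sub>M \<nu>)) w \<partial>(\<mu> \<Otimes>\<^sub>M \<nu>))"
      by (simp add: emeasure_distr emeasure_density)
    also have "\<dots> = (\<integral>\<^sup>+w. k w * indicator A (snd w) \<partial>(\<mu> \<Otimes>\<^sub>M \<nu>))"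
      by (intro nn_integral_cong) (auto split: split_indicator)
    also have "\<dots> = (\<integral>\<^sup>+z. (\<integral>\<^sup>+y. k (y, z) * indicator A z \<partial>\<mu>) \<partial>\<nu>)"
      by (subst P.nn_integral_snd[symmetric]) (auto simp: case_prod_beta)
    also have "\<dots> = (\<integral>\<^sup>+z. indicator A z \<partial>\<nu>)"
      using 2 by (intro nn_integral_cong_AE) (auto simp: nn_integral_multc)
    finally show "emeasure (distr (density (\<mu> \<Otimes>\<^sub>M \<nu>) k) \<nu> snd) A = emeasure \<nu> A"
      by simp
  qed simp
  ultimately show ?thesis by (simp add: couplings_def)
qed

text \<open>Gluing along a discrete label: draw the label \<open>n\<close>, then draw the two points independently from
\<open>\<mu>\<close> conditioned on \<open>f = n\<close> and from \<open>\<nu>\<close> conditioned on \<open>g = n\<close>. When the label is the cell that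
contains the middle point of two couplings, the two middle points end up in the same cell.\<close>

lemma conditionally_independent_coupling:
  fixes f :: "'a \<Rightarrow> nat" and g :: "'b \<Rightarrow> nat"
  assumes "prob_space \<mu>" "prob_space \<nu>"
    and f[measurable]: "f \<in> \<mu> \<rightarrow>\<^sub>M count_space UNIV" and g[measurable]: "g \<in> \<nu> \<rightarrow>\<^sub>M count_space UNIV"
    and eq: "distr \<mu> (count_space UNIV) f = distr \<nu> (count_space UNIV) g"
  shows "\<exists>\<pi>\<in>couplings \<mu> \<nu>. AE w in \<pi>. f (fst w) = g (snd w)"
proof -
  interpret \<mu>: prob_space \<mu> by fact
  interpret \<nu>: prob_space \<nu> by fact
  define q where "q n = emeasure \<nu> {y \<in> space \<nu>. g y = n}" for n
  have q': "q n = emeasure \<mu> {x \<in> space \<mu>. f x = n}" for n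
  proof -
    have "emeasure (distr \<mu> (count_space UNIV) f) {n} = emeasure (distr \<nu> (count_space UNIV) g) {n}"
      using eq by simp
    moreover have "f -` {n} \<inter> space \<mu> = {x \<in> space \<mu>. f x = n}" "g -` {n} \<inter> space \<nu> = {y \<in> space \<nu>. g y = n}"
      by auto
    ultimately show ?thesis by (simp add: emeasure_distr q_def)
  qed
  have qfin: "q n \<noteq> \<infinity>" for n by (simp add: q_def)
  define k where "k w = (if f (fst w) = g (snd w) then 1 / q (g (snd w)) else 0)" for w
  have [measurable]: "k \<in> borel_measurable (\<mu> \<Otimes>\<^sub>M \<nu>)"
  proof -
    have "{w \<in> space (\<mu> \<Otimes>\<^sub>M \<nu>). f (fst w) = g (snd w)}
       = (\<Union>n. {w \<in> space (\<mu> \<Otimes>\<^sub>M \<nu>). f (fst w) = n} \<inter> {w \<in> space (\<mu> \<Otimes>\<^sub>M \<nu>). g (snd w) = n})"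
      by auto
    also have "\<dots> \<in> sets (\<mu> \<Otimes>\<^sub>M \<nu>)"
      by (intro sets.countable_UN image_subsetI sets.Int) measurable
    finally have eq_set: "{w \<in> space (\<mu> \<Otimes>\<^sub>M \<nu>). f (fst w) = g (snd w)} \<in> sets (\<mu> \<Otimes>\<^sub>M \<nu>)" .
    have "(\<lambda>w. 1 / q (g (snd w))) \<in> borel_measurable (\<mu> \<Otimes>\<^sub>M \<nu>)"
      by (rule measurable_compose[OF measurable_snd measurable_compose[OF g]]) simp
    then show ?thesis
      unfolding k_def using eq_set by (intro measurable_If) simp_all
  qed
  have inv: "1 / q n * q n = 1" if "q n \<noteq> 0" for n
    using that qfin[of n] by (simp add: ennreal_divide_times top.not_eq_extremum)
  have "density (\<mu> \<Otimes>\<^sub>M \<nu>) k \<in> couplings \<mu> \<nu>"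
  proof (rule density_in_couplings)
    have "AE x in \<mu>. \<forall>n. q n = 0 \<longrightarrow> f x \<noteq> n"
      unfolding AE_all_countable
    proof
      fix n
      show "AE x in \<mu>. q n = 0 \<longrightarrow> f x \<noteq> n"
        by (cases "q n = 0") (auto simp: q' intro!: AE_I[where N="{x \<in> space \<mu>. f x = n}"])
    qed
    then show "AE y in \<mu>. (\<integral>\<^sup>+z. k (y, z) \<partial>\<nu>) = 1"
    proof eventually_elim
      case (elim x)
      have "(\<integral>\<^sup>+z. k (x, z) \<partial>\<nu>) = (\<integral>\<^sup>+z. 1 / q (f x) * indicator {y \<in> space \<nu>. g y = f x} z \<partial>\<nu>)"
        by (intro nn_integral_cong) (auto simp: k_def split: split_indicator)
      also have "\<dots> = 1 / q (f x) * q (f x)"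
        by (subst nn_integral_cmult_indicator) (auto simp: q_def)
      finally show ?case using elim inv by auto
    qed
    have "AE x in \<nu>. \<forall>n. q n = 0 \<longrightarrow> g x \<noteq> n"
      unfolding AE_all_countable
    proof
      fix n
      show "AE x in \<nu>. q n = 0 \<longrightarrow> g x \<noteq> n"
        by (cases "q n = 0") (auto simp: q_def intro!: AE_I[where N="{x \<in> space \<nu>. g x = n}"])
    qed
    then show "AE z in \<nu>. (\<integral>\<^sup>+y. k (y, z) \<partial>\<mu>) = 1"
    proof eventually_elim
      case (elim z)
      have "(\<integral>\<^sup>+y. k (y, z) \<partial>\<mu>) = (\<integral>\<^sup>+y. 1 / q (g z) * indicator {y \<in> space \<mu>. f y = g z} y \<partial>\<mu>)"
        by (intro nn_integral_cong) (auto simp: k_def split: split_indicator)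
      also have "\<dots> = 1 / q (g z) * q (g z)"
        by (subst nn_integral_cmult_indicator) (auto simp: q')
      finally show ?case using elim inv by auto
    qed
  qed (simp_all add: assms)
  moreover have "AE w in density (\<mu> \<Otimes>\<^sub>M \<nu>) k. f (fst w) = g (snd w)"
    by (subst AE_density) (auto simp: k_def)
  ultimately show ?thesis by blast
qed

section \<open>The Wasserstein metric of a compact Euclidean set\<close>

text \<open>The measures are arbitrary because \<^const>\<open>Metric_space\<close> asks for symmetry at all arguments, not
only at those in the carrier. Exchanging the components is a bijection of couplings.\<close>

lemma wasserstein_commute:
  assumes "\<And>x y. d x y = d y x"
  shows "wasserstein d p \<mu> \<nu> = wasserstein d p \<nu> \<mu>"
proof -
  have "(\<lambda>\<pi>. LINT z|\<pi>. d (fst z) (snd z) powr p) ` couplings \<mu> \<nu>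
      \<subseteq> (\<lambda>\<pi>. LINT z|\<pi>. d (fst z) (snd z) powr p) ` couplings \<nu> \<mu>" for \<mu> \<nu> :: "'a measure"
  proof safe
    fix \<pi> assume "\<pi> \<in> couplings \<mu> \<nu>"
    then have s[measurable_cong]: "sets \<pi> = sets (\<mu> \<Otimes>\<^sub>M \<nu>)"
      and 1: "distr \<pi> \<mu> fst = \<mu>" and 2: "distr \<pi> \<nu> snd = \<nu>"
      by (auto simp: couplings_def)
    let ?s = "\<lambda>z::'a \<times> 'a. (snd z, fst z)"
    define \<pi>' where "\<pi>' = distr \<pi> (\<nu> \<Otimes>\<^sub>M \<mu>) ?s"
    have sw: "?s \<in> \<pi> \<rightarrow>\<^sub>M \<nu> \<Otimes>\<^sub>M \<mu>"
      by measurable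
    have sw': "?s \<in> \<nu> \<Otimes>\<^sub>M \<mu> \<rightarrow>\<^sub>M \<pi>"
      by measurable
    have "distr \<pi>' \<nu> fst = \<nu>"
      unfolding \<pi>'_def by (subst distr_distr[OF measurable_fst sw]) (simp add: comp_def 2)
    moreover have "distr \<pi>' \<mu> snd = \<mu>"
      unfolding \<pi>'_def by (subst distr_distr[OF measurable_snd sw]) (simp add: comp_def 1)
    ultimately have mem: "\<pi>' \<in> couplings \<nu> \<mu>" by (simp add: couplings_def \<pi>'_def)
    let ?f = "\<lambda>z. d (fst z) (snd z) powr p"
    have f: "?f (?s z) = ?f z" for z by (simp add: assms)
    \<comment> \<open>A cost that is not measurable integrates to zero on both sides.\<close>
    have "integral\<^sup>L \<pi>' ?f = integral\<^sup>L \<pi> ?f"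
    proof (cases "?f \<in> borel_measurable (\<nu> \<Otimes>\<^sub>M \<mu>)")
      case True
      then show ?thesis unfolding \<pi>'_def by (subst integral_distr[OF sw]) (simp_all add: assms)
    next
      case False
      have "?f \<notin> borel_measurable \<pi>"
      proof
        assume "?f \<in> borel_measurable \<pi>"
        then have "(\<lambda>z. ?f (?s z)) \<in> borel_measurable (\<nu> \<Otimes>\<^sub>M \<mu>)"
          by (rule measurable_compose[OF sw'])
        then show False using False by (simp only: f)
      qed
      moreover have "?f \<notin> borel_measurable \<pi>'"
        unfolding \<pi>'_def measurable_distr_eq1 by (rule False)
      ultimately have "\<not> integrable \<pi> ?f" "\<not> integrable \<pi>' ?f"
        using borel_measurable_integrable by blast+
      then show ?thesis by (simp add: not_integrable_integral_eq)
    qed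
    then show "integral\<^sup>L \<pi> ?f \<in> (\<lambda>\<pi>. integral\<^sup>L \<pi> ?f) ` couplings \<nu> \<mu>"
      by (intro image_eqI[OF _ mem]) simp
  qed
  then have "(\<lambda>\<pi>. LINT z|\<pi>. d (fst z) (snd z) powr p) ` couplings \<mu> \<nu>
      = (\<lambda>\<pi>. LINT z|\<pi>. d (fst z) (snd z) powr p) ` couplings \<nu> \<mu>"
    by (intro subset_antisym) auto
  then show ?thesis unfolding wasserstein_def by simp
qed

lemma in_borel_probs_iff: "\<mu> \<in> borel_probs X \<longleftrightarrow> prob_space \<mu> \<and> sets \<mu> = sets (restrict_space borel X)"
  by (auto simp: borel_probs_def space_prob_algebra)

lemma borel_probs_space: "\<mu> \<in> borel_probs X \<Longrightarrow> space \<mu> = X"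
  using sets_eq_imp_space_eq[of \<mu> "restrict_space borel X"] by (auto simp: in_borel_probs_iff space_restrict_space)

lemma couplings_prob_space:
  assumes "\<pi> \<in> couplings \<mu> \<nu>" "prob_space \<mu>"
  shows "prob_space \<pi>"
proof -
  have "sets \<pi> = sets (\<mu> \<Otimes>\<^sub>M \<nu>)" "distr \<pi> \<mu> fst = \<mu>"
    using assms by (auto simp: couplings_def)
  then show ?thesis
    using prob_space_distrD[of fst \<pi> \<mu>] assms by (auto simp: measurable_cong_sets[of \<pi> "\<mu> \<Otimes>\<^sub>M \<nu>" \<mu> \<mu>])
qed

lemma couplings_nonempty:
  assumes "prob_space \<mu>" "prob_space \<nu>"
  shows "\<mu> \<Otimes>\<^sub>M \<nu> \<in> couplings \<mu> \<nu>"
  using density_in_couplings[OF assms, of "\<lambda>_. 1"] assms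
  by (simp add: density_1 prob_space.emeasure_space_1)

lemma pair_map_in_couplings:
  assumes [measurable]: "f \<in> M \<rightarrow>\<^sub>M N" "g \<in> M \<rightarrow>\<^sub>M L"
  shows "distr M (N \<Otimes>\<^sub>M L) (\<lambda>x. (f x, g x)) \<in> couplings (distr M N f) (distr M L g)"
proof -
  let ?\<pi> = "distr M (N \<Otimes>\<^sub>M L) (\<lambda>x. (f x, g x))"
  have "sets ?\<pi> = sets (distr M N f \<Otimes>\<^sub>M distr M L g)"
    by (simp cong: sets_pair_measure_cong)
  moreover have "distr ?\<pi> (distr M N f) fst = distr M N f"
  proof -
    have "distr ?\<pi> (distr M N f) fst = distr ?\<pi> N fst"
      by (intro distr_cong) simp_all
    also have "\<dots> = distr M N f"
      by (subst distr_distr) (simp_all add: comp_def)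
    finally show ?thesis .
  qed
  moreover have "distr ?\<pi> (distr M L g) snd = distr M L g"
  proof -
    have "distr ?\<pi> (distr M L g) snd = distr ?\<pi> L snd"
      by (intro distr_cong) simp_all
    also have "\<dots> = distr M L g"
      by (subst distr_distr) (simp_all add: comp_def)
    finally show ?thesis .
  qed
  ultimately show ?thesis by (simp add: couplings_def)
qed

lemma couplings_map:
  assumes \<pi>: "\<pi> \<in> couplings \<mu> \<nu>" and [measurable]: "f \<in> \<mu> \<rightarrow>\<^sub>M N" "g \<in> \<nu> \<rightarrow>\<^sub>M L"
  shows "distr \<pi> (N \<Otimes>\<^sub>M L) (\<lambda>w. (f (fst w), g (snd w))) \<in> couplings (distr \<mu> N f) (distr \<nu> L g)"
proof -
  have [measurable_cong]: "sets \<pi> = sets (\<mu> \<Otimes>\<^sub>M \<nu>)"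
    and 1: "distr \<pi> \<mu> fst = \<mu>" and 2: "distr \<pi> \<nu> snd = \<nu>"
    using \<pi> by (auto simp: couplings_def)
  have "distr \<mu> N f = distr (distr \<pi> \<mu> fst) N f" by (simp add: 1)
  also have "\<dots> = distr \<pi> N (\<lambda>w. f (fst w))"
    by (subst distr_distr) (simp_all add: comp_def)
  finally have N: "distr \<mu> N f = distr \<pi> N (\<lambda>w. f (fst w))" .
  have "distr \<nu> L g = distr (distr \<pi> \<nu> snd) L g" by (simp add: 2)
  also have "\<dots> = distr \<pi> L (\<lambda>w. g (snd w))"
    by (subst distr_distr) (simp_all add: comp_def)
  finally have L: "distr \<nu> L g = distr \<pi> L (\<lambda>w. g (snd w))" .
  show ?thesis unfolding N L by (rule pair_map_in_couplings) measurable
qed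

text \<open>The common setting of the ordinary distance on \<open>[-1, 1]\<close> and the geodesic distance on the sphere.
The lower comparison with \<^const>\<open>dist\<close> keeps points that are close for \<open>d\<close> in a Euclidean neighbourhood,
the upper one makes small Euclidean cells small for \<open>d\<close>.\<close>

locale comparable_metric =
  fixes X :: "'a::euclidean_space set" and d :: "'a \<Rightarrow> 'a \<Rightarrow> real" and K D :: real
  assumes closed: "closed X"
    and cost_measurable: "(\<lambda>z. d (fst z) (snd z)) \<in> borel_measurable (restrict_space borel X \<Otimes>\<^sub>M restrict_space borel X)"
    and commute: "\<And>x y. d x y = d y x"
    and triangle: "\<And>x y z. x \<in> X \<Longrightarrow> y \<in> X \<Longrightarrow> z \<in> X \<Longrightarrow> d x z \<le> d x y + d y z"
    and dist_le: "\<And>x y. x \<in> X \<Longrightarrow> y \<in> X \<Longrightarrow> dist x y \<le> d x y"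
    and le_dist: "\<And>x y. x \<in> X \<Longrightarrow> y \<in> X \<Longrightarrow> d x y \<le> K * dist x y"
    and bounded: "\<And>x y. x \<in> X \<Longrightarrow> y \<in> X \<Longrightarrow> d x y \<le> D"
begin

abbreviation cost :: "real \<Rightarrow> ('a \<times> 'a) measure \<Rightarrow> real" where
  "cost p \<pi> \<equiv> LINT z|\<pi>. d (fst z) (snd z) powr p"

lemma nonneg: "x \<in> X \<Longrightarrow> y \<in> X \<Longrightarrow> 0 \<le> d x y"
  using dist_le[of x y] zero_le_dist[of x y] by linarith

lemma d_self: "x \<in> X \<Longrightarrow> d x x = 0"
  using dist_le[of x x] le_dist[of x x] by simp

context
  fixes \<mu> \<nu> :: "'a measure" and \<pi> :: "('a \<times> 'a) measure"
  assumes \<mu>: "\<mu> \<in> borel_probs X" and \<nu>: "\<nu> \<in> borel_probs X" and \<pi>: "\<pi> \<in> couplings \<mu> \<nu>"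
begin

lemma coupling_sets: "sets \<pi> = sets (restrict_space borel X \<Otimes>\<^sub>M restrict_space borel X)"
  using \<mu> \<nu> \<pi> sets_pair_measure_cong[of \<mu> "restrict_space borel X" \<nu> "restrict_space borel X"]
  by (auto simp: couplings_def in_borel_probs_iff)

lemma coupling_space: "space \<pi> = X \<times> X"
  using sets_eq_imp_space_eq[OF coupling_sets] by (simp add: space_pair_measure space_restrict_space)

lemma coupling_prob: "prob_space \<pi>"
  using couplings_prob_space[OF \<pi>] \<mu> by (simp add: in_borel_probs_iff)

lemma coupling_cost_measurable: "(\<lambda>z. d (fst z) (snd z)) \<in> borel_measurable \<pi>"
  using cost_measurable by (simp add: measurable_cong_sets[OF coupling_sets refl])

lemma coupling_integrable: "p \<ge> 0 \<Longrightarrow> integrable \<pi> (\<lambda>z. d (fst z) (snd z) powr p)"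
  using prob_space.integrable_powr_bounded[OF coupling_prob coupling_cost_measurable, of D p]
  by (auto simp: coupling_space nonneg bounded)

lemma bdd_below_cost: "bdd_below (cost p ` couplings \<mu> \<nu>)"
  by (rule bdd_belowI[of _ 0]) auto

lemma wasserstein_powr_le_cost:
  assumes "p > 0"
  shows "wasserstein d p \<mu> \<nu> powr p \<le> cost p \<pi>"
proof -
  have "0 \<le> (INF \<pi>\<in>couplings \<mu> \<nu>. cost p \<pi>)"
    using \<pi> by (intro cINF_greatest) auto
  then have "wasserstein d p \<mu> \<nu> powr p = (INF \<pi>\<in>couplings \<mu> \<nu>. cost p \<pi>)"
    using assms by (simp add: wasserstein_def powr_powr)
  also have "\<dots> \<le> cost p \<pi>"
    using \<pi> by (intro cINF_lower bdd_below_cost)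
  finally show ?thesis .
qed

lemma wasserstein_le_if_cost_le:
  assumes "p > 0" "cost p \<pi> \<le> A powr p" "A \<ge> 0"
  shows "wasserstein d p \<mu> \<nu> \<le> A"
proof -
  have "wasserstein d p \<mu> \<nu> powr p \<le> A powr p"
    using wasserstein_powr_le_cost assms by fastforce
  then show ?thesis using assms by (meson linorder_not_le powr_less_mono2)
qed

end

lemma wasserstein_nonneg: "0 \<le> wasserstein d p \<mu> \<nu>"
  by (simp add: wasserstein_def)

lemma wasserstein_greatest:
  assumes \<mu>: "\<mu> \<in> borel_probs X" and \<nu>: "\<nu> \<in> borel_probs X" and p: "p > 0"
    and "\<And>\<pi>. \<pi> \<in> couplings \<mu> \<nu> \<Longrightarrow> A \<le> cost p \<pi>" "A \<ge> 0"
  shows "A \<le> wasserstein d p \<mu> \<nu> powr p"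
proof -
  have "couplings \<mu> \<nu> \<noteq> {}"
    using couplings_nonempty \<mu> \<nu> by (metis empty_iff in_borel_probs_iff)
  then have le: "A \<le> (INF \<pi>\<in>couplings \<mu> \<nu>. cost p \<pi>)"
    using assms by (intro cINF_greatest) auto
  then have "(INF \<pi>\<in>couplings \<mu> \<nu>. cost p \<pi>) = wasserstein d p \<mu> \<nu> powr p"
    using p \<open>A \<ge> 0\<close> by (simp add: wasserstein_def powr_powr)
  then show ?thesis using le by simp
qed

text \<open>A substitute for optimal couplings: any number above the distance is the bound for some coupling.\<close>

lemma near_optimal_coupling:
  assumes \<mu>: "\<mu> \<in> borel_probs X" and \<nu>: "\<nu> \<in> borel_probs X" and p: "p > 0"
    and A: "wasserstein d p \<mu> \<nu> < A"
  shows "\<exists>\<pi>\<in>couplings \<mu> \<nu>. cost p \<pi> \<le> A powr p"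
proof (rule ccontr)
  assume "\<not> ?thesis"
  then have "A powr p \<le> wasserstein d p \<mu> \<nu> powr p"
    by (intro wasserstein_greatest[OF \<mu> \<nu> p]) auto
  moreover have "wasserstein d p \<mu> \<nu> powr p < A powr p"
    using A p wasserstein_nonneg by (intro powr_less_mono2) auto
  ultimately show False by simp
qed

lemma wasserstein_bounded:
  assumes \<mu>: "\<mu> \<in> borel_probs X" and \<nu>: "\<nu> \<in> borel_probs X" and p: "p > 0"
  shows "wasserstein d p \<mu> \<nu> \<le> D"
proof -
  have c: "\<mu> \<Otimes>\<^sub>M \<nu> \<in> couplings \<mu> \<nu>"
    using couplings_nonempty \<mu> \<nu> by (auto simp: in_borel_probs_iff)
  interpret prob_space "\<mu> \<Otimes>\<^sub>M \<nu>" by (rule coupling_prob[OF \<mu> \<nu> c])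
  have sp: "space (\<mu> \<Otimes>\<^sub>M \<nu>) = X \<times> X" by (rule coupling_space[OF \<mu> \<nu> c])
  have "X \<noteq> {}" using not_empty sp by auto
  then have D: "D \<ge> 0" using bounded nonneg by fastforce
  have "cost p (\<mu> \<Otimes>\<^sub>M \<nu>) \<le> expectation (\<lambda>_. D powr p)"
    using coupling_integrable[OF \<mu> \<nu> c] p
    by (intro integral_mono powr_mono2) (auto simp: sp nonneg bounded)
  also have "\<dots> = D powr p" by (simp add: prob_space)
  finally show ?thesis using D p by (intro wasserstein_le_if_cost_le[OF \<mu> \<nu> c]) auto
qed

text \<open>Label a point by the first member of a countable dense set that is close to it.\<close>

lemma countable_small_cells:
  assumes "e > 0"
  shows "\<exists>f::'a \<Rightarrow> nat. f \<in> borel \<rightarrow>\<^sub>M count_space UNIV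
     \<and> (\<forall>x\<in>X. \<forall>y\<in>X. f x = f y \<longrightarrow> d x y \<le> e)"
proof -
  obtain S :: "'a set" where S: "countable S" "\<And>U. open U \<Longrightarrow> U \<noteq> {} \<Longrightarrow> \<exists>s\<in>S. s \<in> U"
    using countable_dense_setE by metis
  have "S \<noteq> {}" using S(2)[of UNIV] by auto
  define s where "s = from_nat_into S"
  define e' where "e' = e / (2 * (\<bar>K\<bar> + 1))"
  have e': "e' > 0" using assms by (simp add: e'_def)
  have ex: "\<exists>n. dist (s n) x < e'" for x
  proof -
    obtain z where "z \<in> S" "z \<in> ball x e'"
      using S(2)[of "ball x e'"] e' by auto
    then show ?thesis
      using from_nat_into_surj[OF S(1), of z] by (auto simp: s_def dist_commute)
  qed
  define f where "f x = (LEAST n. dist (s n) x < e')" for x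
  have "f \<in> borel \<rightarrow>\<^sub>M count_space UNIV"
    unfolding f_def by measurable
  moreover have "d x y \<le> e" if "x \<in> X" "y \<in> X" "f x = f y" for x y
  proof -
    have "dist (s (f x)) x < e'" "dist (s (f x)) y < e'"
      using LeastI_ex[OF ex[of x]] LeastI_ex[OF ex[of y]] that(3) by (auto simp: f_def)
    then have "dist x y \<le> 2 * e'"
      using dist_triangle[of x y "s (f x)"] by (simp add: dist_commute)
    have "d x y \<le> K * dist x y" using le_dist that by simp
    also have "\<dots> \<le> (\<bar>K\<bar> + 1) * (2 * e')"
      using \<open>dist x y \<le> 2 * e'\<close> by (intro mult_mono) auto
    also have "\<dots> = e" by (simp add: e'_def add_nonneg_eq_0_iff field_simps)
    finally show ?thesis .
  qed
  ultimately show ?thesis by blast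
qed

text \<open>Glue near-optimal couplings of \<open>\<mu>, \<nu>\<close> and of \<open>\<nu>, \<rho>\<close> along small cells of the middle space. The two
middle points then have distance at most \<open>e / 3\<close>, and Minkowski's inequality adds the three steps.\<close>

lemma wasserstein_triangle:
  assumes \<mu>: "\<mu> \<in> borel_probs X" and \<nu>: "\<nu> \<in> borel_probs X" and \<rho>: "\<rho> \<in> borel_probs X" and p: "p \<ge> 1"
  shows "wasserstein d p \<mu> \<rho> \<le> wasserstein d p \<mu> \<nu> + wasserstein d p \<nu> \<rho>"
proof (rule field_le_epsilon)
  fix e :: real assume "e > 0"
  define A B where "A = wasserstein d p \<mu> \<nu> + e / 3" and "B = wasserstein d p \<nu> \<rho> + e / 3"
  have AB: "A > 0" "B > 0"
    using wasserstein_nonneg \<open>e > 0\<close> by (auto simp: A_def B_def intro!: add_nonneg_pos)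
  have p0: "p > 0" "p \<ge> 0" using p by auto
  obtain \<pi>1 where \<pi>1: "\<pi>1 \<in> couplings \<mu> \<nu>" and cost1: "cost p \<pi>1 \<le> A powr p"
    using near_optimal_coupling[OF \<mu> \<nu> p0(1), of A] \<open>e > 0\<close> by (auto simp: A_def)
  obtain \<pi>2 where \<pi>2: "\<pi>2 \<in> couplings \<nu> \<rho>" and cost2: "cost p \<pi>2 \<le> B powr p"
    using near_optimal_coupling[OF \<nu> \<rho> p0(1), of B] \<open>e > 0\<close> by (auto simp: B_def)
  obtain f :: "'a \<Rightarrow> nat" where f[measurable]: "f \<in> borel \<rightarrow>\<^sub>M count_space UNIV"
    and small: "\<And>x y. x \<in> X \<Longrightarrow> y \<in> X \<Longrightarrow> f x = f y \<Longrightarrow> d x y \<le> e / 3"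
    using countable_small_cells[of "e / 3"] \<open>e > 0\<close> by auto
  let ?X = "restrict_space borel X"
  have s[measurable_cong]: "sets \<mu> = sets ?X" "sets \<nu> = sets ?X" "sets \<rho> = sets ?X"
    using \<mu> \<nu> \<rho> by (auto simp: in_borel_probs_iff)
  have s'[measurable_cong]: "sets \<pi>1 = sets (?X \<Otimes>\<^sub>M ?X)" "sets \<pi>2 = sets (?X \<Otimes>\<^sub>M ?X)"
    using coupling_sets \<mu> \<nu> \<rho> \<pi>1 \<pi>2 by auto
  have [measurable]: "f \<in> ?X \<rightarrow>\<^sub>M count_space UNIV"
    by (rule measurable_restrict_space1) measurable
  have ps1: "prob_space \<pi>1" and ps2: "prob_space \<pi>2"
    using coupling_prob \<mu> \<nu> \<rho> \<pi>1 \<pi>2 by auto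
  have sp: "space \<pi>1 = X \<times> X" "space \<pi>2 = X \<times> X"
    using coupling_space \<mu> \<nu> \<rho> \<pi>1 \<pi>2 by auto
  have "distr \<pi>1 (count_space UNIV) (\<lambda>w. f (snd w)) = distr (distr \<pi>1 \<nu> snd) (count_space UNIV) f"
    by (subst distr_distr) (auto simp: comp_def)
  also have "\<dots> = distr (distr \<pi>2 \<nu> fst) (count_space UNIV) f"
    using \<pi>1 \<pi>2 by (simp add: couplings_def)
  also have "\<dots> = distr \<pi>2 (count_space UNIV) (\<lambda>w. f (fst w))"
    by (subst distr_distr) (auto simp: comp_def)
  finally obtain \<Gamma> where \<Gamma>: "\<Gamma> \<in> couplings \<pi>1 \<pi>2" and AE: "AE w in \<Gamma>. f (snd (fst w)) = f (fst (snd w))"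
    using conditionally_independent_coupling[OF ps1 ps2, of "\<lambda>w. f (snd w)" "\<lambda>w. f (fst w)"] by auto
  have sP: "sets \<Gamma> = sets (\<pi>1 \<Otimes>\<^sub>M \<pi>2)" and P1: "distr \<Gamma> \<pi>1 fst = \<pi>1" and P2: "distr \<Gamma> \<pi>2 snd = \<pi>2"
    using \<Gamma> by (auto simp: couplings_def)
  note sP[measurable_cong]
  interpret P: prob_space \<Gamma> by (rule couplings_prob_space[OF \<Gamma> ps1])
  interpret \<pi>2: prob_space \<pi>2 by fact
  have spP: "space \<Gamma> = (X \<times> X) \<times> (X \<times> X)"
    using sets_eq_imp_space_eq[OF sP] by (simp add: space_pair_measure sp)
  define \<pi> where "\<pi> = distr \<Gamma> (\<mu> \<Otimes>\<^sub>M \<rho>) (\<lambda>w. (fst (fst w), snd (snd w)))"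
  have \<pi>: "\<pi> \<in> couplings \<mu> \<rho>"
  proof -
    have "distr \<pi> \<mu> fst = distr (distr \<Gamma> \<pi>1 fst) \<mu> fst"
      unfolding \<pi>_def by (subst (1 2) distr_distr) (auto simp: comp_def)
    also have "\<dots> = \<mu>" using \<pi>1 by (simp add: P1 couplings_def)
    finally have 1: "distr \<pi> \<mu> fst = \<mu>" .
    have "distr \<pi> \<rho> snd = distr (distr \<Gamma> \<pi>2 snd) \<rho> snd"
      unfolding \<pi>_def by (subst (1 2) distr_distr) (auto simp: comp_def)
    also have "\<dots> = \<rho>" using \<pi>2 by (simp add: P2 couplings_def)
    finally show ?thesis using 1 by (simp add: couplings_def \<pi>_def)
  qed
  note [measurable] = cost_measurable
  have m1: "(\<lambda>w. d (fst (fst w)) (snd (fst w))) \<in> borel_measurable \<Gamma>"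
    using measurable_compose[OF _ cost_measurable, of fst \<Gamma>] by simp
  have m2: "(\<lambda>w. d (fst (snd w)) (snd (snd w))) \<in> borel_measurable \<Gamma>"
    using measurable_compose[OF _ cost_measurable, of snd \<Gamma>] by simp
  have m3: "(\<lambda>w. d (fst (fst w)) (snd (snd w))) \<in> borel_measurable \<Gamma>"
    using measurable_compose[OF _ cost_measurable, of "\<lambda>w. (fst (fst w), snd (snd w))" \<Gamma>] by simp
  have bounded2: "d x y + d x' y' \<le> 2 * D" if "x \<in> X" "y \<in> X" "x' \<in> X" "y' \<in> X" for x y x' y'
    using bounded[of x y] bounded[of x' y'] that by linarith
  have "cost p \<pi> = P.expectation (\<lambda>w. d (fst (fst w)) (snd (snd w)) powr p)"
    unfolding \<pi>_def by (subst integral_distr) simp_all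
  also have "\<dots> \<le> P.expectation (\<lambda>w. (d (fst (fst w)) (snd (fst w)) + (d (fst (snd w)) (snd (snd w)) + e / 3)) powr p)"
  proof (rule integral_mono_AE)
    show "integrable \<Gamma> (\<lambda>w. d (fst (fst w)) (snd (snd w)) powr p)"
      using m3 p0 by (intro P.integrable_powr_bounded[where B=D]) (auto simp: spP nonneg bounded)
    show "integrable \<Gamma> (\<lambda>w. (d (fst (fst w)) (snd (fst w)) + (d (fst (snd w)) (snd (snd w)) + e / 3)) powr p)"
      using m1 m2 p0 \<open>e > 0\<close>
      by (intro P.integrable_powr_bounded[where B="D + (D + e / 3)"])
         (use bounded2 in \<open>auto simp: spP nonneg intro!: add_nonneg_nonneg\<close>)
    show "AE w in \<Gamma>. d (fst (fst w)) (snd (snd w)) powr p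
       \<le> (d (fst (fst w)) (snd (fst w)) + (d (fst (snd w)) (snd (snd w)) + e / 3)) powr p"
      using AE
    proof (rule AE_mp, intro AE_I2 impI)
      fix w assume "w \<in> space \<Gamma>" and eq: "f (snd (fst w)) = f (fst (snd w))"
      then obtain x y y' z where w: "w = ((x, y), (y', z))" and X: "x \<in> X" "y \<in> X" "y' \<in> X" "z \<in> X"
        by (auto simp: spP)
      have "d x z \<le> d x y + (d y y' + d y' z)"
        using triangle[of x y z] triangle[of y y' z] X by linarith
      also have "\<dots> \<le> d x y + (d y' z + e / 3)"
        using small[of y y'] eq X by (simp add: w)
      finally show "d (fst (fst w)) (snd (snd w)) powr p
         \<le> (d (fst (fst w)) (snd (fst w)) + (d (fst (snd w)) (snd (snd w)) + e / 3)) powr p"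
        using X p0 nonneg by (intro powr_mono2) (auto simp: w)
    qed
  qed
  also have "\<dots> \<le> (A + (B + e / 3)) powr p"
  proof (rule P.minkowski_powr_le[where F=D and G="D + e / 3"])
    have "P.expectation (\<lambda>w. d (fst (fst w)) (snd (fst w)) powr p) = cost p (distr \<Gamma> \<pi>1 fst)"
      by (subst integral_distr) simp_all
    then show "P.expectation (\<lambda>w. d (fst (fst w)) (snd (fst w)) powr p) \<le> A powr p"
      using cost1 by (simp add: P1)
    have "P.expectation (\<lambda>w. (d (fst (snd w)) (snd (snd w)) + e / 3) powr p)
       = (LINT z|distr \<Gamma> \<pi>2 snd. (d (fst z) (snd z) + e / 3) powr p)"
      by (subst integral_distr) simp_all
    also have "\<dots> \<le> (B + e / 3) powr p"
      unfolding P2 using coupling_cost_measurable[OF \<nu> \<rho> \<pi>2] AB cost2 p \<open>e > 0\<close>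
      by (intro \<pi>2.minkowski_powr_le[where F=D and G="e / 3"]) (auto simp: sp nonneg bounded \<pi>2.prob_space)
    finally show "P.expectation (\<lambda>w. (d (fst (snd w)) (snd (snd w)) + e / 3) powr p) \<le> (B + e / 3) powr p" .
    show "A > 0" "B + e / 3 > 0" using AB \<open>e > 0\<close> by auto
    show "(\<lambda>w. d (fst (fst w)) (snd (fst w))) \<in> borel_measurable \<Gamma>" by (rule m1)
    show "(\<lambda>w. d (fst (snd w)) (snd (snd w)) + e / 3) \<in> borel_measurable \<Gamma>" using m2 by simp
  qed (use p \<open>e > 0\<close> in \<open>auto simp: spP nonneg bounded intro: add_nonneg_nonneg[OF nonneg]\<close>)
  finally have "wasserstein d p \<mu> \<rho> \<le> A + (B + e / 3)"
    using AB \<open>e > 0\<close> p0 by (intro wasserstein_le_if_cost_le[OF \<mu> \<rho> \<pi>]) auto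
  then show "wasserstein d p \<mu> \<rho> \<le> wasserstein d p \<mu> \<nu> + wasserstein d p \<nu> \<rho> + e"
    by (simp add: A_def B_def)
qed

lemma wasserstein_self:
  assumes \<mu>: "\<mu> \<in> borel_probs X" and p: "p > 0"
  shows "wasserstein d p \<mu> \<mu> = 0"
proof -
  have "distr \<mu> (\<mu> \<Otimes>\<^sub>M \<mu>) (\<lambda>x. (x, x)) \<in> couplings (distr \<mu> \<mu> (\<lambda>x. x)) (distr \<mu> \<mu> (\<lambda>x. x))"
    by (rule pair_map_in_couplings) simp_all
  then have \<pi>: "distr \<mu> (\<mu> \<Otimes>\<^sub>M \<mu>) (\<lambda>x. (x, x)) \<in> couplings \<mu> \<mu>" (is "?\<pi> \<in> _") by simp
  have "cost p ?\<pi> = (LINT x|\<mu>. d x x powr p)"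
    using coupling_cost_measurable[OF \<mu> \<mu> \<pi>] by (subst integral_distr) simp_all
  also have "\<dots> = (LINT x|\<mu>. 0)"
    using d_self by (intro Bochner_Integration.integral_cong) (simp_all add: borel_probs_space[OF \<mu>])
  finally have "wasserstein d p \<mu> \<mu> \<le> 0"
    using p by (intro wasserstein_le_if_cost_le[OF \<mu> \<mu> \<pi>]) simp_all
  then show ?thesis using wasserstein_nonneg[of p \<mu> \<mu>] by simp
qed

text \<open>There are couplings of arbitrarily small cost, so by Markov's inequality mass moves further than
\<open>1 / Suc n\<close> only with arbitrarily small probability. Hence the closed neighbourhood \<open>T n\<close> of \<open>C\<close> has at
least as much mass under \<open>\<nu>\<close> as \<open>C\<close> has under \<open>\<mu>\<close>, and these neighbourhoods decrease to \<open>C\<close>.\<close>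

lemma measure_closed_le:
  assumes \<mu>: "\<mu> \<in> borel_probs X" and \<nu>: "\<nu> \<in> borel_probs X" and p: "p > 0"
    and 0: "wasserstein d p \<mu> \<nu> = 0" and C: "closed C" "C \<subseteq> X" "C \<noteq> {}"
  shows "measure \<mu> C \<le> measure \<nu> C"
proof -
  let ?X = "restrict_space borel X"
  have s[measurable_cong]: "sets \<mu> = sets ?X" "sets \<nu> = sets ?X"
    using \<mu> \<nu> by (auto simp: in_borel_probs_iff)
  interpret \<nu>: prob_space \<nu> using \<nu> by (simp add: in_borel_probs_iff)
  have closed_sets: "B \<in> sets ?X" if "closed B" "B \<subseteq> X" for B
    using that closed by (simp add: sets_restrict_space_iff)
  define T where "T n = {x \<in> X. infdist x C \<le> 1 / real (Suc n)}" for n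
  have T: "T n \<in> sets ?X" for n
  proof (rule closed_sets)
    have "closed (X \<inter> {x. infdist x C \<le> 1 / real (Suc n)})"
      by (intro closed_Int closed closed_Collect_le continuous_intros)
    then show "closed (T n)" by (simp add: T_def Collect_conj_eq)
  qed (auto simp: T_def)
  have le: "measure \<mu> C \<le> measure \<nu> (T n)" for n
  proof (rule field_le_epsilon)
    fix e :: real assume "e > 0"
    define r where "r = 1 / real (Suc n)"
    have r: "r > 0" by (simp add: r_def)
    define A where "A = (e * r powr p) powr (1 / p)"
    have A: "A > 0" "A powr p = e * r powr p"
      using \<open>e > 0\<close> r p by (auto simp: A_def powr_powr)
    obtain \<pi> where \<pi>: "\<pi> \<in> couplings \<mu> \<nu>" and cost: "cost p \<pi> \<le> e * r powr p"
      using near_optimal_coupling[OF \<mu> \<nu> p, of A] A 0 by auto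
    note s\<pi>[measurable_cong] = coupling_sets[OF \<mu> \<nu> \<pi>]
    note sp = coupling_space[OF \<mu> \<nu> \<pi>]
    note [measurable] = coupling_cost_measurable[OF \<mu> \<nu> \<pi>]
    interpret \<pi>: prob_space \<pi> by (rule coupling_prob[OF \<mu> \<nu> \<pi>])
    have C': "C \<in> sets \<mu>" using closed_sets C by (simp add: s)
    have T': "T n \<in> sets \<nu>" using T by (simp add: s)
    have far: "{w \<in> space \<pi>. r powr p \<le> d (fst w) (snd w) powr p} \<in> sets \<pi>"
      by measurable
    have f1: "fst \<in> \<pi> \<rightarrow>\<^sub>M \<mu>" and f2: "snd \<in> \<pi> \<rightarrow>\<^sub>M \<nu>" by measurable
    have "measure \<mu> C = measure (distr \<pi> \<mu> fst) C" using \<pi> by (simp add: couplings_def)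
    also have "\<dots> = measure \<pi> (fst -` C \<inter> space \<pi>)" by (rule measure_distr[OF f1 C'])
    also have "\<dots> \<le> measure \<pi> ((snd -` T n \<inter> space \<pi>) \<union> {w \<in> space \<pi>. r powr p \<le> d (fst w) (snd w) powr p})"
    proof (rule \<pi>.finite_measure_mono)
      show "fst -` C \<inter> space \<pi> \<subseteq> (snd -` T n \<inter> space \<pi>) \<union> {w \<in> space \<pi>. r powr p \<le> d (fst w) (snd w) powr p}"
      proof
        fix w assume w: "w \<in> fst -` C \<inter> space \<pi>"
        then have X: "fst w \<in> X" "snd w \<in> X" "fst w \<in> C" by (auto simp: sp)
        show "w \<in> (snd -` T n \<inter> space \<pi>) \<union> {w \<in> space \<pi>. r powr p \<le> d (fst w) (snd w) powr p}"
        proof (cases "d (fst w) (snd w) < r")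
          case True
          have "infdist (snd w) C \<le> dist (snd w) (fst w)" using X by (intro infdist_le)
          also have "\<dots> \<le> r" using dist_le[of "fst w" "snd w"] X True by (simp add: dist_commute)
          finally show ?thesis using X w by (simp add: T_def r_def)
        next
          case False
          then show ?thesis using w r p by (auto intro!: powr_mono2)
        qed
      qed
    qed (use measurable_sets[OF f2 T'] far in auto)
    also have "\<dots> \<le> measure \<pi> (snd -` T n \<inter> space \<pi>) + measure \<pi> {w \<in> space \<pi>. r powr p \<le> d (fst w) (snd w) powr p}"
      using measurable_sets[OF f2 T'] far by (intro measure_Un_le)
    also have "measure \<pi> (snd -` T n \<inter> space \<pi>) = measure (distr \<pi> \<nu> snd) (T n)"
      by (rule measure_distr[OF f2 T', symmetric])
    also have "\<dots> = measure \<nu> (T n)" using \<pi> by (simp add: couplings_def)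
    also have "measure \<pi> {w \<in> space \<pi>. r powr p \<le> d (fst w) (snd w) powr p} \<le> cost p \<pi> / r powr p"
      using r coupling_integrable[OF \<mu> \<nu> \<pi>, of p] p
      by (intro integral_Markov_inequality_measure[where A="{}"]) auto
    also have "\<dots> \<le> e" using cost r by (simp add: field_simps)
    finally show "measure \<mu> C \<le> measure \<nu> (T n) + e" by simp
  qed
  have "(\<lambda>n. measure \<nu> (T n)) \<longlonglongrightarrow> measure \<nu> (\<Inter>n. T n)"
  proof (rule \<nu>.finite_Lim_measure_decseq)
    show "range T \<subseteq> sets \<nu>" using T by (auto simp: s)
    show "decseq T"
    proof (rule decseq_SucI)
      fix n show "T (Suc n) \<subseteq> T n"
        unfolding T_def by (auto intro: order_trans[OF _ divide_left_mono])
    qed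
  qed
  moreover have "(\<Inter>n. T n) = C"
  proof
    show "C \<subseteq> (\<Inter>n. T n)" using C by (auto simp: T_def)
    show "(\<Inter>n. T n) \<subseteq> C"
    proof
      fix x assume "x \<in> (\<Inter>n. T n)"
      then have "infdist x C \<le> 1 / real (Suc n)" for n by (auto simp: T_def)
      then have "infdist x C \<le> 0"
        using LIMSEQ_le_const[OF LIMSEQ_inverse_real_of_nat, of "infdist x C"] by (auto simp: inverse_eq_divide)
      then show "x \<in> C"
        using C in_closed_iff_infdist_zero[of C x] infdist_nonneg[of x C] by auto
    qed
  qed
  ultimately show ?thesis using le by (intro LIMSEQ_le_const) auto
qed

text \<open>The measures agree on closed sets, by the previous lemma in both directions, and closed sets
generate the Borel sets.\<close>

lemma wasserstein_eq_0D:
  assumes \<mu>: "\<mu> \<in> borel_probs X" and \<nu>: "\<nu> \<in> borel_probs X" and p: "p > 0"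
    and 0: "wasserstein d p \<mu> \<nu> = 0"
  shows "\<mu> = \<nu>"
proof -
  let ?X = "restrict_space borel X"
  have s[measurable_cong]: "sets \<mu> = sets ?X" "sets \<nu> = sets ?X"
    using \<mu> \<nu> by (auto simp: in_borel_probs_iff)
  interpret \<mu>: prob_space \<mu> using \<mu> by (simp add: in_borel_probs_iff)
  interpret \<nu>: prob_space \<nu> using \<nu> by (simp add: in_borel_probs_iff)
  have rev: "wasserstein d p \<nu> \<mu> = 0"
    by (subst wasserstein_commute) (rule commute, rule 0)
  have id: "(\<lambda>x. x) \<in> ?X \<rightarrow>\<^sub>M borel" by (rule measurable_restrict_space1) simp
  then have id': "(\<lambda>x. x) \<in> \<mu> \<rightarrow>\<^sub>M borel" "(\<lambda>x. x) \<in> \<nu> \<rightarrow>\<^sub>M borel"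
    by (simp_all cong: measurable_cong_sets)
  have eq: "distr \<mu> borel (\<lambda>x. x) = distr \<nu> borel (\<lambda>x. x)"
  proof (rule measure_eqI_generator_eq[where E="Collect closed" and \<Omega>=UNIV and A="\<lambda>_. UNIV"])
    show "Int_stable (Collect closed :: 'a set set)" by (auto simp: Int_stable_def)
    fix C :: "'a set" assume "C \<in> Collect closed"
    then have C: "closed C" by simp
    have "measure \<mu> (C \<inter> X) = measure \<nu> (C \<inter> X)"
    proof (cases "C \<inter> X = {}")
      case False
      then show ?thesis
        using C closed measure_closed_le[OF \<mu> \<nu> p 0, of "C \<inter> X"] measure_closed_le[OF \<nu> \<mu> p rev, of "C \<inter> X"]
        by (intro antisym) auto
    qed simp
    then show "emeasure (distr \<mu> borel (\<lambda>x. x)) C = emeasure (distr \<nu> borel (\<lambda>x. x)) C"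
      using C id' by (simp add: emeasure_distr borel_probs_space[OF \<mu>] borel_probs_space[OF \<nu>]
          \<mu>.emeasure_eq_measure \<nu>.emeasure_eq_measure)
  next
    show "emeasure (distr \<mu> borel (\<lambda>x. x)) UNIV \<noteq> \<infinity>" for i :: nat
      using id' by (simp add: emeasure_distr)
  qed (auto simp: borel_eq_closed)
  show ?thesis
  proof (rule measure_eqI)
    fix A assume "A \<in> sets \<mu>"
    then have A: "A \<in> sets borel" "A \<subseteq> X"
      using closed by (auto simp: s sets_restrict_space_iff borel_closed)
    then have "emeasure (distr \<mu> borel (\<lambda>x. x)) A = emeasure \<mu> A" "emeasure (distr \<nu> borel (\<lambda>x. x)) A = emeasure \<nu> A"
      using id' by (simp_all add: emeasure_distr borel_probs_space[OF \<mu>] borel_probs_space[OF \<nu>] Int_absorb2)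
    then show "emeasure \<mu> A = emeasure \<nu> A" by (simp add: eq)
  qed (simp add: s)
qed

lemma Metric_space_wasserstein:
  assumes "p \<ge> 1"
  shows "Metric_space (borel_probs X) (wasserstein d p)"
proof
  show "wasserstein d p \<mu> \<nu> = wasserstein d p \<nu> \<mu>" for \<mu> \<nu>
    by (rule wasserstein_commute) (rule commute)
  show "(wasserstein d p \<mu> \<nu> = 0) = (\<mu> = \<nu>)" if "\<mu> \<in> borel_probs X" "\<nu> \<in> borel_probs X" for \<mu> \<nu>
    using that assms wasserstein_eq_0D[of \<mu> \<nu> p] wasserstein_self[of \<mu> p] by auto
qed (use assms wasserstein_nonneg wasserstein_triangle in auto)

end

section \<open>Geodesic distance and slices of the sphere\<close>

lemma inner_unit_sphere_bounds:
  assumes "x \<in> unit_sphere" "y \<in> unit_sphere"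
  shows "-1 \<le> x \<bullet> y" "x \<bullet> y \<le> 1"
  using Cauchy_Schwarz_ineq2[of x y] assms by auto

lemma cos_geodesic_dist:
  assumes "x \<in> unit_sphere" "y \<in> unit_sphere"
  shows "cos (geodesic_dist x y) = x \<bullet> y" "0 \<le> geodesic_dist x y" "geodesic_dist x y \<le> pi"
  using inner_unit_sphere_bounds[OF assms]
  by (auto simp: geodesic_dist_def arccos_lbound arccos_ubound)

text \<open>A chord of the unit circle in terms of the angle that it subtends.\<close>

lemma dist_eq_sin_geodesic_dist:
  assumes "x \<in> unit_sphere" "y \<in> unit_sphere"
  shows "dist x y = 2 * sin (geodesic_dist x y / 2)"
proof -
  let ?a = "geodesic_dist x y"
  have "(dist x y)\<^sup>2 = x \<bullet> x + y \<bullet> y - 2 * (x \<bullet> y)"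
    by (simp add: dist_norm power2_norm_eq_inner inner_diff inner_commute)
  also have "\<dots> = 2 - 2 * cos ?a"
    using assms by (simp add: cos_geodesic_dist norm_eq_1)
  also have "cos ?a = 1 - 2 * (sin (?a / 2))\<^sup>2"
    using cos_double_sin[of "?a / 2"] by simp
  finally have "(dist x y)\<^sup>2 = (2 * sin (?a / 2))\<^sup>2" by (simp add: power_mult_distrib)
  moreover have "0 \<le> sin (?a / 2)"
    using cos_geodesic_dist[OF assms] by (intro sin_ge_zero) auto
  ultimately show ?thesis by - (rule power2_eq_imp_eq, auto)
qed

text \<open>The graph of the concave function \<^const>\<open>sin\<close> lies above its chord over \<open>[0, pi / 2]\<close>.\<close>

lemma jordan_sin_ge:
  fixes t :: real
  assumes "0 \<le> t" "t \<le> pi / 2"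
  shows "2 / pi * t \<le> sin t"
proof -
  have "convex_on {0..pi/2} (\<lambda>t. - sin t)"
    by (rule f''_ge0_imp_convex[where f'="\<lambda>t. - cos t" and f''="sin"])
       (auto intro!: derivative_eq_intros sin_ge_zero)
  then have "- sin ((1 - 2 / pi * t) *\<^sub>R 0 + (2 / pi * t) *\<^sub>R (pi / 2))
     \<le> (1 - 2 / pi * t) * - sin 0 + (2 / pi * t) * - sin (pi / 2)"
    using assms by (intro convex_onD) (auto simp: field_simps)
  then show ?thesis by simp
qed

text \<open>Remove from \<open>x\<close> and \<open>z\<close> their components along \<open>y\<close>; the remainders \<open>u\<close> and \<open>v\<close> have the sines
of the two angles as their norms. Cauchy-Schwarz for \<open>u\<close> and \<open>v\<close> says that \<open>x \<bullet> z\<close> is at least the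
cosine of the sum of the angles.\<close>

lemma geodesic_dist_triangle:
  fixes x y z :: "'a::euclidean_space"
  assumes "x \<in> unit_sphere" "y \<in> unit_sphere" "z \<in> unit_sphere"
  shows "geodesic_dist x z \<le> geodesic_dist x y + geodesic_dist y z"
proof (cases "geodesic_dist x y + geodesic_dist y z \<le> pi")
  case False
  then show ?thesis using cos_geodesic_dist(3)[of x z] assms by simp
next
  case True
  let ?a = "geodesic_dist x y" and ?b = "geodesic_dist y z"
  note a = cos_geodesic_dist[OF assms(1,2)] and b = cos_geodesic_dist[OF assms(2,3)]
  have n: "x \<bullet> x = 1" "y \<bullet> y = 1" "z \<bullet> z = 1" using assms by (auto simp: norm_eq_1)
  define u v where "u = x - cos ?a *\<^sub>R y" and "v = z - cos ?b *\<^sub>R y"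
  have "(norm u)\<^sup>2 = 1 - (cos ?a)\<^sup>2"
    by (simp add: u_def power2_norm_eq_inner inner_diff inner_commute n flip: a(1)) (simp add: power2_eq_square)
  then have nu: "norm u = sin ?a"
    using a sin_ge_zero[of ?a] by - (rule power2_eq_imp_eq, auto simp: sin_squared_eq)
  have "(norm v)\<^sup>2 = 1 - (cos ?b)\<^sup>2"
    using b(1) by (simp add: v_def power2_norm_eq_inner inner_diff inner_commute n) (simp add: power2_eq_square)
  then have nv: "norm v = sin ?b"
    using b sin_ge_zero[of ?b] by - (rule power2_eq_imp_eq, auto simp: sin_squared_eq)
  have "u \<bullet> v = x \<bullet> z - cos ?a * cos ?b"
    by (simp add: u_def v_def inner_diff n a(1) b(1) inner_commute[of z y] inner_commute[of z x])
  moreover have "- (norm u * norm v) \<le> u \<bullet> v"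
    using Cauchy_Schwarz_ineq2[of u v] by linarith
  ultimately have "cos (?a + ?b) \<le> x \<bullet> z"
    by (simp add: nu nv cos_add)
  then have "arccos (x \<bullet> z) \<le> arccos (cos (?a + ?b))"
    using inner_unit_sphere_bounds[OF assms(1,3)] by (intro arccos_le_arccos) auto
  also have "\<dots> = ?a + ?b" using True a b by (intro arccos_cos) auto
  finally show ?thesis by (simp add: geodesic_dist_def)
qed

lemma comparable_geodesic_dist:
  "comparable_metric (unit_sphere :: 'a::euclidean_space set) geodesic_dist (pi / 2) pi"
proof
  let ?S = "restrict_space borel (unit_sphere :: 'a set)"
  show "(\<lambda>z. geodesic_dist (fst z) (snd z)) \<in> borel_measurable (?S \<Otimes>\<^sub>M ?S)"
  proof -
    \<comment> \<open>Truncated to \<open>[-1, 1]\<close>, the argument stays where \<^const>\<open>arccos\<close> is continuous, and on the sphere nothing changes.\<close>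
    have c: "continuous_on UNIV (\<lambda>t. arccos (max (-1) (min 1 t)))"
      by (intro continuous_on_arccos continuous_intros) auto
    have "(\<lambda>z. fst z \<bullet> snd z) \<in> borel_measurable (?S \<Otimes>\<^sub>M ?S)"
      by (intro borel_measurable_inner measurable_compose[OF measurable_fst] measurable_compose[OF measurable_snd])
         (auto intro: measurable_restrict_space1)
    from measurable_compose[OF this borel_measurable_continuous_onI[OF c]]
    have "(\<lambda>z. arccos (max (-1) (min 1 (fst z \<bullet> snd z)))) \<in> borel_measurable (?S \<Otimes>\<^sub>M ?S)" .
    moreover have "arccos (max (-1) (min 1 (fst z \<bullet> snd z))) = geodesic_dist (fst z) (snd z)"
      if "z \<in> space (?S \<Otimes>\<^sub>M ?S)" for z
      using that inner_unit_sphere_bounds[of "fst z" "snd z"]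
      by (auto simp: space_pair_measure space_restrict_space geodesic_dist_def max_def min_def)
    ultimately show ?thesis by (simp cong: measurable_cong)
  qed
  show "geodesic_dist x y = geodesic_dist y x" for x y :: 'a
    by (simp add: geodesic_dist_def inner_commute)
  show "geodesic_dist x z \<le> geodesic_dist x y + geodesic_dist y z"
    if "x \<in> unit_sphere" "y \<in> unit_sphere" "z \<in> unit_sphere" for x y z :: 'a
    using geodesic_dist_triangle that .
  show "dist x y \<le> geodesic_dist x y" if "x \<in> unit_sphere" "y \<in> unit_sphere" for x y :: 'a
    using sin_x_le_x[of "geodesic_dist x y / 2"] cos_geodesic_dist[OF that]
    by (simp add: dist_eq_sin_geodesic_dist[OF that])
  show "geodesic_dist x y \<le> pi / 2 * dist x y" if "x \<in> unit_sphere" "y \<in> unit_sphere" for x y :: 'a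
    using jordan_sin_ge[of "geodesic_dist x y / 2"] cos_geodesic_dist[OF that]
    by (simp add: dist_eq_sin_geodesic_dist[OF that] field_simps)
  show "geodesic_dist x y \<le> pi" if "x \<in> unit_sphere" "y \<in> unit_sphere" for x y :: 'a
    using cos_geodesic_dist[OF that] by simp
qed simp

lemma comparable_dist_interval: "comparable_metric {-1..1::real} dist 1 2"
proof
  show "(\<lambda>z. dist (fst z) (snd z)) \<in> borel_measurable (restrict_space borel {-1..1::real} \<Otimes>\<^sub>M restrict_space borel {-1..1})"
    by (intro borel_measurable_dist measurable_compose[OF measurable_fst] measurable_compose[OF measurable_snd])
       (auto intro: measurable_restrict_space1)
qed (auto simp: dist_commute dist_triangle dist_real_def)

interpretation sphere: comparable_metric "unit_sphere :: 'a::euclidean_space set" geodesic_dist "pi / 2" pi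
  by (rule comparable_geodesic_dist)

interpretation interval: comparable_metric "{-1..1::real}" dist 1 2
  by (rule comparable_dist_interval)

lemma slice_measurable:
  assumes "\<psi> \<in> unit_sphere" "sets \<mu> = sets (restrict_space borel unit_sphere)"
  shows "slice \<psi> \<in> \<mu> \<rightarrow>\<^sub>M restrict_space borel {-1..1}"
proof -
  have "slice \<psi> \<in> restrict_space borel unit_sphere \<rightarrow>\<^sub>M restrict_space borel {-1..1}"
  proof (rule measurable_restrict_space2)
    show "slice \<psi> \<in> space (restrict_space borel unit_sphere) \<rightarrow> {-1..1}"
      using inner_unit_sphere_bounds assms(1) by (auto simp: space_restrict_space slice_def)
    show "slice \<psi> \<in> borel_measurable (restrict_space borel unit_sphere)"
      unfolding slice_def[abs_def] by (rule measurable_restrict_space1) simp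
  qed
  then show ?thesis by (simp add: measurable_cong_sets[OF assms(2) refl])
qed

lemma sliced_in_borel_probs:
  assumes \<psi>: "\<psi> \<in> unit_sphere" and \<mu>: "\<mu> \<in> borel_probs unit_sphere"
  shows "sliced \<psi> \<mu> \<in> borel_probs {-1..1}"
  using slice_measurable[OF \<psi>, of \<mu>] \<mu>
  by (auto simp: sliced_def in_borel_probs_iff intro: prob_space.prob_space_distr)

text \<open>Slices do not increase distances, so the image of a coupling under a slice costs no more.\<close>

lemma wasserstein_sliced_le:
  fixes \<mu> \<nu> :: "'a::euclidean_space measure"
  assumes \<psi>: "\<psi> \<in> unit_sphere" and \<mu>: "\<mu> \<in> borel_probs unit_sphere" and \<nu>: "\<nu> \<in> borel_probs unit_sphere"
    and p: "p > 0"
  shows "wasserstein dist p (sliced \<psi> \<mu>) (sliced \<psi> \<nu>) \<le> wasserstein geodesic_dist p \<mu> \<nu>"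
proof -
  let ?I = "restrict_space borel {-1..1::real}"
  let ?W = "wasserstein dist p (sliced \<psi> \<mu>) (sliced \<psi> \<nu>)"
  have "?W powr p \<le> wasserstein geodesic_dist p \<mu> \<nu> powr p"
  proof (rule sphere.wasserstein_greatest[OF \<mu> \<nu> p])
    fix \<pi> assume \<pi>: "\<pi> \<in> couplings \<mu> \<nu>"
    note sl = slice_measurable[OF \<psi>, of \<mu>] slice_measurable[OF \<psi>, of \<nu>]
    have s: "sets \<mu> = sets (restrict_space borel unit_sphere)" "sets \<nu> = sets (restrict_space borel unit_sphere)"
      using \<mu> \<nu> by (auto simp: in_borel_probs_iff)
    have [measurable_cong]: "sets \<pi> = sets (\<mu> \<Otimes>\<^sub>M \<nu>)" using \<pi> by (simp add: couplings_def)
    let ?h = "\<lambda>w. (slice \<psi> (fst w), slice \<psi> (snd w))"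
    let ?\<pi> = "distr \<pi> (?I \<Otimes>\<^sub>M ?I) ?h"
    have c: "?\<pi> \<in> couplings (sliced \<psi> \<mu>) (sliced \<psi> \<nu>)"
      unfolding sliced_def by (rule couplings_map[OF \<pi>]) (use sl s in auto)
    have h: "?h \<in> \<pi> \<rightarrow>\<^sub>M ?I \<Otimes>\<^sub>M ?I"
      using measurable_compose[OF measurable_fst sl(1)[OF s(1)], of \<nu>]
        measurable_compose[OF measurable_snd sl(2)[OF s(2)], of \<mu>] by measurable
    have "?W powr p \<le> (LINT z|?\<pi>. dist (fst z) (snd z) powr p)"
      by (rule interval.wasserstein_powr_le_cost[OF sliced_in_borel_probs[OF \<psi> \<mu>] sliced_in_borel_probs[OF \<psi> \<nu>] c p])
    also have "\<dots> = (LINT w|\<pi>. dist (slice \<psi> (fst w)) (slice \<psi> (snd w)) powr p)"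
      using interval.cost_measurable by (subst integral_distr[OF h]) auto
    also have "\<dots> \<le> sphere.cost p \<pi>"
    proof (rule integral_mono)
      have "integrable ?\<pi> (\<lambda>z. dist (fst z) (snd z) powr p)"
        using interval.coupling_integrable[OF sliced_in_borel_probs[OF \<psi> \<mu>] sliced_in_borel_probs[OF \<psi> \<nu>] c] p by simp
      then show "integrable \<pi> (\<lambda>w. dist (slice \<psi> (fst w)) (slice \<psi> (snd w)) powr p)"
        by (auto dest: integrable_distr[OF h])
      show "integrable \<pi> (\<lambda>z. geodesic_dist (fst z) (snd z) powr p)"
        using sphere.coupling_integrable[OF \<mu> \<nu> \<pi>] p by simp
      fix w assume "w \<in> space \<pi>"
      then have w: "fst w \<in> unit_sphere" "snd w \<in> unit_sphere"
        using sphere.coupling_space[OF \<mu> \<nu> \<pi>] by auto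
      have "dist (slice \<psi> (fst w)) (slice \<psi> (snd w)) = \<bar>(fst w - snd w) \<bullet> \<psi>\<bar>"
        by (simp add: slice_def dist_real_def inner_diff_left)
      also have "\<dots> \<le> dist (fst w) (snd w)"
        using Cauchy_Schwarz_ineq2[of "fst w - snd w" \<psi>] \<psi> by (simp add: dist_norm)
      also have "\<dots> \<le> geodesic_dist (fst w) (snd w)" using sphere.dist_le w by blast
      finally show "dist (slice \<psi> (fst w)) (slice \<psi> (snd w)) powr p \<le> geodesic_dist (fst w) (snd w) powr p"
        using p by (intro powr_mono2) auto
    qed
    finally show "?W powr p \<le> sphere.cost p \<pi>" .
  qed simp
  then show ?thesis
    using p sphere.wasserstein_nonneg[of p \<mu> \<nu>] by (meson linorder_not_le powr_less_mono2)
qed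

text \<open>Couple the two projections \<open>x \<bullet> \<psi>\<close> and \<open>x \<bullet> \<phi>\<close> of the same random point \<open>x\<close>.\<close>

lemma wasserstein_sliced_direction_le:
  fixes \<mu> :: "'a::euclidean_space measure"
  assumes \<psi>: "\<psi> \<in> unit_sphere" and \<phi>: "\<phi> \<in> unit_sphere" and \<mu>: "\<mu> \<in> borel_probs unit_sphere"
    and p: "p > 0"
  shows "wasserstein dist p (sliced \<psi> \<mu>) (sliced \<phi> \<mu>) \<le> dist \<psi> \<phi>"
proof -
  let ?I = "restrict_space borel {-1..1::real}"
  have s: "sets \<mu> = sets (restrict_space borel unit_sphere)"
    using \<mu> by (auto simp: in_borel_probs_iff)
  interpret prob_space \<mu> using \<mu> by (auto simp: in_borel_probs_iff)
  note sl = slice_measurable[OF \<psi> s] slice_measurable[OF \<phi> s]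
  let ?h = "\<lambda>x. (slice \<psi> x, slice \<phi> x)"
  let ?\<pi> = "distr \<mu> (?I \<Otimes>\<^sub>M ?I) ?h"
  have c: "?\<pi> \<in> couplings (sliced \<psi> \<mu>) (sliced \<phi> \<mu>)"
    unfolding sliced_def by (rule pair_map_in_couplings) (use sl in auto)
  have h: "?h \<in> \<mu> \<rightarrow>\<^sub>M ?I \<Otimes>\<^sub>M ?I" using sl by measurable
  note sp = sliced_in_borel_probs[OF \<psi> \<mu>] sliced_in_borel_probs[OF \<phi> \<mu>]
  have "(LINT z|?\<pi>. dist (fst z) (snd z) powr p) = expectation (\<lambda>x. dist (slice \<psi> x) (slice \<phi> x) powr p)"
    using interval.cost_measurable by (subst integral_distr[OF h]) auto
  also have "\<dots> \<le> expectation (\<lambda>_. dist \<psi> \<phi> powr p)"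
  proof (rule integral_mono)
    have "integrable ?\<pi> (\<lambda>z. dist (fst z) (snd z) powr p)"
      using interval.coupling_integrable[OF sp c] p by simp
    then show "integrable \<mu> (\<lambda>x. dist (slice \<psi> x) (slice \<phi> x) powr p)"
      by (auto dest: integrable_distr[OF h])
    fix x assume "x \<in> space \<mu>"
    then have x: "x \<in> unit_sphere" using borel_probs_space[OF \<mu>] by simp
    have "dist (slice \<psi> x) (slice \<phi> x) = \<bar>x \<bullet> (\<psi> - \<phi>)\<bar>"
      by (simp add: slice_def dist_real_def inner_diff_right)
    also have "\<dots> \<le> dist \<psi> \<phi>"
      using Cauchy_Schwarz_ineq2[of x "\<psi> - \<phi>"] x by (simp add: dist_norm)
    finally show "dist (slice \<psi> x) (slice \<phi> x) powr p \<le> dist \<psi> \<phi> powr p"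
      using p by (intro powr_mono2) auto
  qed simp
  also have "\<dots> = dist \<psi> \<phi> powr p" by (simp add: prob_space)
  finally show ?thesis
    using p by (intro interval.wasserstein_le_if_cost_le[OF sp c]) auto
qed

text \<open>The integrand of \<^const>\<open>PSW\<close> is Lipschitz in the direction. This makes it measurable, without
which the integral would be zero by convention.\<close>

lemma continuous_on_wasserstein_sliced:
  fixes \<mu> \<nu> :: "'a::euclidean_space measure"
  assumes \<mu>: "\<mu> \<in> borel_probs unit_sphere" and \<nu>: "\<nu> \<in> borel_probs unit_sphere" and p: "p \<ge> 1"
  shows "continuous_on unit_sphere (\<lambda>\<psi>. wasserstein dist p (sliced \<psi> \<mu>) (sliced \<psi> \<nu>))"
proof -
  have le: "wasserstein dist p (sliced \<psi> \<mu>) (sliced \<psi> \<nu>)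
      \<le> wasserstein dist p (sliced \<phi> \<mu>) (sliced \<phi> \<nu>) + 2 * dist \<psi> \<phi>"
    if \<psi>: "\<psi> \<in> unit_sphere" and \<phi>: "\<phi> \<in> unit_sphere" for \<psi> \<phi> :: 'a
  proof -
    note sp = sliced_in_borel_probs[OF \<psi> \<mu>] sliced_in_borel_probs[OF \<phi> \<mu>]
      sliced_in_borel_probs[OF \<psi> \<nu>] sliced_in_borel_probs[OF \<phi> \<nu>]
    have "wasserstein dist p (sliced \<psi> \<mu>) (sliced \<psi> \<nu>)
        \<le> wasserstein dist p (sliced \<psi> \<mu>) (sliced \<phi> \<mu>) + wasserstein dist p (sliced \<phi> \<mu>) (sliced \<psi> \<nu>)"
      using interval.wasserstein_triangle[OF sp(1,2,3) p] .
    also have "wasserstein dist p (sliced \<phi> \<mu>) (sliced \<psi> \<nu>)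
        \<le> wasserstein dist p (sliced \<phi> \<mu>) (sliced \<phi> \<nu>) + wasserstein dist p (sliced \<phi> \<nu>) (sliced \<psi> \<nu>)"
      using interval.wasserstein_triangle[OF sp(2,4,3) p] .
    finally show ?thesis
      using wasserstein_sliced_direction_le[OF \<psi> \<phi> \<mu>, of p] wasserstein_sliced_direction_le[OF \<phi> \<psi> \<nu>, of p] p
      by (simp add: dist_commute)
  qed
  have "2-lipschitz_on unit_sphere (\<lambda>\<psi>. wasserstein dist p (sliced \<psi> \<mu>) (sliced \<psi> \<nu>))"
  proof (rule lipschitz_onI)
    fix x y :: 'a assume "x \<in> unit_sphere" "y \<in> unit_sphere"
    then show "dist (wasserstein dist p (sliced x \<mu>) (sliced x \<nu>)) (wasserstein dist p (sliced y \<mu>) (sliced y \<nu>)) \<le> 2 * dist x y"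
      using le[of x y] le[of y x] by (simp add: dist_real_def dist_commute abs_le_iff)
  qed simp
  then show ?thesis by (rule lipschitz_on_continuous_on)
qed

lemma sets_sphere_uniform: "sets (sphere_uniform :: 'a::euclidean_space measure) = sets (restrict_space borel unit_sphere)"
  by (simp add: sphere_uniform_def sphere_surface_measure_def sets_scale_measure)

lemma space_sphere_uniform: "space (sphere_uniform :: 'a::euclidean_space measure) = unit_sphere"
  using sets_eq_imp_space_eq[OF sets_sphere_uniform] by (simp add: space_restrict_space)

lemma wasserstein_sliced_measurable:
  fixes \<mu> \<nu> :: "'a::euclidean_space measure"
  assumes "\<mu> \<in> borel_probs unit_sphere" "\<nu> \<in> borel_probs unit_sphere" "p \<ge> 1"
  shows "(\<lambda>\<psi>. wasserstein dist p (sliced \<psi> \<mu>) (sliced \<psi> \<nu>)) \<in> borel_measurable sphere_uniform"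
  using borel_measurable_continuous_on_restrict[OF continuous_on_wasserstein_sliced[OF assms]]
  by (simp add: measurable_cong_sets[OF sets_sphere_uniform refl])

lemma PSW_powr:
  assumes "p > 0"
  shows "PSW p \<mu> \<nu> powr p = (LINT \<psi>|sphere_uniform. wasserstein dist p (sliced \<psi> \<mu>) (sliced \<psi> \<nu>) powr p)"
  using assms by (simp add: PSW_def powr_powr)

lemma PSW_nonneg: "0 \<le> PSW p \<mu> \<nu>"
  by (simp add: PSW_def)

lemma PSW_commute: "PSW p \<mu> \<nu> = PSW p \<nu> \<mu>"
  unfolding PSW_def by (subst wasserstein_commute) (rule dist_commute, rule refl)

lemma PSW_self:
  assumes "\<mu> \<in> borel_probs unit_sphere" "p > 0"
  shows "PSW p \<mu> \<mu> = 0"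
proof -
  have "(LINT \<psi>|sphere_uniform. wasserstein dist p (sliced \<psi> \<mu>) (sliced \<psi> \<mu>) powr p) = (LINT \<psi>|(sphere_uniform :: 'a measure). 0)"
    using assms interval.wasserstein_self sliced_in_borel_probs
    by (intro Bochner_Integration.integral_cong) (auto simp: space_sphere_uniform)
  then show ?thesis by (simp add: PSW_def)
qed

lemma wasserstein_sliced_bounds:
  assumes "\<mu> \<in> borel_probs unit_sphere" "\<nu> \<in> borel_probs unit_sphere" "p > 0" "\<psi> \<in> unit_sphere"
  shows "0 \<le> wasserstein dist p (sliced \<psi> \<mu>) (sliced \<psi> \<nu>)" "wasserstein dist p (sliced \<psi> \<mu>) (sliced \<psi> \<nu>) \<le> 2"
  using interval.wasserstein_nonneg
    interval.wasserstein_bounded[OF sliced_in_borel_probs[OF assms(4,1)] sliced_in_borel_probs[OF assms(4,2)] assms(3)]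
  by auto

lemma PSW_triangle:
  fixes \<mu> \<nu> \<rho> :: "'a::euclidean_space measure"
  assumes \<mu>: "\<mu> \<in> borel_probs unit_sphere" and \<nu>: "\<nu> \<in> borel_probs unit_sphere"
    and \<rho>: "\<rho> \<in> borel_probs unit_sphere" and p: "p \<ge> 1"
  shows "PSW p \<mu> \<rho> \<le> PSW p \<mu> \<nu> + PSW p \<nu> \<rho>"
proof (rule field_le_epsilon)
  fix e :: real assume "e > 0"
  interpret S: prob_space "sphere_uniform :: 'a measure" by (rule prob_space_sphere_uniform)
  have p0: "p > 0" using p by simp
  define A B where "A = PSW p \<mu> \<nu> + e / 2" and "B = PSW p \<nu> \<rho> + e / 2"
  have AB: "A > 0" "B > 0" "PSW p \<mu> \<nu> \<le> A" "PSW p \<nu> \<rho> \<le> B"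
    using PSW_nonneg[of p \<mu> \<nu>] PSW_nonneg[of p \<nu> \<rho>] \<open>e > 0\<close> by (auto simp: A_def B_def)
  let ?W = "\<lambda>\<mu> \<nu> \<psi>. wasserstein dist p (sliced \<psi> \<mu>) (sliced \<psi> \<nu>)"
  note m = wasserstein_sliced_measurable[OF \<mu> \<nu> p] wasserstein_sliced_measurable[OF \<nu> \<rho> p]
    wasserstein_sliced_measurable[OF \<mu> \<rho> p]
  note b = wasserstein_sliced_bounds[OF \<mu> \<nu> p0] wasserstein_sliced_bounds[OF \<nu> \<rho> p0]
    wasserstein_sliced_bounds[OF \<mu> \<rho> p0]
  have "PSW p \<mu> \<rho> powr p = S.expectation (\<lambda>\<psi>. ?W \<mu> \<rho> \<psi> powr p)"
    using p0 by (rule PSW_powr)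
  also have "\<dots> \<le> S.expectation (\<lambda>\<psi>. (?W \<mu> \<nu> \<psi> + ?W \<nu> \<rho> \<psi>) powr p)"
  proof (rule integral_mono)
    show "integrable sphere_uniform (\<lambda>\<psi>. ?W \<mu> \<rho> \<psi> powr p)"
      using m b p0 by (intro S.integrable_powr_bounded[where B=2]) (auto simp: space_sphere_uniform)
    show "integrable sphere_uniform (\<lambda>\<psi>. (?W \<mu> \<nu> \<psi> + ?W \<nu> \<rho> \<psi>) powr p)"
    proof (intro S.integrable_powr_bounded[where B=4])
      fix \<psi> :: 'a assume "\<psi> \<in> space sphere_uniform"
      then have "\<psi> \<in> unit_sphere" by (simp add: space_sphere_uniform)
      from b[OF this] show "0 \<le> ?W \<mu> \<nu> \<psi> + ?W \<nu> \<rho> \<psi>" "?W \<mu> \<nu> \<psi> + ?W \<nu> \<rho> \<psi> \<le> 4" by auto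
    qed (use m p0 in auto)
    fix \<psi> :: 'a assume "\<psi> \<in> space sphere_uniform"
    then have \<psi>: "\<psi> \<in> unit_sphere" by (simp add: space_sphere_uniform)
    show "?W \<mu> \<rho> \<psi> powr p \<le> (?W \<mu> \<nu> \<psi> + ?W \<nu> \<rho> \<psi>) powr p"
      using interval.wasserstein_triangle[OF sliced_in_borel_probs[OF \<psi> \<mu>] sliced_in_borel_probs[OF \<psi> \<nu>]
          sliced_in_borel_probs[OF \<psi> \<rho>] p] b(5)[OF \<psi>] p0 by (intro powr_mono2) auto
  qed
  also have "\<dots> \<le> (A + B) powr p"
  proof (rule S.minkowski_powr_le[where F=2 and G=2])
    show "S.expectation (\<lambda>\<psi>. ?W \<mu> \<nu> \<psi> powr p) \<le> A powr p"
      using AB p0 PSW_nonneg by (subst PSW_powr[symmetric]) (auto intro!: powr_mono2)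
    show "S.expectation (\<lambda>\<psi>. ?W \<nu> \<rho> \<psi> powr p) \<le> B powr p"
      using AB p0 PSW_nonneg by (subst PSW_powr[symmetric]) (auto intro!: powr_mono2)
  qed (use m b AB p in \<open>auto simp: space_sphere_uniform\<close>)
  finally have "PSW p \<mu> \<rho> \<le> A + B"
    using AB p0 by (meson add_pos_pos less_imp_le linorder_not_le powr_less_mono2)
  then show "PSW p \<mu> \<rho> \<le> PSW p \<mu> \<nu> + PSW p \<nu> \<rho> + e" by (simp add: A_def B_def)
qed

lemma PSW_le_wasserstein:
  fixes \<mu> \<nu> :: "'a::euclidean_space measure"
  assumes \<mu>: "\<mu> \<in> borel_probs unit_sphere" and \<nu>: "\<nu> \<in> borel_probs unit_sphere" and p: "p \<ge> 1"
  shows "PSW p \<mu> \<nu> \<le> wasserstein geodesic_dist p \<mu> \<nu>"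
proof -
  interpret S: prob_space "sphere_uniform :: 'a measure" by (rule prob_space_sphere_uniform)
  let ?W = "\<lambda>\<psi>. wasserstein dist p (sliced \<psi> \<mu>) (sliced \<psi> \<nu>)"
  have p0: "p > 0" using p by simp
  note b = wasserstein_sliced_bounds[OF \<mu> \<nu> p0]
  have "PSW p \<mu> \<nu> powr p = S.expectation (\<lambda>\<psi>. ?W \<psi> powr p)"
    using p0 by (rule PSW_powr)
  also have "\<dots> \<le> S.expectation (\<lambda>\<psi>. wasserstein geodesic_dist p \<mu> \<nu> powr p)"
  proof (rule integral_mono)
    show "integrable sphere_uniform (\<lambda>\<psi>. ?W \<psi> powr p)"
      using wasserstein_sliced_measurable[OF \<mu> \<nu> p] b p0
      by (intro S.integrable_powr_bounded[where B=2]) (auto simp: space_sphere_uniform)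
  qed (use wasserstein_sliced_le[OF _ \<mu> \<nu> p0] b p0 in \<open>auto simp: space_sphere_uniform intro!: powr_mono2\<close>)
  also have "\<dots> = wasserstein geodesic_dist p \<mu> \<nu> powr p" by (simp add: S.prob_space)
  finally show ?thesis
    using p0 sphere.wasserstein_nonneg[of p \<mu> \<nu>] by (meson linorder_not_le powr_less_mono2)
qed

section \<open>The Gaussian density\<close>

definition gauss_density :: "'a::euclidean_space \<Rightarrow> real" where
  "gauss_density x = exp (- (norm x)\<^sup>2 / 2) / sqrt (2 * pi) ^ DIM('a)"

lemma gauss_density_pos: "0 < gauss_density x"
  by (simp add: gauss_density_def)

lemma gauss_density_measurable[measurable]: "gauss_density \<in> borel_measurable borel"
  unfolding gauss_density_def[abs_def] by measurable

lemma gauss_density_eq_prod: "gauss_density (x :: 'a::euclidean_space) = (\<Prod>b\<in>Basis. std_normal_density (x \<bullet> b))"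
proof -
  have "(norm x)\<^sup>2 = (\<Sum>b\<in>Basis. (x \<bullet> b)\<^sup>2)"
    by (subst euclidean_inner[of x x, folded power2_norm_eq_inner]) (simp add: power2_eq_square)
  then have "exp (- (norm x)\<^sup>2 / 2) = (\<Prod>b\<in>Basis. exp (- (x \<bullet> b)\<^sup>2 / 2))"
    by (simp add: exp_sum[symmetric] sum_negf sum_divide_distrib)
  then show ?thesis
    by (simp add: gauss_density_def std_normal_density_def prod_dividef prod.distrib divide_simps)
qed

text \<open>The Gaussian and the exponential both factor over the coordinates, which reduces the integral to
the characteristic function of the standard normal distribution.\<close>

lemma gauss_density_fourier:
  fixes x :: "'a::euclidean_space"
  shows "integrable lborel (\<lambda>\<xi>. gauss_density \<xi> *\<^sub>R iexp (x \<bullet> \<xi>))"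
    and "(LINT \<xi>|lborel. gauss_density \<xi> *\<^sub>R iexp (x \<bullet> \<xi>)) = of_real (exp (- (norm x)\<^sup>2 / 2))"
proof -
  interpret product_sigma_finite "\<lambda>_::'a. lborel :: real measure" ..
  let ?e = "\<lambda>f::'a \<Rightarrow> real. \<Sum>b\<in>Basis. f b *\<^sub>R b"
  let ?F = "\<lambda>\<xi>. gauss_density \<xi> *\<^sub>R iexp (x \<bullet> \<xi>)"
  let ?g = "\<lambda>b t. std_normal_density t *\<^sub>R iexp ((x \<bullet> b) * t)"
  have int1: "integrable lborel (?g b)" for b
    by (rule Bochner_Integration.integrable_bound[OF integrable_std_normal_moment[of 0]])
       (auto simp: norm_mult)
  have val1: "(LINT t|lborel. ?g b t) = of_real (exp (- (x \<bullet> b)\<^sup>2 / 2))" for b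
  proof -
    have "(LINT t|lborel. ?g b t) = (LINT t|std_normal_distribution. iexp ((x \<bullet> b) * t))"
      by (subst integral_density) (auto simp: normal_density_nonneg)
    also have "\<dots> = char std_normal_distribution (x \<bullet> b)" by (simp add: char_def)
    finally show ?thesis by (simp add: char_std_normal_distribution)
  qed
  have F: "?F (?e f) = (\<Prod>b\<in>Basis. ?g b (f b))" for f
  proof -
    have c: "?e f \<bullet> b = f b" if "b \<in> Basis" for b
      using that by (simp add: inner_sum_left inner_Basis if_distrib cong: if_cong)
    have "iexp (x \<bullet> ?e f) = (\<Prod>b\<in>Basis. iexp ((x \<bullet> b) * f b))"
      by (simp add: inner_sum_right exp_sum[symmetric] sum_distrib_left mult_ac)
    moreover have "gauss_density (?e f) = (\<Prod>b\<in>Basis. std_normal_density (f b))"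
      unfolding gauss_density_eq_prod by (intro prod.cong refl) (simp only: c)
    ultimately show ?thesis by (simp add: scaleR_conv_of_real prod.distrib)
  qed
  have meas: "?e \<in> (\<Pi>\<^sub>M b\<in>(Basis::'a set). lborel) \<rightarrow>\<^sub>M borel" by measurable
  have mF: "?F \<in> borel_measurable borel" by measurable
  have "integrable (\<Pi>\<^sub>M b\<in>(Basis::'a set). lborel) (\<lambda>f. \<Prod>b\<in>Basis. ?g b (f b))"
    using int1 by (intro product_integrable_prod) auto
  then have "integrable (\<Pi>\<^sub>M b\<in>(Basis::'a set). lborel) (\<lambda>f. ?F (?e f))" by (simp only: F)
  then show "integrable lborel ?F"
    by (subst lborel_eq) (use meas mF in \<open>simp add: integrable_distr_eq\<close>)
  have "(LINT \<xi>|lborel. ?F \<xi>) = (LINT f|(\<Pi>\<^sub>M b\<in>(Basis::'a set). lborel). ?F (?e f))"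
    by (subst lborel_eq) (rule integral_distr[OF meas mF])
  also have "\<dots> = (\<Prod>b\<in>Basis. LINT t|lborel. ?g b t)"
    unfolding F using int1 by (intro product_integral_prod) auto
  also have "\<dots> = of_real (\<Prod>b\<in>Basis. exp (- (x \<bullet> b)\<^sup>2 / 2))" by (simp only: val1 of_real_prod)
  also have "(\<Prod>b\<in>Basis. exp (- (x \<bullet> b)\<^sup>2 / 2)) = exp (- (norm x)\<^sup>2 / 2)"
    using gauss_density_eq_prod[of x]
    by (simp add: gauss_density_def std_normal_density_def prod_dividef prod.distrib divide_simps)
  finally show "(LINT \<xi>|lborel. ?F \<xi>) = of_real (exp (- (norm x)\<^sup>2 / 2))" .
qed

lemma gauss_density_integrable: "integrable lborel (gauss_density :: 'a::euclidean_space \<Rightarrow> real)"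
  and gauss_density_integral: "(LINT \<xi>|lborel. gauss_density (\<xi> :: 'a::euclidean_space)) = 1"
proof -
  show i: "integrable lborel (gauss_density :: 'a \<Rightarrow> real)"
    using integrable_Re[OF gauss_density_fourier(1)[of "0 :: 'a"]] by simp
  have "(LINT \<xi>|lborel. complex_of_real (gauss_density (\<xi> :: 'a))) = 1"
    using gauss_density_fourier(2)[of "0 :: 'a"] by (simp add: scaleR_conv_of_real)
  then show "(LINT \<xi>|lborel. gauss_density (\<xi> :: 'a)) = 1"
    by (metis integral_complex_of_real of_real_eq_1_iff)
qed

lemma gauss_density_nn_integral: "(\<integral>\<^sup>+\<xi>. gauss_density (\<xi> :: 'a::euclidean_space) \<partial>lborel) = 1"
  by (subst nn_integral_eq_integral)
     (auto simp: gauss_density_integrable gauss_density_integral less_imp_le[OF gauss_density_pos])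

lemma gauss_density_cos_integral:
  fixes x :: "'a::euclidean_space"
  shows "integrable lborel (\<lambda>\<xi>. gauss_density \<xi> * cos (x \<bullet> \<xi>))"
    and "(LINT \<xi>|lborel. gauss_density \<xi> * cos (x \<bullet> \<xi>)) = exp (- (norm x)\<^sup>2 / 2)"
proof -
  have Re: "Re (gauss_density \<xi> *\<^sub>R iexp (x \<bullet> \<xi>)) = gauss_density \<xi> * cos (x \<bullet> \<xi>)" for \<xi>
    by (simp add: Re_exp)
  show "integrable lborel (\<lambda>\<xi>. gauss_density \<xi> * cos (x \<bullet> \<xi>))"
    using integrable_Re[OF gauss_density_fourier(1)[of x]] by (simp only: Re)
  show "(LINT \<xi>|lborel. gauss_density \<xi> * cos (x \<bullet> \<xi>)) = exp (- (norm x)\<^sup>2 / 2)"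
    using integral_Re[OF gauss_density_fourier(1)[of x]]
    unfolding gauss_density_fourier(2) Re by simp
qed

text \<open>The image under \<open>x \<mapsto> x \<bullet> \<theta>\<close> is identified by its characteristic function, a Fourier integral of the
Gaussian along the line spanned by \<open>\<theta>\<close>.\<close>

lemma distr_gauss_inner:
  fixes \<theta> :: "'a::euclidean_space"
  assumes "norm \<theta> = 1"
  shows "distr (density lborel (\<lambda>x. ennreal (gauss_density x))) borel (\<lambda>x. x \<bullet> \<theta>) = std_normal_distribution"
proof -
  let ?N = "density lborel (\<lambda>x::'a. ennreal (gauss_density x))"
  have "prob_space ?N"
    by (rule prob_spaceI) (simp add: emeasure_density gauss_density_nn_integral)
  then interpret N: prob_space ?N .
  have "prob_space (distr ?N borel (\<lambda>x. x \<bullet> \<theta>))" by (rule N.prob_space_distr) simp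
  then have rd: "real_distribution (distr ?N borel (\<lambda>x. x \<bullet> \<theta>))"
    by (auto simp: real_distribution_def real_distribution_axioms_def)
  have "char (distr ?N borel (\<lambda>x. x \<bullet> \<theta>)) t = char std_normal_distribution t" for t
  proof -
    have "char (distr ?N borel (\<lambda>x. x \<bullet> \<theta>)) t = (LINT x|?N. iexp (t * (x \<bullet> \<theta>)))"
      by (simp add: char_def integral_distr)
    also have "\<dots> = (LINT x|lborel. gauss_density x *\<^sub>R iexp ((t *\<^sub>R \<theta>) \<bullet> x))"
      by (subst integral_density) (auto simp: less_imp_le[OF gauss_density_pos] inner_commute)
    also have "\<dots> = of_real (exp (- t\<^sup>2 / 2))"
      by (subst gauss_density_fourier(2)) (simp add: assms)
    finally show ?thesis by (simp add: char_std_normal_distribution)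
  qed
  then show ?thesis
    using Levy_uniqueness[OF rd real_dist_normal_dist] by blast
qed

text \<open>On the ball Lebesgue measure is at most a constant times the Gaussian measure, whose image in the
direction \<open>\<theta>\<close> has a density bounded by 1.\<close>

lemma slab_nn_integral_le:
  fixes G :: "real \<Rightarrow> ennreal" and \<theta> :: "'a::euclidean_space"
  assumes \<theta>: "norm \<theta> = 1" and [measurable]: "G \<in> borel_measurable borel"
  shows "(\<integral>\<^sup>+x\<in>cball 0 2. G (x \<bullet> \<theta>) \<partial>lborel)
      \<le> ennreal (exp 2 * sqrt (2 * pi) ^ DIM('a)) * (\<integral>\<^sup>+t. G t \<partial>lborel)"
proof -
  let ?C = "exp 2 * sqrt (2 * pi) ^ DIM('a)"
  let ?N = "density lborel (\<lambda>x::'a. ennreal (gauss_density x))"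
  have "(\<integral>\<^sup>+x\<in>cball 0 2. G (x \<bullet> \<theta>) \<partial>lborel) \<le> (\<integral>\<^sup>+x. ennreal ?C * (gauss_density x * G (x \<bullet> \<theta>)) \<partial>lborel)"
  proof (intro nn_integral_mono)
    fix x :: 'a
    show "G (x \<bullet> \<theta>) * indicator (cball 0 2) x \<le> ennreal ?C * (gauss_density x * G (x \<bullet> \<theta>))"
    proof (cases "x \<in> cball 0 2")
      case True
      then have "(norm x)\<^sup>2 \<le> 2\<^sup>2" by (intro power_mono) auto
      then have "1 \<le> exp (2 - (norm x)\<^sup>2 / 2)" by simp
      also have "\<dots> = ?C * gauss_density x"
        by (simp add: gauss_density_def flip: exp_add)
      finally have "ennreal 1 \<le> ennreal ?C * gauss_density x"
        by (subst ennreal_mult'[symmetric]) (auto intro: ennreal_leI simp: less_imp_le[OF gauss_density_pos])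
      from mult_right_mono[OF this, of "G (x \<bullet> \<theta>)"] show ?thesis
        using True by (simp add: mult.assoc)
    qed simp
  qed
  also have "\<dots> = ennreal ?C * (\<integral>\<^sup>+x. G (x \<bullet> \<theta>) \<partial>?N)"
    by (subst nn_integral_cmult) (auto simp: nn_integral_density)
  also have "(\<integral>\<^sup>+x. G (x \<bullet> \<theta>) \<partial>?N) = (\<integral>\<^sup>+t. G t \<partial>distr ?N borel (\<lambda>x. x \<bullet> \<theta>))"
    by (simp add: nn_integral_distr)
  also have "\<dots> = (\<integral>\<^sup>+t. std_normal_density t * G t \<partial>lborel)"
    unfolding distr_gauss_inner[OF \<theta>] by (simp add: nn_integral_density)
  also have "\<dots> \<le> (\<integral>\<^sup>+t. G t \<partial>lborel)"
  proof (intro nn_integral_mono)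
    fix t :: real
    have "sqrt (2 * pi) \<ge> 1" using pi_gt3 by (intro real_le_rsqrt) simp
    then have "std_normal_density t \<le> 1"
      unfolding std_normal_density_def by (intro mult_le_one) (auto simp: divide_simps)
    then have "ennreal (std_normal_density t) \<le> 1" by simp
    from mult_right_mono[OF this, of "G t"] show "std_normal_density t * G t \<le> G t" by simp
  qed
  finally show ?thesis by (simp add: mult_left_mono)
qed

section \<open>Polar coordinates\<close>

lemma nn_integral_sphere_uniform:
  fixes G :: "'a::euclidean_space \<Rightarrow> ennreal"
  assumes G: "G \<in> borel_measurable (restrict_space borel unit_sphere)"
  shows "(\<integral>\<^sup>+\<theta>. G \<theta> \<partial>sphere_uniform)
     = (\<integral>\<^sup>+\<xi>. G (sgn \<xi>) * indicator (cball 0 1 - {0}) \<xi> \<partial>lborel) / ennreal (unit_ball_vol DIM('a))"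
proof -
  let ?S = "sphere_surface_measure :: 'a measure" and ?R = "restrict_space borel (unit_sphere :: 'a set)"
  let ?V = "ennreal (unit_ball_vol DIM('a))"
  have s: "sets ?S = sets ?R" by (simp add: sphere_surface_measure_def sets_scale_measure)
  have sp: "space ?S = unit_sphere" using sets_eq_imp_space_eq[OF s] by (simp add: space_restrict_space)
  have mG: "G \<in> borel_measurable ?S" using G by (simp add: measurable_cong_sets[OF s refl])
  have U: "unit_sphere \<in> sets ?S" by (simp add: s sets_restrict_space_iff)
  have "(\<integral>\<^sup>+\<theta>. G \<theta> \<partial>sphere_uniform) = (\<integral>\<^sup>+\<theta>. G \<theta> * indicator unit_sphere \<theta> \<partial>?S) / emeasure ?S unit_sphere"
    unfolding sphere_uniform_def using mG U by (rule nn_integral_uniform_measure)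
  also have "(\<integral>\<^sup>+\<theta>. G \<theta> * indicator unit_sphere \<theta> \<partial>?S) = (\<integral>\<^sup>+\<theta>. G \<theta> \<partial>?S)"
    by (intro nn_integral_cong) (simp add: sp)
  also have "\<dots> = of_nat DIM('a) * (\<integral>\<^sup>+\<theta>. G \<theta> \<partial>distr (restrict_space lborel (cball 0 1 - {0})) ?R sgn)"
    unfolding sphere_surface_measure_def by (rule nn_integral_scale_measure) (simp add: G)
  also have "\<dots> = of_nat DIM('a) * (\<integral>\<^sup>+\<xi>. G (sgn \<xi>) \<partial>restrict_space lborel (cball 0 1 - {0}))"
    by (subst nn_integral_distr[OF sgn_measurable_sphere]) (simp_all add: G)
  also have "(\<integral>\<^sup>+\<xi>. G (sgn \<xi>) \<partial>restrict_space lborel (cball 0 1 - {0})) = (\<integral>\<^sup>+\<xi>. G (sgn \<xi>) * indicator (cball 0 1 - {0}) \<xi> \<partial>lborel)"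
    by (rule nn_integral_restrict_space) simp
  finally have eq: "(\<integral>\<^sup>+\<theta>. G \<theta> \<partial>sphere_uniform) = of_nat DIM('a)
      * (\<integral>\<^sup>+\<xi>. G (sgn \<xi>) * indicator (cball 0 1 - {0}) \<xi> \<partial>lborel) / emeasure ?S unit_sphere" .
  have "of_nat DIM('a) * Y / ennreal (DIM('a) * unit_ball_vol DIM('a)) = Y / ?V" for Y :: ennreal
  proof -
    have "ennreal (real DIM('a)) * inverse (ennreal (DIM('a) * unit_ball_vol DIM('a))) = inverse ?V"
      using unit_ball_vol_pos[of "DIM('a)"] by (simp add: inverse_ennreal flip: ennreal_mult)
    then show ?thesis
      by (simp add: divide_ennreal_def ennreal_of_nat_eq_real_of_nat) (metis mult.assoc mult.commute)
  qed
  then show ?thesis unfolding eq emeasure_sphere_surface_measure_sphere .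
qed

lemma nn_integral_affine_euclidean:
  fixes F :: "'a::euclidean_space \<Rightarrow> ennreal"
  assumes [measurable]: "F \<in> borel_measurable borel" and c: "c > 0"
  shows "(\<integral>\<^sup>+x. F x \<partial>lborel) = ennreal (c ^ DIM('a)) * (\<integral>\<^sup>+x. F (t + c *\<^sub>R x) \<partial>lborel)"
proof -
  have "(\<integral>\<^sup>+x. F x \<partial>lborel) = (\<integral>\<^sup>+x. F x \<partial>density (distr lborel borel (\<lambda>x. t + c *\<^sub>R x)) (\<lambda>_. ennreal (\<bar>c\<bar> ^ DIM('a))))"
    using lborel_affine[of c t] c by simp
  also have "\<dots> = ennreal (c ^ DIM('a)) * (\<integral>\<^sup>+x. F (t + c *\<^sub>R x) \<partial>lborel)"
    using c by (simp add: nn_integral_density nn_integral_distr nn_integral_cmult)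
  finally show ?thesis .
qed

lemma nn_integral_power_tail:
  fixes a :: real
  assumes "a > 0" "n > 0"
  shows "(\<integral>\<^sup>+u. ennreal (1 / u ^ (n + 1)) * indicator {a..} u \<partial>lborel) = ennreal (1 / (n * a ^ n))"
proof -
  have "(\<integral>\<^sup>+u. ennreal (1 / u ^ (n + 1)) * indicator {a..} u \<partial>lborel) = ennreal (0 - (- 1 / (real n * a ^ n)))"
  proof (rule nn_integral_FTC_atLeast)
    show "DERIV (\<lambda>u. - 1 / (real n * u ^ n)) x :> 1 / x ^ (n + 1)" if "a \<le> x" for x
      using that assms
      by (auto intro!: derivative_eq_intros simp: field_simps power2_eq_square power_add[symmetric] simp flip: power_Suc)
    have "((\<lambda>u::real. (- 1 / real n) * inverse u ^ n) \<longlongrightarrow> (- 1 / real n) * 0 ^ n) at_top"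
      by (intro tendsto_intros tendsto_inverse_0_at_top filterlim_ident)
    then show "((\<lambda>u. - 1 / (real n * u ^ n)) \<longlongrightarrow> 0) at_top"
      using assms by (simp add: power_inverse divide_inverse mult_ac power_0_left)
  qed (use assms in auto)
  then show ?thesis by simp
qed

text \<open>The uniform measure is the normalized image of Lebesgue measure on the unit ball under \<^const>\<open>sgn\<close>,
so the right-hand side is an integral over a point \<open>\<xi>\<close> of the ball and a ray variable \<open>t\<close>.
Substitute \<open>t = u * norm \<xi>\<close> and then \<open>\<eta> = u *\<^sub>R \<xi>\<close>; the variable \<open>u\<close> now ranges over
\<open>u \<ge> norm \<eta>\<close>, and integrating it out leaves \<open>F \<eta>\<close> with a constant factor.\<close>

lemma nn_integral_polar:
  fixes F :: "'a::euclidean_space \<Rightarrow> ennreal"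
  assumes [measurable]: "F \<in> borel_measurable borel"
  shows "(\<integral>\<^sup>+x. F x \<partial>lborel) = ennreal (DIM('a) * unit_ball_vol DIM('a)) *
    (\<integral>\<^sup>+\<theta>. (\<integral>\<^sup>+t. ennreal (t ^ (DIM('a) - 1)) * F (t *\<^sub>R \<theta>) * indicator {0<..} t \<partial>lborel) \<partial>sphere_uniform)"
proof -
  let ?d = "DIM('a)"
  have d: "?d > 0" by simp
  let ?V = "unit_ball_vol ?d"
  have V: "?V > 0" by (simp add: unit_ball_vol_pos)
  let ?R = "\<lambda>\<theta>::'a. \<integral>\<^sup>+t. ennreal (t ^ (?d - 1)) * F (t *\<^sub>R \<theta>) * indicator {0<..} t \<partial>lborel"
  let ?B = "cball (0::'a) 1 - {0}"
  let ?f = "\<lambda>\<xi> u. ennreal (u ^ (?d - 1)) * ennreal (norm \<xi> ^ ?d) * F (u *\<^sub>R \<xi>) * indicator {0<..} u"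
  let ?g = "\<lambda>\<eta> u. F \<eta> * ennreal (norm \<eta> ^ ?d) * (ennreal (1 / u ^ (?d + 1)) * indicator {0..} (u - norm \<eta>)) * indicator {0<..} u * indicator (- {0}) \<eta>"
  have [measurable]: "cball (0::'a) 1 \<in> sets borel" "{0::'a} \<in> sets borel" "- {0::'a} \<in> sets borel" by auto
  have mR: "?R \<in> borel_measurable borel" by measurable
  \<comment> \<open>Substituting \<open>t = u * norm \<xi>\<close> replaces the ray through \<open>sgn \<xi>\<close> by the one through \<open>\<xi>\<close>.\<close>
  have ray: "?R (sgn \<xi>) = (\<integral>\<^sup>+u. ?f \<xi> u \<partial>lborel)"
    if "\<xi> \<noteq> 0" for \<xi>
  proof -
    have n: "norm \<xi> > 0" using that by simp
    have "?R (sgn \<xi>) = ennreal \<bar>norm \<xi>\<bar> * (\<integral>\<^sup>+u. ennreal ((0 + norm \<xi> * u) ^ (?d - 1)) * F ((0 + norm \<xi> * u) *\<^sub>R sgn \<xi>) * indicator {0<..} (0 + norm \<xi> * u) \<partial>lborel)"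
      by (rule nn_integral_real_affine) (use n in auto)
    also have "\<dots> = (\<integral>\<^sup>+u. ennreal (norm \<xi>) * (ennreal ((norm \<xi> * u) ^ (?d - 1)) * F ((norm \<xi> * u) *\<^sub>R sgn \<xi>) * indicator {0<..} (norm \<xi> * u)) \<partial>lborel)"
      by (subst nn_integral_cmult) auto
    also have "\<dots> = (\<integral>\<^sup>+u. ?f \<xi> u \<partial>lborel)"
    proof (intro nn_integral_cong)
      fix u :: real
      show "ennreal (norm \<xi>) * (ennreal ((norm \<xi> * u) ^ (?d - 1)) * F ((norm \<xi> * u) *\<^sub>R sgn \<xi>) * indicator {0<..} (norm \<xi> * u))
         = ?f \<xi> u"
      proof (cases "u > 0")
        case True
        have "norm \<xi> * norm \<xi> ^ (?d - 1) = norm \<xi> ^ ?d"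
          using d by (metis power_eq_if nat_neq_iff not_less_zero)
        then have "ennreal (norm \<xi>) * ennreal ((norm \<xi> * u) ^ (?d - 1)) = ennreal (u ^ (?d - 1)) * ennreal (norm \<xi> ^ ?d)"
          using True by (simp add: power_mult_distrib mult_ac flip: ennreal_mult)
        moreover have "(norm \<xi> * u) *\<^sub>R sgn \<xi> = u *\<^sub>R \<xi>" using n by (simp add: sgn_div_norm)
        ultimately show ?thesis using True n by (simp add: mult.assoc[symmetric])
      next
        case False
        then have "\<not> norm \<xi> * u > 0" using n by (simp add: zero_less_mult_iff)
        then show ?thesis using False by simp
      qed
    qed
    finally show ?thesis .
  qed
  have "(\<integral>\<^sup>+\<xi>. ?R (sgn \<xi>) * indicator ?B \<xi> \<partial>lborel)
      = (\<integral>\<^sup>+\<xi>. (\<integral>\<^sup>+u. ?f \<xi> u * indicator ?B \<xi> \<partial>lborel) \<partial>lborel)"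
  proof (intro nn_integral_cong)
    fix \<xi> :: 'a
    show "?R (sgn \<xi>) * indicator ?B \<xi>
      = (\<integral>\<^sup>+u. ?f \<xi> u * indicator ?B \<xi> \<partial>lborel)"
    proof (cases "\<xi> \<in> ?B")
      case True
      then have "\<xi> \<noteq> 0" by simp
      from ray[OF this] True show ?thesis by simp
    qed simp
  qed
  also have "\<dots> = (\<integral>\<^sup>+u. (\<integral>\<^sup>+\<xi>. ?f \<xi> u * indicator ?B \<xi> \<partial>lborel) \<partial>lborel)"
    by (rule lborel_pair.Fubini') measurable
  also have "\<dots> = (\<integral>\<^sup>+u. (\<integral>\<^sup>+\<eta>. ?g \<eta> u \<partial>lborel) \<partial>lborel)"
  proof (rule nn_integral_cong)
    fix u :: real
    show "(\<integral>\<^sup>+\<xi>. ?f \<xi> u * indicator ?B \<xi> \<partial>lborel)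
      = (\<integral>\<^sup>+\<eta>. ?g \<eta> u \<partial>lborel)"
    proof (cases "u > 0")
      case True
      let ?H = "\<lambda>\<eta>::'a. F \<eta> * ennreal (norm \<eta> ^ ?d) * (ennreal (1 / u ^ (?d + 1)) * indicator {0..} (u - norm \<eta>)) * indicator (- {0}) \<eta>"
      have "(\<integral>\<^sup>+\<eta>. ?H \<eta> \<partial>lborel) = ennreal (u ^ ?d) * (\<integral>\<^sup>+\<xi>. ?H (u *\<^sub>R \<xi>) \<partial>lborel)"
        using nn_integral_affine_euclidean[OF _ True, of ?H 0] by simp
      also have "\<dots> = (\<integral>\<^sup>+\<xi>. ennreal (u ^ ?d) * ?H (u *\<^sub>R \<xi>) \<partial>lborel)"
        by (rule nn_integral_cmult[symmetric]) measurable
      also have "\<dots> = (\<integral>\<^sup>+\<xi>. ennreal (u ^ (?d - 1)) * ennreal (norm \<xi> ^ ?d) * F (u *\<^sub>R \<xi>) * indicator ?B \<xi> \<partial>lborel)"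
      proof (intro nn_integral_cong)
        fix \<xi> :: 'a
        have "u ^ ?d * (norm (u *\<^sub>R \<xi>) ^ ?d * (1 / u ^ (?d + 1))) = u ^ (?d - 1) * norm \<xi> ^ ?d"
        proof -
          obtain m where m: "?d = Suc m" using d by (metis Suc_pred)
          show ?thesis using True unfolding m by (simp add: power_mult_distrib field_simps)
        qed
        then have 1: "ennreal (u ^ ?d) * (ennreal (norm (u *\<^sub>R \<xi>) ^ ?d) * ennreal (1 / u ^ (?d + 1))) = ennreal (u ^ (?d - 1)) * ennreal (norm \<xi> ^ ?d)"
          using True by (simp flip: ennreal_mult)
        have 2: "(indicator {0..} (u - norm (u *\<^sub>R \<xi>)) * indicator (- {0}) (u *\<^sub>R \<xi>) :: ennreal) = indicator ?B \<xi>"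
          using True by (auto split: split_indicator)
        have "ennreal (u ^ ?d) * ?H (u *\<^sub>R \<xi>)
          = (ennreal (u ^ ?d) * (ennreal (norm (u *\<^sub>R \<xi>) ^ ?d) * ennreal (1 / u ^ (?d + 1)))) * F (u *\<^sub>R \<xi>)
            * (indicator {0..} (u - norm (u *\<^sub>R \<xi>)) * indicator (- {0}) (u *\<^sub>R \<xi>))"
          by (simp only: mult_ac)
        also have "\<dots> = ennreal (u ^ (?d - 1)) * ennreal (norm \<xi> ^ ?d) * F (u *\<^sub>R \<xi>) * indicator ?B \<xi>"
          unfolding 1 2 by (rule refl)
        finally show "ennreal (u ^ ?d) * ?H (u *\<^sub>R \<xi>) = ennreal (u ^ (?d - 1)) * ennreal (norm \<xi> ^ ?d) * F (u *\<^sub>R \<xi>) * indicator ?B \<xi>" .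
      qed
      finally have eq: "(\<integral>\<^sup>+\<eta>. ?H \<eta> \<partial>lborel)
        = (\<integral>\<^sup>+\<xi>. ennreal (u ^ (?d - 1)) * ennreal (norm \<xi> ^ ?d) * F (u *\<^sub>R \<xi>) * indicator ?B \<xi> \<partial>lborel)" .
      show ?thesis using eq[symmetric] True by simp
    qed simp
  qed
  also have "\<dots> = (\<integral>\<^sup>+\<eta>. (\<integral>\<^sup>+u. ?g \<eta> u \<partial>lborel) \<partial>lborel)"
    by (rule lborel_pair.Fubini') measurable
  also have "\<dots> = (\<integral>\<^sup>+\<eta>. ennreal (1 / ?d) * F \<eta> \<partial>lborel)"
  proof -
    let ?G = "\<lambda>\<eta>. \<integral>\<^sup>+u. ?g \<eta> u \<partial>lborel"
    have tail: "?G \<eta> = ennreal (1 / ?d) * F \<eta>" if \<eta>: "\<eta> \<noteq> 0" for \<eta>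
    proof -
    have pos: "0 < u" if "norm \<eta> \<le> u" for u
      using \<eta> that by (meson order.strict_trans2 zero_less_norm_iff)
    have "(\<integral>\<^sup>+u. ?g \<eta> u \<partial>lborel)
       = (\<integral>\<^sup>+u. (F \<eta> * ennreal (norm \<eta> ^ ?d)) * (ennreal (1 / u ^ (?d + 1)) * indicator {norm \<eta>..} u) \<partial>lborel)"
      using \<eta> pos by (intro nn_integral_cong) (auto split: split_indicator)
    also have "\<dots> = (F \<eta> * ennreal (norm \<eta> ^ ?d)) * ennreal (1 / (?d * norm \<eta> ^ ?d))"
      using nn_integral_power_tail[of "norm \<eta>" ?d] \<eta> by (subst nn_integral_cmult) simp_all
    also have "\<dots> = F \<eta> * ennreal (norm \<eta> ^ ?d * (1 / (?d * norm \<eta> ^ ?d)))"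
      by (simp add: mult.assoc flip: ennreal_mult)
    also have "norm \<eta> ^ ?d * (1 / (?d * norm \<eta> ^ ?d)) = 1 / ?d" using \<eta> by simp
    finally show ?thesis by (simp add: mult.commute)
    qed
    have "AE \<eta> in lborel. ?G \<eta> = ennreal (1 / ?d) * F \<eta>"
      by (rule AE_mp[OF AE_lborel_singleton[of "0::'a"]]) (intro AE_I2 impI tail)
    then show ?thesis by (rule nn_integral_cong_AE)
  qed
  also have "\<dots> = ennreal (1 / ?d) * (\<integral>\<^sup>+\<eta>. F \<eta> \<partial>lborel)" by (rule nn_integral_cmult) simp
  finally have I: "(\<integral>\<^sup>+\<xi>. ?R (sgn \<xi>) * indicator ?B \<xi> \<partial>lborel) = ennreal (1 / ?d) * (\<integral>\<^sup>+\<eta>. F \<eta> \<partial>lborel)" .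
  have "(\<integral>\<^sup>+\<theta>. ?R \<theta> \<partial>sphere_uniform) = ennreal (1 / ?d) * (\<integral>\<^sup>+\<eta>. F \<eta> \<partial>lborel) / ennreal ?V"
    by (subst nn_integral_sphere_uniform) (use mR I in \<open>auto intro: measurable_restrict_space1\<close>)
  also have "\<dots> = ennreal (1 / (?d * ?V)) * (\<integral>\<^sup>+\<eta>. F \<eta> \<partial>lborel)"
  proof -
    have c: "ennreal (1 / ?d) * ennreal (inverse ?V) = ennreal (1 / (?d * ?V))"
      using V by (simp add: inverse_eq_divide flip: ennreal_mult)
    have "ennreal (1 / ?d) * (\<integral>\<^sup>+\<eta>. F \<eta> \<partial>lborel) / ennreal ?V
        = (ennreal (1 / ?d) * ennreal (inverse ?V)) * (\<integral>\<^sup>+\<eta>. F \<eta> \<partial>lborel)"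
      using V by (simp only: divide_ennreal_def inverse_ennreal mult_ac)
    then show ?thesis unfolding c .
  qed
  finally have "ennreal (?d * ?V) * (\<integral>\<^sup>+\<theta>. ?R \<theta> \<partial>sphere_uniform) = ennreal (?d * ?V * (1 / (?d * ?V))) * (\<integral>\<^sup>+\<eta>. F \<eta> \<partial>lborel)"
    using V by (simp add: mult.assoc[symmetric] flip: ennreal_mult)
  then show ?thesis using V d by simp
qed

section \<open>The Gaussian as an average of ridge functions\<close>

text \<open>For \<open>k = n - 1\<close> this is the radial part of a Gaussian integral over dimension \<open>n\<close> in polar coordinates.\<close>

definition half_moment :: "nat \<Rightarrow> real \<Rightarrow> real" where
  "half_moment k r = indicator {0<..} r * (r ^ k * exp (- r\<^sup>2 / 2))"

lemma half_moment_nonneg: "0 \<le> half_moment k r"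
  by (auto simp: half_moment_def split: split_indicator)

lemma half_moment_integrable: "integrable lborel (half_moment k)"
proof -
  have "integrable lborel (\<lambda>r. indicator {0<..} r *\<^sub>R (sqrt (2 * pi) * (std_normal_density r * r ^ k)))"
    by (intro integrable_mult_indicator integrable_mult_right integrable_std_normal_moment) simp
  also have "(\<lambda>r. indicator {0<..} r *\<^sub>R (sqrt (2 * pi) * (std_normal_density r * r ^ k))) = half_moment k"
    by (rule ext) (simp add: half_moment_def std_normal_density_def)
  finally show ?thesis .
qed

lemma half_moment_measurable[measurable]: "half_moment k \<in> borel_measurable borel"
  unfolding half_moment_def[abs_def] by measurable

lemma half_moment_times_integrable:
  assumes [measurable]: "f \<in> borel_measurable borel" and "\<And>r. \<bar>f r\<bar> \<le> 1"
  shows "integrable lborel (\<lambda>r. half_moment k r * f r)"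
  by (rule Bochner_Integration.integrable_bound[OF half_moment_integrable[of k]])
     (use assms in \<open>auto simp: abs_mult half_moment_nonneg intro!: mult_left_le AE_I2\<close>)

text \<open>Up to a constant, the contribution of a single direction to the Fourier integral of the Gaussian in
dimension \<open>n\<close>.\<close>

definition ridge_profile :: "nat \<Rightarrow> real \<Rightarrow> real" where
  "ridge_profile n s = (LINT r|lborel. half_moment (n - 1) r * cos (r * s))"

lemma ridge_profile_measurable[measurable]: "ridge_profile n \<in> borel_measurable borel"
  unfolding ridge_profile_def[abs_def] by measurable

lemma ridge_profile_bounded: "\<bar>ridge_profile n s\<bar> \<le> ridge_profile n 0"
proof -
  have "norm (ridge_profile n s) \<le> (LINT r|lborel. norm (half_moment (n - 1) r * cos (r * s)))"
    unfolding ridge_profile_def by (rule integral_norm_bound)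
  also have "\<dots> \<le> (LINT r|lborel. half_moment (n - 1) r * cos (r * 0))"
    by (intro integral_mono integrable_norm half_moment_times_integrable)
       (auto simp: abs_mult half_moment_nonneg intro!: mult_left_le)
  finally show ?thesis by (simp add: ridge_profile_def)
qed

text \<open>Up to a constant the Gaussian is its own Fourier transform, and in polar coordinates the integral
over a ray is \<^const>\<open>ridge_profile\<close>. Polar coordinates are available for nonnegative functions, so the
cosine is replaced by \<open>1 + cos\<close>; the case \<open>x = 0\<close> gives the contribution of the summand 1.\<close>

lemma gauss_ridge_decomposition:
  "\<exists>K>0. \<forall>x::'a::euclidean_space.
     exp (- (norm x)\<^sup>2 / 2) = K * (LINT \<theta>|sphere_uniform. ridge_profile DIM('a) (x \<bullet> \<theta>))"
proof -
  let ?n = "DIM('a)"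
  let ?g = "ridge_profile ?n"
  let ?s = "sqrt (2 * pi) ^ ?n"
  define L where "L = real ?n * unit_ball_vol ?n / ?s"
  have L: "L > 0" using unit_ball_vol_pos[of "real ?n"] by (simp add: L_def)
  interpret S: prob_space "sphere_uniform :: 'a measure" by (rule prob_space_sphere_uniform)
  have mg: "(\<lambda>\<theta>. ?g (x \<bullet> \<theta>)) \<in> borel_measurable sphere_uniform" for x :: 'a
  proof -
    have "(\<lambda>\<theta>. ?g (x \<bullet> \<theta>)) \<in> borel_measurable (restrict_space borel unit_sphere)"
      by (rule measurable_restrict_space1) measurable
    then show ?thesis by (simp add: measurable_cong_sets[OF sets_sphere_uniform refl])
  qed
  have ig: "integrable sphere_uniform (\<lambda>\<theta>. ?g (x \<bullet> \<theta>))" for x :: 'a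
    by (rule S.integrable_const_bound[where B="?g 0"]) (use mg ridge_profile_bounded in auto)
  have eq: "1 + exp (- (norm x)\<^sup>2 / 2) = L * (?g 0 + (LINT \<theta>|sphere_uniform. ?g (x \<bullet> \<theta>)))" for x :: 'a
  proof -
    let ?F = "\<lambda>\<xi>::'a. ennreal (gauss_density \<xi> * (1 + cos (x \<bullet> \<xi>)))"
    have nn: "0 \<le> 1 + cos y" for y :: real using cos_ge_minus_one[of y] by linarith
    have "(\<integral>\<^sup>+\<xi>. ?F \<xi> \<partial>lborel) = ennreal (LINT \<xi>|lborel. gauss_density \<xi> * (1 + cos (x \<bullet> \<xi>)))"
    proof (rule nn_integral_eq_integral)
      show "integrable lborel (\<lambda>\<xi>. gauss_density \<xi> * (1 + cos (x \<bullet> \<xi>)))"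
        using gauss_density_integrable[where 'a='a] gauss_density_cos_integral(1)[of x] by (simp add: distrib_left)
      show "AE \<xi> in lborel. 0 \<le> gauss_density \<xi> * (1 + cos (x \<bullet> \<xi>))"
        by (intro AE_I2 mult_nonneg_nonneg less_imp_le[OF gauss_density_pos] nn)
    qed
    also have "(LINT \<xi>|lborel. gauss_density \<xi> * (1 + cos (x \<bullet> \<xi>))) = 1 + exp (- (norm x)\<^sup>2 / 2)"
      using gauss_density_integrable[where 'a='a] gauss_density_cos_integral[of x]
      by (simp add: distrib_left gauss_density_integral)
    finally have lhs: "(\<integral>\<^sup>+\<xi>. ?F \<xi> \<partial>lborel) = ennreal (1 + exp (- (norm x)\<^sup>2 / 2))" .
    have ray: "(\<integral>\<^sup>+t. ennreal (t ^ (?n - 1)) * ?F (t *\<^sub>R \<theta>) * indicator {0<..} t \<partial>lborel)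
        = ennreal ((?g 0 + ?g (x \<bullet> \<theta>)) / ?s)" if \<theta>: "\<theta> \<in> unit_sphere" for \<theta>
    proof -
      let ?h = "\<lambda>t. half_moment (?n - 1) t * cos (t * 0) + half_moment (?n - 1) t * cos (t * (x \<bullet> \<theta>))"
      have ih: "integrable lborel (\<lambda>t. half_moment (?n - 1) t * cos (t * y))" for y
        by (rule half_moment_times_integrable) auto
      have "(\<integral>\<^sup>+t. ennreal (t ^ (?n - 1)) * ?F (t *\<^sub>R \<theta>) * indicator {0<..} t \<partial>lborel)
          = (\<integral>\<^sup>+t. ennreal (?h t / ?s) \<partial>lborel)"
      proof (rule nn_integral_cong)
        fix t :: real
        show "ennreal (t ^ (?n - 1)) * ?F (t *\<^sub>R \<theta>) * indicator {0<..} t = ennreal (?h t / ?s)"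
        proof (cases "t > 0")
          case True
          have "t ^ (?n - 1) * (gauss_density (t *\<^sub>R \<theta>) * (1 + cos (x \<bullet> (t *\<^sub>R \<theta>)))) = ?h t / ?s"
            using True \<theta> by (simp add: gauss_density_def half_moment_def field_simps)
          then show ?thesis
            using True nn by (simp add: less_imp_le[OF gauss_density_pos] flip: ennreal_mult)
        qed (simp add: half_moment_def)
      qed
      also have "\<dots> = ennreal (LINT t|lborel. ?h t / ?s)"
      proof (rule nn_integral_eq_integral)
        show "integrable lborel (\<lambda>t. ?h t / ?s)" using ih[of 0] ih[of "x \<bullet> \<theta>"] by auto
        have "0 \<le> ?h t / ?s" for t
        proof -
          have "?h t = half_moment (?n - 1) t * (1 + cos (t * (x \<bullet> \<theta>)))" by (simp add: distrib_left)
          then show ?thesis using nn half_moment_nonneg by simp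
        qed
        then show "AE t in lborel. 0 \<le> ?h t / ?s" by simp
      qed
      also have "(LINT t|lborel. ?h t / ?s) = (?g 0 + ?g (x \<bullet> \<theta>)) / ?s"
        using ih[of 0] ih[of "x \<bullet> \<theta>"] by (simp add: ridge_profile_def)
      finally show ?thesis .
    qed
    have pos: "0 \<le> ?g 0 + ?g y" for y using ridge_profile_bounded[of ?n y] by linarith
    have "(\<integral>\<^sup>+\<theta>. (\<integral>\<^sup>+t. ennreal (t ^ (?n - 1)) * ?F (t *\<^sub>R \<theta>) * indicator {0<..} t \<partial>lborel) \<partial>sphere_uniform)
        = (\<integral>\<^sup>+\<theta>. ennreal ((?g 0 + ?g (x \<bullet> \<theta>)) / ?s) \<partial>sphere_uniform)"
      using ray by (intro nn_integral_cong) (simp add: space_sphere_uniform)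
    also have "\<dots> = ennreal (LINT \<theta>|sphere_uniform. (?g 0 + ?g (x \<bullet> \<theta>)) / ?s)"
      using ig[of x] pos by (intro nn_integral_eq_integral) auto
    also have "(LINT \<theta>|sphere_uniform. (?g 0 + ?g (x \<bullet> \<theta>)) / ?s)
        = (?g 0 + (LINT \<theta>|sphere_uniform. ?g (x \<bullet> \<theta>))) / ?s" (is "_ = ?J / ?s")
      using ig[of x] by (simp add: S.prob_space)
    finally have "ennreal (1 + exp (- (norm x)\<^sup>2 / 2)) = ennreal (?n * unit_ball_vol ?n) * ennreal (?J / ?s)"
      using nn_integral_polar[of ?F] lhs by simp
    also have "\<dots> = ennreal (L * ?J)"
      using unit_ball_vol_pos[of "real ?n"] by (simp add: L_def mult_ac flip: ennreal_mult')
    finally have e: "ennreal (1 + exp (- (norm x)\<^sup>2 / 2)) = ennreal (L * ?J)" .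
    have p: "0 < 1 + exp (- (norm x)\<^sup>2 / 2)" by (simp add: add_pos_pos)
    then have "0 < ennreal (L * ?J)" unfolding e[symmetric] by (simp only: ennreal_less_zero_iff)
    then have "0 \<le> L * ?J" by simp
    then show ?thesis using p by (intro ennreal_inj[THEN iffD1, OF _ _ e]) auto
  qed
  have "L * ?g 0 = 1"
    using eq[of 0] by (simp add: S.prob_space)
  then have "exp (- (norm x)\<^sup>2 / 2) = L * (LINT \<theta>|sphere_uniform. ?g (x \<bullet> \<theta>))" for x :: 'a
    using eq[of x] by (simp add: distrib_left)
  then show ?thesis using L by blast
qed

lemma power_times_gauss_tendsto_0: "((\<lambda>r::real. r ^ k * exp (- r\<^sup>2 / 2)) \<longlongrightarrow> 0) at_top"
proof (rule Lim_null_comparison)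
  have "((\<lambda>r::real. exp (1/2) * (r ^ k / exp r)) \<longlongrightarrow> exp (1/2) * 0) at_top"
    by (intro tendsto_intros tendsto_power_div_exp_0)
  then show "((\<lambda>r::real. exp (1/2) * (r ^ k / exp r)) \<longlongrightarrow> 0) at_top" by simp
  show "\<forall>\<^sub>F r::real in at_top. norm (r ^ k * exp (- r\<^sup>2 / 2)) \<le> exp (1/2) * (r ^ k / exp r)"
    using eventually_ge_at_top[of 0]
  proof eventually_elim
    case (elim r)
    have "0 \<le> (r - 1)\<^sup>2" by simp
    then have "- r\<^sup>2 / 2 \<le> 1/2 - r" by (simp add: power2_diff)
    then have "exp (- r\<^sup>2 / 2) \<le> exp (1/2) / exp r" by (simp flip: exp_diff)
    from mult_left_mono[OF this, of "r ^ k"] show ?case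
      using elim by (simp add: abs_mult mult_ac)
  qed
qed

text \<open>The integral is minus the derivative of \<open>ridge_profile (Suc m)\<close> at \<open>s\<close>. With
\<open>u = r ^ Suc m * exp (- r\<^sup>2 / 2)\<close>, two integrations by parts turn \<open>s\<^sup>2\<close> times the integral of \<open>u * sin (r * s)\<close>
into minus the integral of \<open>u'' * sin (r * s)\<close>. Both are done at once with the antiderivative
\<open>u' * sin (r * s) - u * (s * cos (r * s))\<close>, which vanishes at 0 and at infinity.\<close>

lemma sine_moment_decay:
  "\<exists>M\<ge>0. \<forall>s. \<bar>LINT r|lborel. half_moment (Suc m) r * sin (r * s)\<bar> \<le> M / (1 + s\<^sup>2)"
proof -
  let ?A = "\<lambda>s. LINT r|lborel. half_moment (Suc m) r * sin (r * s)"
  define M1 where "M1 = (LINT r|lborel. half_moment (Suc m) r)"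
  define H where "H r = real (Suc m) * real m * half_moment (m - 1) r - (2 * real m + 3) * half_moment (Suc m) r
     + half_moment (m + 3) r" for r
  have iH: "integrable lborel H"
    unfolding H_def[abs_def] by (intro Bochner_Integration.integrable_add Bochner_Integration.integrable_diff integrable_mult_right half_moment_integrable)
  define M2 where "M2 = (LINT r|lborel. \<bar>H r\<bar>)"
  have b1: "\<bar>?A s\<bar> \<le> M1" for s
  proof -
    have "norm (?A s) \<le> (LINT r|lborel. norm (half_moment (Suc m) r * sin (r * s)))"
      by (rule integral_norm_bound)
    also have "\<dots> \<le> M1"
      unfolding M1_def
      by (intro integral_mono integrable_norm half_moment_times_integrable half_moment_integrable)
         (auto simp: abs_mult half_moment_nonneg intro!: mult_left_le)
    finally show ?thesis by simp
  qed
  have b2: "s\<^sup>2 * ?A s = - (LINT r|lborel. H r * sin (r * s))" for s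
  proof -
    let ?e = "\<lambda>r::real. exp (- r\<^sup>2 / 2)"
    let ?u = "\<lambda>r. r ^ Suc m * ?e r"
    let ?u' = "\<lambda>r. (real (Suc m) * r ^ m - r ^ (m + 2)) * ?e r"
    let ?u'' = "\<lambda>r. (real (Suc m) * real m * r ^ (m - 1) - (2 * real m + 3) * r ^ Suc m + r ^ (m + 3)) * ?e r"
    let ?F = "\<lambda>r. ?u' r * sin (r * s) - ?u r * (s * cos (r * s))"
    let ?f = "\<lambda>r. s\<^sup>2 * (?u r * sin (r * s)) + ?u'' r * sin (r * s)"
    have m1: "real m * (r * r ^ (m - 1)) = real m * r ^ m" for r :: real
      by (cases m) auto
    have DF: "(?F has_real_derivative ?f r) (at r)" for r
    proof -
      have du: "(?u has_real_derivative ?u' r) (at r)"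
        by (rule derivative_eq_intros refl | simp)+ (simp add: algebra_simps power2_eq_square)
      have du': "(?u' has_real_derivative ?u'' r) (at r)"
        by (rule derivative_eq_intros refl | simp)+
           (simp add: algebra_simps power2_eq_square power3_eq_cube power_add m1)
      show ?thesis
        by (rule derivative_eq_intros du du' refl | simp)+ (simp add: algebra_simps power2_eq_square)
    qed
    have ind: "indicator {0<..} r *\<^sub>R ?f r = s\<^sup>2 * (half_moment (Suc m) r * sin (r * s)) + H r * sin (r * s)" for r
      by (simp add: half_moment_def H_def algebra_simps split: split_indicator)
    have i1: "integrable lborel (\<lambda>r. half_moment (Suc m) r * sin (r * s))"
      by (rule half_moment_times_integrable) auto
    have i2: "integrable lborel (\<lambda>r. H r * sin (r * s))"
      by (rule Bochner_Integration.integrable_bound[OF iH])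
         (use iH in \<open>auto simp: abs_mult intro!: mult_left_le AE_I2\<close>)
    have ei: "einterval (ereal 0) \<infinity> = {0<..}" by (auto simp: einterval_def)
    have "(LBINT r=ereal 0..\<infinity>. ?f r) = 0 - 0"
    proof (rule interval_integral_FTC_integrable[where F="?F"])
      show "(?F has_vector_derivative ?f x) (at x)" for x
        using DF[of x] by (simp add: has_real_derivative_iff_has_vector_derivative)
      have "continuous_on UNIV ?f" by (intro continuous_intros) auto
      then show "isCont ?f x" for x by (simp add: continuous_on_eq_continuous_at)
      show "set_integrable lborel (einterval (ereal 0) \<infinity>) ?f"
        unfolding set_integrable_def ei ind
        by (intro Bochner_Integration.integrable_add integrable_mult_right i1 i2)
      have "isCont ?F 0" by (rule DERIV_isCont[OF DF])
      then have "(?F \<longlongrightarrow> ?F 0) (at 0)" by (simp only: isCont_def)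
      moreover have "?F 0 = 0" by simp
      ultimately have "(?F \<longlongrightarrow> 0) (at_right 0)" by (simp only: filterlim_at_split)
      then show "((?F \<circ> real_of_ereal) \<longlongrightarrow> 0) (at_right (ereal 0))"
        unfolding ereal_tendsto_simps .
      have "(?F \<longlongrightarrow> 0) at_top"
      proof (rule Lim_null_comparison)
        let ?G = "\<lambda>r::real. real (Suc m) * (r ^ m * ?e r) + r ^ (m + 2) * ?e r + \<bar>s\<bar> * ?u r"
        have "(?G \<longlongrightarrow> real (Suc m) * 0 + 0 + \<bar>s\<bar> * 0) at_top"
          by (intro tendsto_intros power_times_gauss_tendsto_0)
        then show "(?G \<longlongrightarrow> 0) at_top" by simp
        show "\<forall>\<^sub>F r in at_top. norm (?F r) \<le> ?G r"
          using eventually_ge_at_top[of 0]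
        proof eventually_elim
          case (elim r)
          have "\<bar>?F r\<bar> \<le> \<bar>?u' r\<bar> * \<bar>sin (r * s)\<bar> + \<bar>?u r\<bar> * (\<bar>s\<bar> * \<bar>cos (r * s)\<bar>)"
            by (rule order_trans[OF abs_triangle_ineq4]) (simp add: abs_mult)
          also have "\<dots> \<le> \<bar>?u' r\<bar> * 1 + \<bar>?u r\<bar> * (\<bar>s\<bar> * 1)"
            by (intro add_mono mult_left_mono) auto
          also have "\<bar>?u' r\<bar> \<le> (real (Suc m) * r ^ m + r ^ (m + 2)) * ?e r"
            unfolding abs_mult abs_exp_cancel
            by (intro mult_right_mono order_trans[OF abs_triangle_ineq4]) (use elim in auto)
          finally show ?case using elim by (simp add: algebra_simps)
        qed
      qed
      then show "((?F \<circ> real_of_ereal) \<longlongrightarrow> 0) (at_left \<infinity>)"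
        unfolding ereal_tendsto_simps .
    qed simp
    then have "(LINT r:{0<..}|lborel. ?f r) = 0"
      by (simp add: interval_integral_to_infinity_eq)
    then have "(LINT r|lborel. s\<^sup>2 * (half_moment (Suc m) r * sin (r * s)) + H r * sin (r * s)) = 0"
      unfolding set_lebesgue_integral_def ind .
    then show ?thesis using i1 i2 by simp
  qed
  have "\<bar>?A s\<bar> \<le> (M1 + M2) / (1 + s\<^sup>2)" for s
  proof -
    have "\<bar>s\<^sup>2 * ?A s\<bar> \<le> M2"
    proof -
      have "norm (LINT r|lborel. H r * sin (r * s)) \<le> (LINT r|lborel. norm (H r * sin (r * s)))"
        by (rule integral_norm_bound)
      also have "\<dots> \<le> M2"
        unfolding M2_def
      proof (intro integral_mono integrable_norm)
        show "integrable lborel (\<lambda>r. H r * sin (r * s))"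
          by (rule Bochner_Integration.integrable_bound[OF iH])
             (use iH in \<open>auto simp: abs_mult intro!: mult_left_le AE_I2\<close>)
      qed (use iH in \<open>auto simp: abs_mult intro!: mult_left_le\<close>)
      finally show ?thesis unfolding b2 by simp
    qed
    then have "(1 + s\<^sup>2) * \<bar>?A s\<bar> \<le> M1 + M2"
      using b1[of s] by (simp add: abs_mult distrib_right)
    moreover have "1 + s\<^sup>2 > 0" by (simp add: add_pos_nonneg)
    ultimately show ?thesis by (simp add: field_simps)
  qed
  moreover have "M1 + M2 \<ge> 0"
    using b1[of 0] by (auto simp: M2_def intro!: add_nonneg_nonneg)
  ultimately show ?thesis by blast
qed

text \<open>The fundamental theorem of calculus for the profile, from the one for cosine by Fubini.\<close>

lemma ridge_profile_diff:
  assumes "a \<le> b"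
  shows "ridge_profile (Suc m) a - ridge_profile (Suc m) b
    = (LINT v|lborel. indicator {a..b} v * (LINT r|lborel. half_moment (Suc m) r * sin (r * v)))"
proof -
  let ?f = "\<lambda>v r. indicator {a..b} v * (half_moment (Suc m) r * sin (r * v)) :: real"
  have "integrable (lborel \<Otimes>\<^sub>M lborel) (\<lambda>z. indicator {a..b} (fst z) * half_moment (Suc m) (snd z) :: real)"
  proof (rule lborel_pair.Fubini_integrable)
    have "integrable lborel (\<lambda>v. indicator {a..b} v * (LINT r|lborel. half_moment (Suc m) r))"
      by (intro integrable_mult_left integrable_real_indicator) (auto simp: emeasure_lborel_Icc_eq)
    then show "integrable lborel (\<lambda>v. LINT r|lborel. norm (indicator {a..b} (fst (v, r)) * half_moment (Suc m) (snd (v, r)) :: real))"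
      by (simp add: abs_mult half_moment_nonneg)
    show "AE v in lborel. integrable lborel (\<lambda>r. indicator {a..b} (fst (v, r)) * half_moment (Suc m) (snd (v, r)) :: real)"
      using half_moment_integrable by simp
  qed measurable
  then have int: "integrable (lborel \<Otimes>\<^sub>M lborel) (\<lambda>(v, r). ?f v r)"
    by (rule Bochner_Integration.integrable_bound)
       (auto simp: abs_mult half_moment_nonneg mult.assoc[symmetric] intro!: mult_left_le AE_I2)
  have "(LINT v|lborel. indicator {a..b} v * (LINT r|lborel. half_moment (Suc m) r * sin (r * v)))
      = (LINT v|lborel. LINT r|lborel. ?f v r)" by simp
  also have "\<dots> = (LINT r|lborel. LINT v|lborel. ?f v r)"
    using lborel_pair.Fubini_integral[OF int] by simp
  also have "\<dots> = (LINT r|lborel. half_moment m r * cos (r * a) - half_moment m r * cos (r * b))"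
  proof (rule Bochner_Integration.integral_cong[OF refl])
    fix r :: real
    have "(LINT v|lborel. (r * sin (r * v)) * indicator {a..b} v) = - cos (r * b) - (- cos (r * a))"
      by (rule integral_FTC_Icc_real[OF assms]) (auto intro!: derivative_eq_intros continuous_intros)
    then have "(LINT v|lborel. half_moment m r * ((r * sin (r * v)) * indicator {a..b} v)) = half_moment m r * (cos (r * a) - cos (r * b))"
      by simp
    moreover have "half_moment m r * ((r * sin (r * v)) * indicator {a..b} v) = ?f v r" for v
      by (simp add: half_moment_def mult_ac)
    ultimately show "(LINT v|lborel. ?f v r) = half_moment m r * cos (r * a) - half_moment m r * cos (r * b)"
      by (simp add: right_diff_distrib)
  qed
  also have "\<dots> = ridge_profile (Suc m) a - ridge_profile (Suc m) b"
    by (simp add: ridge_profile_def half_moment_times_integrable)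
  finally show ?thesis by simp
qed

text \<open>The constant is the integral of a bound for the derivative, integrable by its quadratic decay.\<close>

lemma ridge_profile_L1_modulus:
  "\<exists>A\<ge>0. \<forall>h\<ge>0. (\<integral>\<^sup>+t. ennreal \<bar>ridge_profile (Suc m) (t + h) - ridge_profile (Suc m) t\<bar> \<partial>lborel) \<le> ennreal (A * h)"
proof -
  let ?g = "ridge_profile (Suc m)"
  let ?S = "\<lambda>v. LINT r|lborel. half_moment (Suc m) r * sin (r * v)"
  obtain M where M: "M \<ge> 0" "\<And>v. \<bar>?S v\<bar> \<le> M / (1 + v\<^sup>2)"
    using sine_moment_decay[of m] by blast
  have int: "integrable lborel (\<lambda>v::real. M / (1 + v\<^sup>2))"
    using integrable_inverse_1_plus_square
    by (simp add: set_integrable_def divide_inverse)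
  have nn: "0 \<le> M / (1 + v\<^sup>2)" for v using M by simp
  define A where "A = (LINT v|lborel. M / (1 + v\<^sup>2))"
  have A: "(\<integral>\<^sup>+v. ennreal (M / (1 + v\<^sup>2)) \<partial>lborel) = ennreal A" "A \<ge> 0"
    using int nn by (auto simp: A_def nn_integral_eq_integral)
  have "(\<integral>\<^sup>+t. ennreal \<bar>?g (t + h) - ?g t\<bar> \<partial>lborel) \<le> ennreal (A * h)" if h: "h \<ge> 0" for h
  proof -
    have pt: "ennreal \<bar>?g (t + h) - ?g t\<bar> \<le> (\<integral>\<^sup>+v. ennreal (M / (1 + v\<^sup>2)) * indicator {0..h} (v - t) \<partial>lborel)" for t
    proof -
      have i: "integrable lborel (\<lambda>v. indicator {t..t + h} v *\<^sub>R (M / (1 + v\<^sup>2)))"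
        by (intro integrable_mult_indicator int) simp
      have "\<bar>?g (t + h) - ?g t\<bar> = \<bar>LINT v|lborel. indicator {t..t + h} v * ?S v\<bar>"
        using ridge_profile_diff[of t "t + h" m] h by simp
      also have "\<dots> \<le> (LINT v|lborel. indicator {t..t + h} v *\<^sub>R (M / (1 + v\<^sup>2)))"
      proof (rule integral_abs_bound_integral[OF _ i])
        show "integrable lborel (\<lambda>v. indicator {t..t + h} v * ?S v)"
          by (rule Bochner_Integration.integrable_bound[OF i]) (use M in \<open>auto intro!: AE_I2 split: split_indicator\<close>)
      qed (use M in \<open>auto split: split_indicator\<close>)
      finally have "ennreal \<bar>?g (t + h) - ?g t\<bar> \<le> ennreal (LINT v|lborel. indicator {t..t + h} v *\<^sub>R (M / (1 + v\<^sup>2)))"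
        by (rule ennreal_leI)
      also have "\<dots> = (\<integral>\<^sup>+v. ennreal (indicator {t..t + h} v *\<^sub>R (M / (1 + v\<^sup>2))) \<partial>lborel)"
        using M(1) by (intro nn_integral_eq_integral[symmetric] i) (auto intro!: AE_I2 split: split_indicator)
      also have "\<dots> = (\<integral>\<^sup>+v. ennreal (M / (1 + v\<^sup>2)) * indicator {0..h} (v - t) \<partial>lborel)"
        by (intro nn_integral_cong) (auto split: split_indicator)
      finally show ?thesis .
    qed
    have "(\<integral>\<^sup>+t. ennreal \<bar>?g (t + h) - ?g t\<bar> \<partial>lborel)
        \<le> (\<integral>\<^sup>+t. (\<integral>\<^sup>+v. ennreal (M / (1 + v\<^sup>2)) * indicator {0..h} (v - t) \<partial>lborel) \<partial>lborel)"
      by (intro nn_integral_mono pt)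
    also have "\<dots> = (\<integral>\<^sup>+v. (\<integral>\<^sup>+t. ennreal (M / (1 + v\<^sup>2)) * indicator {0..h} (v - t) \<partial>lborel) \<partial>lborel)"
      by (rule lborel_pair.Fubini') measurable
    also have "\<dots> = (\<integral>\<^sup>+v. ennreal (M / (1 + v\<^sup>2)) * ennreal h \<partial>lborel)"
    proof (rule nn_integral_cong)
      fix v :: real
      have "(\<integral>\<^sup>+t. ennreal (M / (1 + v\<^sup>2)) * indicator {0..h} (v - t) \<partial>lborel)
          = (\<integral>\<^sup>+t. ennreal (M / (1 + v\<^sup>2)) * indicator {v - h..v} t \<partial>lborel)"
        by (intro nn_integral_cong) (auto split: split_indicator)
      also have "\<dots> = ennreal (M / (1 + v\<^sup>2)) * ennreal h"
        using h by (subst nn_integral_cmult_indicator) auto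
      finally show "(\<integral>\<^sup>+t. ennreal (M / (1 + v\<^sup>2)) * indicator {0..h} (v - t) \<partial>lborel) = ennreal (M / (1 + v\<^sup>2)) * ennreal h" .
    qed
    also have "\<dots> = ennreal (A * h)"
      using A h by (subst nn_integral_multc) (auto simp: ennreal_mult)
    finally show ?thesis .
  qed
  then show ?thesis using A by blast
qed

text \<open>The constant does not depend on \<open>e\<close>, because dilating a function preserves its total variation.\<close>

lemma ridge_profile_scaled_L1_le:
  "\<exists>A\<ge>0. \<forall>e>0. \<forall>s s'. (\<integral>\<^sup>+t. ennreal \<bar>ridge_profile (Suc m) ((t - s) / e) - ridge_profile (Suc m) ((t - s') / e)\<bar> \<partial>lborel)
     \<le> ennreal (A * \<bar>s - s'\<bar>)"
proof -
  let ?g = "ridge_profile (Suc m)"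
  obtain A where A: "A \<ge> 0" "\<And>h. h \<ge> 0 \<Longrightarrow> (\<integral>\<^sup>+t. ennreal \<bar>?g (t + h) - ?g t\<bar> \<partial>lborel) \<le> ennreal (A * h)"
    using ridge_profile_L1_modulus[of m] by blast
  have le: "(\<integral>\<^sup>+t. ennreal \<bar>?g ((t - s) / e) - ?g ((t - s') / e)\<bar> \<partial>lborel) \<le> ennreal (A * \<bar>s - s'\<bar>)"
    if e: "e > 0" and ss: "s \<le> s'" for e s s'
  proof -
    have "(\<integral>\<^sup>+t. ennreal \<bar>?g ((t - s) / e) - ?g ((t - s') / e)\<bar> \<partial>lborel)
        = ennreal \<bar>e\<bar> * (\<integral>\<^sup>+t. ennreal \<bar>?g ((s' + e * t - s) / e) - ?g ((s' + e * t - s') / e)\<bar> \<partial>lborel)"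
      by (rule nn_integral_real_affine) (use e in auto)
    also have "(\<integral>\<^sup>+t. ennreal \<bar>?g ((s' + e * t - s) / e) - ?g ((s' + e * t - s') / e)\<bar> \<partial>lborel)
        = (\<integral>\<^sup>+t. ennreal \<bar>?g (t + (s' - s) / e) - ?g t\<bar> \<partial>lborel)"
    proof (rule nn_integral_cong)
      fix t :: real
      have "(s' + e * t - s) / e = t + (s' - s) / e" "(s' + e * t - s') / e = t"
        using e by (auto simp: field_simps)
      then show "ennreal \<bar>?g ((s' + e * t - s) / e) - ?g ((s' + e * t - s') / e)\<bar> = ennreal \<bar>?g (t + (s' - s) / e) - ?g t\<bar>"
        by simp
    qed
    also have "ennreal \<bar>e\<bar> * \<dots> \<le> ennreal \<bar>e\<bar> * ennreal (A * ((s' - s) / e))"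
      using e ss by (intro mult_left_mono A) auto
    also have "\<dots> = ennreal (A * \<bar>s - s'\<bar>)"
      using e ss A by (simp flip: ennreal_mult)
    finally show ?thesis .
  qed
  have "(\<integral>\<^sup>+t. ennreal \<bar>?g ((t - s) / e) - ?g ((t - s') / e)\<bar> \<partial>lborel) \<le> ennreal (A * \<bar>s - s'\<bar>)"
    if e: "e > 0" for e s s'
    using le[OF e, of s s'] le[OF e, of s' s] by (cases "s \<le> s'") (auto simp: abs_minus_commute)
  then show ?thesis using A by blast
qed

section \<open>Coupling two measures through a common kernel\<close>

lemma ennreal_mult_divide_max:
  fixes a b :: ennreal
  assumes "0 < a" "a < \<top>" "0 < b" "b < \<top>"
  shows "a * (b / max a b) = min a b"
proof (cases "a \<le> b")
  case True
  have "b / b = 1" using assms by (intro ennreal_divide_self) auto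
  then show ?thesis using True by (simp add: max_def min_def)
next
  case False
  have "a * (b / a) = (a / a) * b" by (simp add: ennreal_times_divide mult.commute divide_ennreal_def mult.left_commute)
  also have "a / a = 1" using assms by (intro ennreal_divide_self) auto
  finally show ?thesis using False by (simp add: max_def min_def)
qed

text \<open>Let \<open>\<rho>\<close> and \<open>\<sigma>\<close> be two densities, \<open>\<rho>\<close> arising from \<open>\<mu>\<close> by smoothing with \<open>q\<close>. At \<open>x\<close> they have \<open>min (\<rho> x) (\<sigma> x)\<close>
in common, which is the proportion \<open>\<sigma> x / max (\<rho> x) (\<sigma> x)\<close> of the mass \<open>\<rho> x\<close>. If each \<open>y\<close> keeps that
proportion of what it sends to \<open>x\<close>, it keeps the integral below in total.\<close>

lemma overlap_weight:
  fixes q :: "'x \<Rightarrow> 'y \<Rightarrow> ennreal" and \<rho> \<sigma> :: "'x \<Rightarrow> ennreal"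
  assumes "prob_space \<mu>" "sigma_finite_measure L"
    and [measurable]: "case_prod q \<in> borel_measurable (L \<Otimes>\<^sub>M \<mu>)" "\<sigma> \<in> borel_measurable L"
    and \<rho>: "\<And>x. x \<in> space L \<Longrightarrow> \<rho> x = (\<integral>\<^sup>+y. q x y \<partial>\<mu>)"
    and pos: "\<And>x. x \<in> space L \<Longrightarrow> 0 < \<rho> x \<and> \<rho> x < \<top> \<and> 0 < \<sigma> x \<and> \<sigma> x < \<top>"
    and normalized: "\<And>y. y \<in> space \<mu> \<Longrightarrow> (\<integral>\<^sup>+x. q x y \<partial>L) = 1"
  shows "\<And>y. y \<in> space \<mu> \<Longrightarrow> (\<integral>\<^sup>+x. q x y * (\<sigma> x / max (\<rho> x) (\<sigma> x)) \<partial>L) \<le> 1"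
    and "(\<integral>\<^sup>+y. (\<integral>\<^sup>+x. q x y * (\<sigma> x / max (\<rho> x) (\<sigma> x)) \<partial>L) \<partial>\<mu>) = (\<integral>\<^sup>+x. min (\<rho> x) (\<sigma> x) \<partial>L)"
proof -
  interpret \<mu>: prob_space \<mu> by fact
  interpret L: sigma_finite_measure L by fact
  interpret P: pair_sigma_finite L \<mu> ..
  have [measurable]: "\<rho> \<in> borel_measurable L"
    by (subst measurable_cong[OF \<rho>]) measurable
  show "(\<integral>\<^sup>+x. q x y * (\<sigma> x / max (\<rho> x) (\<sigma> x)) \<partial>L) \<le> 1" if y: "y \<in> space \<mu>" for y
  proof -
    have "(\<integral>\<^sup>+x. q x y * (\<sigma> x / max (\<rho> x) (\<sigma> x)) \<partial>L) \<le> (\<integral>\<^sup>+x. q x y * 1 \<partial>L)"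
      using pos by (intro nn_integral_mono mult_left_mono)
        (auto intro!: divide_le_posI_ennreal simp: less_max_iff_disj)
    then show ?thesis using normalized[OF y] by simp
  qed
  have "(\<integral>\<^sup>+y. (\<integral>\<^sup>+x. q x y * (\<sigma> x / max (\<rho> x) (\<sigma> x)) \<partial>L) \<partial>\<mu>) = (\<integral>\<^sup>+x. (\<integral>\<^sup>+y. q x y * (\<sigma> x / max (\<rho> x) (\<sigma> x)) \<partial>\<mu>) \<partial>L)"
    by (rule P.Fubini') measurable
  also have "\<dots> = (\<integral>\<^sup>+x. \<rho> x * (\<sigma> x / max (\<rho> x) (\<sigma> x)) \<partial>L)"
    by (intro nn_integral_cong) (simp add: nn_integral_multc \<rho>)
  also have "\<dots> = (\<integral>\<^sup>+x. min (\<rho> x) (\<sigma> x) \<partial>L)"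
    using pos by (intro nn_integral_cong ennreal_mult_divide_max) auto
  finally show "(\<integral>\<^sup>+y. (\<integral>\<^sup>+x. q x y * (\<sigma> x / max (\<rho> x) (\<sigma> x)) \<partial>L) \<partial>\<mu>) = (\<integral>\<^sup>+x. min (\<rho> x) (\<sigma> x) \<partial>L)" .
qed

text \<open>A partial coupling of total mass \<open>m\<close> has marginal densities \<open>\<alpha>\<close> and \<open>\<beta>\<close>. Matching the leftover masses
\<open>1 - \<alpha>\<close> and \<open>1 - \<beta>\<close> independently of each other restores the marginals.\<close>

lemma completion_marginal:
  fixes \<alpha> \<beta> :: "_ \<Rightarrow> ennreal"
  assumes "prob_space \<mu>" "prob_space \<nu>"
    and [measurable]: "\<alpha> \<in> borel_measurable \<mu>" "\<beta> \<in> borel_measurable \<nu>"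
    and \<alpha>: "\<And>y. y \<in> space \<mu> \<Longrightarrow> \<alpha> y \<le> 1" and \<beta>: "\<And>z. z \<in> space \<nu> \<Longrightarrow> \<beta> z \<le> 1"
    and int\<alpha>: "(\<integral>\<^sup>+y. \<alpha> y \<partial>\<mu>) = m" and int\<beta>: "(\<integral>\<^sup>+z. \<beta> z \<partial>\<nu>) = m"
  shows "AE y in \<mu>. \<alpha> y + (\<integral>\<^sup>+z. (1 - \<alpha> y) * (1 - \<beta> z) / (1 - m) \<partial>\<nu>) = 1"
    and "(\<integral>\<^sup>+z. 1 - \<beta> z \<partial>\<nu>) = 1 - m"
proof -
  interpret \<mu>: prob_space \<mu> by fact
  interpret \<nu>: prob_space \<nu> by fact
  have m: "m \<le> 1"
    using nn_integral_mono[of \<mu> \<alpha> "\<lambda>_. 1"] \<alpha> int\<alpha> \<mu>.emeasure_space_1 by auto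
  have defect: "(\<integral>\<^sup>+y. 1 - f y \<partial>M) = 1 - m"
    if M: "prob_space M" and f[measurable]: "f \<in> borel_measurable M" and le: "\<And>y. y \<in> space M \<Longrightarrow> f y \<le> 1"
      and int: "(\<integral>\<^sup>+y. f y \<partial>M) = m" for M and f :: "'z \<Rightarrow> ennreal"
  proof -
    have "(\<integral>\<^sup>+y. 1 - f y \<partial>M) = (\<integral>\<^sup>+y. 1 \<partial>M) - (\<integral>\<^sup>+y. f y \<partial>M)"
      using le m int by (intro nn_integral_diff) (auto simp: top_unique)
    then show ?thesis using int prob_space.emeasure_space_1[OF M] by simp
  qed
  show d\<beta>: "(\<integral>\<^sup>+z. 1 - \<beta> z \<partial>\<nu>) = 1 - m"
    by (rule defect) (use assms in auto)
  have d\<alpha>: "(\<integral>\<^sup>+y. 1 - \<alpha> y \<partial>\<mu>) = 1 - m"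
    by (rule defect) (use assms in auto)
  have inner: "(\<integral>\<^sup>+z. (1 - \<alpha> y) * (1 - \<beta> z) / (1 - m) \<partial>\<nu>) = (1 - \<alpha> y) * ((1 - m) / (1 - m))" for y
  proof -
    have "(\<integral>\<^sup>+z. (1 - \<alpha> y) * (1 - \<beta> z) / (1 - m) \<partial>\<nu>) = (\<integral>\<^sup>+z. (1 - \<alpha> y) / (1 - m) * (1 - \<beta> z) \<partial>\<nu>)"
      by (simp add: divide_ennreal_def mult_ac)
    also have "\<dots> = (1 - \<alpha> y) / (1 - m) * (1 - m)"
      by (subst nn_integral_cmult) (auto simp: d\<beta>)
    finally show ?thesis by (simp add: divide_ennreal_def mult_ac)
  qed
  show "AE y in \<mu>. \<alpha> y + (\<integral>\<^sup>+z. (1 - \<alpha> y) * (1 - \<beta> z) / (1 - m) \<partial>\<nu>) = 1"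
  proof (cases "m = 1")
    case True
    \<comment> \<open>No mass is left over: the weights are 1 almost everywhere, and the second summand vanishes.\<close>
    have "AE y in \<mu>. 1 - \<alpha> y = 0"
      using d\<alpha> True by (subst nn_integral_0_iff_AE[symmetric]) auto
    then show ?thesis
      using AE_space
    proof eventually_elim
      case (elim y)
      then have "\<alpha> y = 1" using \<alpha>[of y] by (simp add: diff_eq_0_iff_ennreal antisym)
      then show ?case by (simp add: inner)
    qed
  next
    case False
    then have "(1 - m) / (1 - m) = 1"
      using m by (intro ennreal_divide_self)
        (auto simp: diff_eq_0_iff_ennreal intro: le_less_trans[OF diff_le_self_ennreal])
    then show ?thesis using \<alpha> by (intro AE_I2) (simp add: inner)
  qed
qed

text \<open>The cost of going from \<open>y\<close> to \<open>x\<close> in a coupling through \<open>x\<close>: the possible partners \<open>z\<close> have total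
weight at most 1, so it is at most the cost of smoothing \<open>M\<close> by \<open>q\<close>.\<close>

lemma transport_leg_cost_le:
  fixes q b :: "'x \<Rightarrow> 'y \<Rightarrow> ennreal"
  assumes "sigma_finite_measure L" "sigma_finite_measure N"
    and [measurable]: "case_prod q \<in> borel_measurable (L \<Otimes>\<^sub>M M)" "case_prod q \<in> borel_measurable (L \<Otimes>\<^sub>M N)"
      "case_prod b \<in> borel_measurable (L \<Otimes>\<^sub>M M)" "w \<in> borel_measurable L"
    and w: "\<And>x. x \<in> space L \<Longrightarrow> (\<integral>\<^sup>+z. q x z \<partial>N) * w x \<le> 1"
  shows "(\<integral>\<^sup>+y. (\<integral>\<^sup>+z. (\<integral>\<^sup>+x. b x y * q x y * (q x z * w x) \<partial>L) \<partial>N) \<partial>M)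
     \<le> (\<integral>\<^sup>+y. (\<integral>\<^sup>+x. b x y * q x y \<partial>L) \<partial>M)"
proof (rule nn_integral_mono)
  interpret L: sigma_finite_measure L by fact
  interpret N: sigma_finite_measure N by fact
  interpret LN: pair_sigma_finite L N ..
  fix y assume [measurable]: "y \<in> space M"
  have "(\<integral>\<^sup>+z. (\<integral>\<^sup>+x. b x y * q x y * (q x z * w x) \<partial>L) \<partial>N) = (\<integral>\<^sup>+x. (\<integral>\<^sup>+z. b x y * q x y * (q x z * w x) \<partial>N) \<partial>L)"
    by (rule LN.Fubini') measurable
  also have "\<dots> \<le> (\<integral>\<^sup>+x. b x y * q x y * 1 \<partial>L)"
  proof (rule nn_integral_mono)
    fix x assume x[measurable]: "x \<in> space L"
    have "(\<integral>\<^sup>+z. b x y * q x y * (q x z * w x) \<partial>N) = b x y * q x y * ((\<integral>\<^sup>+z. q x z \<partial>N) * w x)"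
      using measurable_Pair2[OF assms(4) x] by (simp add: nn_integral_cmult nn_integral_multc)
    also have "\<dots> \<le> b x y * q x y * 1" by (intro mult_left_mono w x) simp
    finally show "(\<integral>\<^sup>+z. b x y * q x y * (q x z * w x) \<partial>N) \<le> b x y * q x y * 1" .
  qed
  finally show "(\<integral>\<^sup>+z. (\<integral>\<^sup>+x. b x y * q x y * (q x z * w x) \<partial>L) \<partial>N) \<le> (\<integral>\<^sup>+x. b x y * q x y \<partial>L)" by simp
qed

text \<open>Both measures are smoothed by the same kernel \<open>q\<close>. Where the smoothed densities overlap, mass travels
from \<open>y\<close> to a common smoothed position \<open>x\<close> and on to \<open>z\<close>, at the price \<open>b x y + b x z\<close>; all other
mass is matched independently, at a price of at most \<open>D\<close>.\<close>

lemma kernel_coupling: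
  fixes q b :: "'x \<Rightarrow> 'y \<Rightarrow> ennreal" and c :: "'y \<Rightarrow> 'y \<Rightarrow> ennreal"
  defines "\<rho> \<equiv> \<lambda>\<mu> x. \<integral>\<^sup>+y. q x y \<partial>\<mu>"
  assumes \<mu>: "prob_space \<mu>" and \<nu>: "prob_space \<nu>" and sets_eq: "sets \<nu> = sets \<mu>" and L: "sigma_finite_measure L"
    and q[measurable]: "case_prod q \<in> borel_measurable (L \<Otimes>\<^sub>M \<mu>)"
    and normalized: "\<And>y. y \<in> space \<mu> \<Longrightarrow> (\<integral>\<^sup>+x. q x y \<partial>L) = 1"
    and pos: "\<And>x. x \<in> space L \<Longrightarrow> 0 < \<rho> \<mu> x \<and> \<rho> \<mu> x < \<top> \<and> 0 < \<rho> \<nu> x \<and> \<rho> \<nu> x < \<top>"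
    and c[measurable]: "case_prod c \<in> borel_measurable (\<mu> \<Otimes>\<^sub>M \<nu>)"
    and b[measurable]: "case_prod b \<in> borel_measurable (L \<Otimes>\<^sub>M \<mu>)"
    and triangle: "\<And>x y z. x \<in> space L \<Longrightarrow> y \<in> space \<mu> \<Longrightarrow> z \<in> space \<mu> \<Longrightarrow> c y z \<le> b x y + b x z"
    and D: "\<And>y z. y \<in> space \<mu> \<Longrightarrow> z \<in> space \<mu> \<Longrightarrow> c y z \<le> D"
  shows "\<exists>\<pi>\<in>couplings \<mu> \<nu>. (\<integral>\<^sup>+w. c (fst w) (snd w) \<partial>\<pi>)
     \<le> (\<integral>\<^sup>+y. (\<integral>\<^sup>+x. b x y * q x y \<partial>L) \<partial>\<mu>) + (\<integral>\<^sup>+y. (\<integral>\<^sup>+x. b x y * q x y \<partial>L) \<partial>\<nu>)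
       + D * (1 - (\<integral>\<^sup>+x. min (\<rho> \<mu> x) (\<rho> \<nu> x) \<partial>L))"
proof -
  interpret \<mu>: prob_space \<mu> by fact
  interpret \<nu>: prob_space \<nu> by fact
  interpret L: sigma_finite_measure L by fact
  interpret L\<mu>: pair_sigma_finite L \<mu> ..
  interpret L\<nu>: pair_sigma_finite L \<nu> ..
  interpret \<mu>\<nu>: pair_prob_space \<mu> \<nu> ..
  note sets_eq[measurable_cong]
  have sp: "space \<nu> = space \<mu>" using sets_eq by (rule sets_eq_imp_space_eq)
  have sL: "sets (L \<Otimes>\<^sub>M \<nu>) = sets (L \<Otimes>\<^sub>M \<mu>)" by (intro sets_pair_measure_cong refl sets_eq)
  have q\<nu>[measurable]: "case_prod q \<in> borel_measurable (L \<Otimes>\<^sub>M \<nu>)"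
    using q by (simp add: measurable_cong_sets[OF sL refl])
  have b\<nu>[measurable]: "case_prod b \<in> borel_measurable (L \<Otimes>\<^sub>M \<nu>)"
    using b by (simp add: measurable_cong_sets[OF sL refl])
  define r s where "r = \<rho> \<mu>" and "s = \<rho> \<nu>"
  have r[measurable]: "r \<in> borel_measurable L" and s[measurable]: "s \<in> borel_measurable L"
    unfolding r_def s_def \<rho>_def by measurable
  have pos': "0 < r x \<and> r x < \<top> \<and> 0 < s x \<and> s x < \<top>" if "x \<in> space L" for x
    using pos[OF that] by (simp add: r_def s_def)
  define m where "m = (\<integral>\<^sup>+x. min (r x) (s x) \<partial>L)"
  define \<alpha> where "\<alpha> y = (\<integral>\<^sup>+x. q x y * (s x / max (r x) (s x)) \<partial>L)" for y
  define \<beta> where "\<beta> z = (\<integral>\<^sup>+x. q x z * (r x / max (s x) (r x)) \<partial>L)" for z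
  have \<alpha>[measurable]: "\<alpha> \<in> borel_measurable \<mu>" and \<beta>[measurable]: "\<beta> \<in> borel_measurable \<nu>"
    unfolding \<alpha>_def[abs_def] \<beta>_def[abs_def] by measurable
  have \<alpha>1: "\<alpha> y \<le> 1" if "y \<in> space \<mu>" for y
    unfolding \<alpha>_def by (rule overlap_weight(1)[OF \<mu> L q s _ _ normalized that]) (use pos' in \<open>auto simp: r_def \<rho>_def\<close>)
  have int\<alpha>: "(\<integral>\<^sup>+y. \<alpha> y \<partial>\<mu>) = m"
    unfolding \<alpha>_def m_def by (rule overlap_weight(2)[OF \<mu> L q s _ _ normalized]) (use pos' in \<open>auto simp: r_def \<rho>_def\<close>)
  have normalized\<nu>: "(\<integral>\<^sup>+x. q x y \<partial>L) = 1" if "y \<in> space \<nu>" for y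
    using normalized that sp by simp
  have \<beta>1: "\<beta> y \<le> 1" if "y \<in> space \<nu>" for y
    unfolding \<beta>_def by (rule overlap_weight(1)[OF \<nu> L q\<nu> r _ _ normalized\<nu> that]) (use pos' in \<open>auto simp: s_def \<rho>_def\<close>)
  have int\<beta>: "(\<integral>\<^sup>+y. \<beta> y \<partial>\<nu>) = m"
    unfolding \<beta>_def m_def min.commute[of "r _"] by (rule overlap_weight(2)[OF \<nu> L q\<nu> r _ _ normalized\<nu>]) (use pos' in \<open>auto simp: s_def \<rho>_def\<close>)
  \<comment> \<open>\<open>\<kappa>\<close> is the joint density of \<open>y\<close> and \<open>z\<close> when \<open>x\<close> is drawn from the overlap \<open>min r s\<close> and then
    \<open>y\<close> and \<open>z\<close> are drawn independently from their conditional laws \<open>q x y / r x\<close> and \<open>q x z / s x\<close>.\<close>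
  define \<kappa> where "\<kappa> y z = (\<integral>\<^sup>+x. q x y * q x z / max (r x) (s x) \<partial>L)" for y z
  define k where "k w = \<kappa> (fst w) (snd w) + (1 - \<alpha> (fst w)) * (1 - \<beta> (snd w)) / (1 - m)" for w
  have \<kappa>[measurable]: "(\<lambda>w. \<kappa> (fst w) (snd w)) \<in> borel_measurable (\<mu> \<Otimes>\<^sub>M \<nu>)"
    unfolding \<kappa>_def by measurable
  have k[measurable]: "k \<in> borel_measurable (\<mu> \<Otimes>\<^sub>M \<nu>)"
    unfolding k_def[abs_def] by measurable
  have \<kappa>1: "(\<integral>\<^sup>+z. \<kappa> y z \<partial>\<nu>) = \<alpha> y" if y: "y \<in> space \<mu>" for y
  proof -
    have "(\<integral>\<^sup>+z. \<kappa> y z \<partial>\<nu>) = (\<integral>\<^sup>+x. (\<integral>\<^sup>+z. q x y * q x z / max (r x) (s x) \<partial>\<nu>) \<partial>L)"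
      unfolding \<kappa>_def by (rule L\<nu>.Fubini') (use y in measurable)
    also have "\<dots> = \<alpha> y"
      unfolding \<alpha>_def
    proof (rule nn_integral_cong)
      fix x assume [measurable]: "x \<in> space L"
      have "(\<integral>\<^sup>+z. q x y * q x z / max (r x) (s x) \<partial>\<nu>) = (\<integral>\<^sup>+z. q x y / max (r x) (s x) * q x z \<partial>\<nu>)"
        by (simp add: divide_ennreal_def mult_ac)
      also have "\<dots> = q x y / max (r x) (s x) * s x"
        by (subst nn_integral_cmult) (auto simp: s_def \<rho>_def)
      finally show "(\<integral>\<^sup>+z. q x y * q x z / max (r x) (s x) \<partial>\<nu>) = q x y * (s x / max (r x) (s x))"
        by (simp add: divide_ennreal_def mult_ac)
    qed
    finally show ?thesis .
  qed
  have \<kappa>2: "(\<integral>\<^sup>+y. \<kappa> y z \<partial>\<mu>) = \<beta> z" if z: "z \<in> space \<nu>" for z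
  proof -
    have "(\<integral>\<^sup>+y. \<kappa> y z \<partial>\<mu>) = (\<integral>\<^sup>+x. (\<integral>\<^sup>+y. q x y * q x z / max (r x) (s x) \<partial>\<mu>) \<partial>L)"
      unfolding \<kappa>_def by (rule L\<mu>.Fubini') (use z in measurable)
    also have "\<dots> = \<beta> z"
      unfolding \<beta>_def
    proof (rule nn_integral_cong)
      fix x assume [measurable]: "x \<in> space L"
      have "(\<integral>\<^sup>+y. q x y * q x z / max (r x) (s x) \<partial>\<mu>) = (\<integral>\<^sup>+y. q x z / max (r x) (s x) * q x y \<partial>\<mu>)"
        by (simp add: divide_ennreal_def mult_ac)
      also have "\<dots> = q x z / max (r x) (s x) * r x"
        by (subst nn_integral_cmult) (auto simp: r_def \<rho>_def)
      finally show "(\<integral>\<^sup>+y. q x y * q x z / max (r x) (s x) \<partial>\<mu>) = q x z * (r x / max (s x) (r x))"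
        by (simp add: divide_ennreal_def mult_ac max.commute)
    qed
    finally show ?thesis .
  qed
  have rest\<alpha>: "AE y in \<mu>. \<alpha> y + (\<integral>\<^sup>+z. (1 - \<alpha> y) * (1 - \<beta> z) / (1 - m) \<partial>\<nu>) = 1"
    by (rule completion_marginal(1)[OF \<mu> \<nu> \<alpha> \<beta> _ _ int\<alpha> int\<beta>]) (use \<alpha>1 \<beta>1 in auto)
  have rest\<beta>: "AE z in \<nu>. \<beta> z + (\<integral>\<^sup>+y. (1 - \<beta> z) * (1 - \<alpha> y) / (1 - m) \<partial>\<mu>) = 1"
    by (rule completion_marginal(1)[OF \<nu> \<mu> \<beta> \<alpha> _ _ int\<beta> int\<alpha>]) (use \<alpha>1 \<beta>1 in auto)
  have defect\<alpha>: "(\<integral>\<^sup>+y. 1 - \<alpha> y \<partial>\<mu>) = 1 - m"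
    by (rule completion_marginal(2)[OF \<nu> \<mu> \<beta> \<alpha> _ _ int\<beta> int\<alpha>]) (use \<alpha>1 \<beta>1 in auto)
  have "density (\<mu> \<Otimes>\<^sub>M \<nu>) k \<in> couplings \<mu> \<nu>"
  proof (rule density_in_couplings[OF \<mu> \<nu> k])
    show "AE y in \<mu>. (\<integral>\<^sup>+z. k (y, z) \<partial>\<nu>) = 1"
      using rest\<alpha> AE_space
    proof eventually_elim
      case (elim y)
      have "(\<integral>\<^sup>+z. k (y, z) \<partial>\<nu>) = (\<integral>\<^sup>+z. \<kappa> y z \<partial>\<nu>) + (\<integral>\<^sup>+z. (1 - \<alpha> y) * (1 - \<beta> z) / (1 - m) \<partial>\<nu>)"
        unfolding k_def fst_conv snd_conv
        using measurable_Pair2[OF \<kappa> elim(2)] by (intro nn_integral_add) auto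
      then show ?case using elim by (simp add: \<kappa>1)
    qed
    show "AE z in \<nu>. (\<integral>\<^sup>+y. k (y, z) \<partial>\<mu>) = 1"
      using rest\<beta> AE_space
    proof eventually_elim
      case (elim z)
      have "(\<integral>\<^sup>+y. k (y, z) \<partial>\<mu>) = (\<integral>\<^sup>+y. \<kappa> y z \<partial>\<mu>) + (\<integral>\<^sup>+y. (1 - \<alpha> y) * (1 - \<beta> z) / (1 - m) \<partial>\<mu>)"
        unfolding k_def fst_conv snd_conv
        using measurable_Pair1[OF \<kappa> elim(2)] by (intro nn_integral_add) auto
      then show ?case using elim by (simp add: \<kappa>2 mult.commute)
    qed
  qed
  moreover have "(\<integral>\<^sup>+w. c (fst w) (snd w) \<partial>density (\<mu> \<Otimes>\<^sub>M \<nu>) k)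
     \<le> (\<integral>\<^sup>+y. (\<integral>\<^sup>+x. b x y * q x y \<partial>L) \<partial>\<mu>) + (\<integral>\<^sup>+y. (\<integral>\<^sup>+x. b x y * q x y \<partial>L) \<partial>\<nu>) + D * (1 - m)"
  proof -
    let ?w = "\<lambda>x. 1 / max (r x) (s x)"
    let ?X = "\<lambda>w. \<integral>\<^sup>+x. b x (fst w) * q x (fst w) * (q x (snd w) * ?w x) \<partial>L"
    let ?Y = "\<lambda>w. \<integral>\<^sup>+x. b x (snd w) * q x (snd w) * (q x (fst w) * ?w x) \<partial>L"
    let ?Z = "\<lambda>w. D * ((1 - \<alpha> (fst w)) * (1 - \<beta> (snd w)) / (1 - m))"
    let ?B = "\<lambda>M. \<integral>\<^sup>+y. (\<integral>\<^sup>+x. b x y * q x y \<partial>L) \<partial>M"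
    have c'[measurable]: "(\<lambda>w. c (fst w) (snd w)) \<in> borel_measurable (\<mu> \<Otimes>\<^sub>M \<nu>)"
      using c by (simp add: case_prod_beta')
    have mXYZ: "?X \<in> borel_measurable (\<mu> \<Otimes>\<^sub>M \<nu>)"
      "?Y \<in> borel_measurable (\<mu> \<Otimes>\<^sub>M \<nu>)"
      "?Z \<in> borel_measurable (\<mu> \<Otimes>\<^sub>M \<nu>)"
      by measurable
    have "(\<integral>\<^sup>+w. c (fst w) (snd w) \<partial>density (\<mu> \<Otimes>\<^sub>M \<nu>) k)
        = (\<integral>\<^sup>+w. k w * c (fst w) (snd w) \<partial>(\<mu> \<Otimes>\<^sub>M \<nu>))"
      by (rule nn_integral_density) measurable
    also have "\<dots> \<le> (\<integral>\<^sup>+w. ?X w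
         + ?Y w
         + ?Z w \<partial>(\<mu> \<Otimes>\<^sub>M \<nu>))"
    proof (rule nn_integral_mono)
      fix w assume "w \<in> space (\<mu> \<Otimes>\<^sub>M \<nu>)"
      then have w[measurable]: "fst w \<in> space \<mu>" "snd w \<in> space \<mu>" by (auto simp: space_pair_measure sp)
      have "\<kappa> (fst w) (snd w) * c (fst w) (snd w)
         = (\<integral>\<^sup>+x. q x (fst w) * q x (snd w) / max (r x) (s x) * c (fst w) (snd w) \<partial>L)"
        unfolding \<kappa>_def by (rule nn_integral_multc[symmetric]) measurable
      also have "\<dots> \<le> (\<integral>\<^sup>+x. b x (fst w) * q x (fst w) * (q x (snd w) * ?w x)
            + b x (snd w) * q x (snd w) * (q x (fst w) * ?w x) \<partial>L)"
      proof (rule nn_integral_mono)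
        fix x assume x: "x \<in> space L"
        have "q x (fst w) * q x (snd w) / max (r x) (s x) * c (fst w) (snd w)
           \<le> q x (fst w) * q x (snd w) / max (r x) (s x) * (b x (fst w) + b x (snd w))"
          by (intro mult_left_mono triangle x w) auto
        also have "\<dots> = b x (fst w) * q x (fst w) * (q x (snd w) * ?w x)
            + b x (snd w) * q x (snd w) * (q x (fst w) * ?w x)"
          by (simp add: divide_ennreal_def distrib_left mult_ac)
        finally show "q x (fst w) * q x (snd w) / max (r x) (s x) * c (fst w) (snd w)
           \<le> b x (fst w) * q x (fst w) * (q x (snd w) * ?w x)
            + b x (snd w) * q x (snd w) * (q x (fst w) * ?w x)" .
      qed
      also have "\<dots> = ?X w
         + ?Y w"
        by (rule nn_integral_add) measurable
      finally have 1: "\<kappa> (fst w) (snd w) * c (fst w) (snd w) \<le> ?X w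
         + ?Y w" .
      have 2: "(1 - \<alpha> (fst w)) * (1 - \<beta> (snd w)) / (1 - m) * c (fst w) (snd w)
         \<le> ?Z w"
        using mult_left_mono[OF D[OF w], of "(1 - \<alpha> (fst w)) * (1 - \<beta> (snd w)) / (1 - m)"]
        by (simp add: mult.commute)
      show "k w * c (fst w) (snd w) \<le> ?X w
         + ?Y w
         + ?Z w"
        unfolding k_def distrib_right by (rule add_mono[OF 1 2])
    qed
    also have "\<dots> = (\<integral>\<^sup>+w. ?X w \<partial>(\<mu> \<Otimes>\<^sub>M \<nu>))
         + (\<integral>\<^sup>+w. ?Y w \<partial>(\<mu> \<Otimes>\<^sub>M \<nu>))
         + (\<integral>\<^sup>+w. ?Z w \<partial>(\<mu> \<Otimes>\<^sub>M \<nu>))"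
      using mXYZ by (simp add: nn_integral_add)
    also have "\<dots> \<le> ?B \<mu> + ?B \<nu> + D * (1 - m)"
    proof (intro add_mono)
      have w1: "s x * ?w x \<le> 1" "r x * ?w x \<le> 1" if "x \<in> space L" for x
      proof -
        have "max (r x) (s x) / max (r x) (s x) = 1"
          using pos'[OF that] by (intro ennreal_divide_self) (auto simp: max_def)
        moreover have "s x * ?w x \<le> max (r x) (s x) * ?w x" "r x * ?w x \<le> max (r x) (s x) * ?w x"
          by (auto intro!: mult_right_mono)
        ultimately show "s x * ?w x \<le> 1" "r x * ?w x \<le> 1" by (auto simp: ennreal_times_divide)
      qed
      have "(\<integral>\<^sup>+w. ?X w \<partial>(\<mu> \<Otimes>\<^sub>M \<nu>))
        = (\<integral>\<^sup>+y. (\<integral>\<^sup>+z. (\<integral>\<^sup>+x. b x y * q x y * (q x z * ?w x) \<partial>L) \<partial>\<nu>) \<partial>\<mu>)"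
        by (subst \<nu>.nn_integral_fst[OF mXYZ(1), symmetric]) simp
      also have "\<dots> \<le> ?B \<mu>"
        by (rule transport_leg_cost_le[OF L \<nu>.sigma_finite_measure_axioms]) (use w1(1) in \<open>simp_all add: s_def \<rho>_def\<close>)
      finally show "(\<integral>\<^sup>+w. ?X w \<partial>(\<mu> \<Otimes>\<^sub>M \<nu>))
        \<le> ?B \<mu>" .
      have "(\<integral>\<^sup>+w. ?Y w \<partial>(\<mu> \<Otimes>\<^sub>M \<nu>))
        = (\<integral>\<^sup>+z. (\<integral>\<^sup>+y. (\<integral>\<^sup>+x. b x z * q x z * (q x y * ?w x) \<partial>L) \<partial>\<mu>) \<partial>\<nu>)"
        by (subst \<mu>\<nu>.nn_integral_snd[symmetric]) (use mXYZ(2) in \<open>simp_all add: case_prod_beta'\<close>)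
      also have "\<dots> \<le> ?B \<nu>"
        by (rule transport_leg_cost_le[OF L \<mu>.sigma_finite_measure_axioms]) (use w1(2) in \<open>simp_all add: r_def \<rho>_def\<close>)
      finally show "(\<integral>\<^sup>+w. ?Y w \<partial>(\<mu> \<Otimes>\<^sub>M \<nu>))
        \<le> ?B \<nu>" .
      have "(\<integral>\<^sup>+w. ?Z w \<partial>(\<mu> \<Otimes>\<^sub>M \<nu>))
         = D * (\<integral>\<^sup>+y. (\<integral>\<^sup>+z. (1 - \<alpha> y) * (1 - \<beta> z) / (1 - m) \<partial>\<nu>) \<partial>\<mu>)"
        by (subst \<nu>.nn_integral_fst[OF mXYZ(3), symmetric]) (simp add: nn_integral_cmult)
      also have "(\<integral>\<^sup>+y. (\<integral>\<^sup>+z. (1 - \<alpha> y) * (1 - \<beta> z) / (1 - m) \<partial>\<nu>) \<partial>\<mu>) = (\<integral>\<^sup>+y. 1 - \<alpha> y \<partial>\<mu>)"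
      proof (rule nn_integral_cong_AE)
        show "AE y in \<mu>. (\<integral>\<^sup>+z. (1 - \<alpha> y) * (1 - \<beta> z) / (1 - m) \<partial>\<nu>) = 1 - \<alpha> y"
          using rest\<alpha> AE_space
        proof eventually_elim
          case (elim y)
          have "\<alpha> y < \<top>" using \<alpha>1[OF elim(2)] by (simp add: le_less_trans[of _ 1])
          then have "\<alpha> y + v - \<alpha> y = v" for v by simp
          then show ?case using elim(1) by metis
        qed
      qed
      also have "\<dots> = 1 - m"
        by (rule defect\<alpha>)
      finally show "(\<integral>\<^sup>+w. ?Z w \<partial>(\<mu> \<Otimes>\<^sub>M \<nu>)) \<le> D * (1 - m)" by simp
    qed
    finally show ?thesis .
  qed
  ultimately show ?thesis unfolding m_def r_def s_def by blast
qed

section \<open>Smoothed measures and their slices\<close>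

lemma measurable_ident_restrict:
  assumes "sets M = sets (restrict_space borel X)"
  shows "(\<lambda>x. x) \<in> M \<rightarrow>\<^sub>M borel"
proof -
  have "(\<lambda>x. x) \<in> restrict_space borel X \<rightarrow>\<^sub>M borel" by (rule measurable_restrict_space1) simp
  then show ?thesis by (simp add: measurable_cong_sets[OF assms refl])
qed

lemma borel_probs_measurable:
  assumes "\<mu> \<in> borel_probs X" "f \<in> borel_measurable borel"
  shows "f \<in> borel_measurable \<mu>"
proof -
  have "sets \<mu> = sets (restrict_space borel X)" using assms by (simp add: in_borel_probs_iff)
  from measurable_compose[OF measurable_ident_restrict[OF this] assms(2)] show ?thesis by simp
qed

lemma measurable_restrict_pair:
  assumes "sets M = sets (restrict_space borel X)" and f: "f \<in> borel_measurable (N \<Otimes>\<^sub>M borel)"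
  shows "f \<in> borel_measurable (N \<Otimes>\<^sub>M M)"
proof -
  have "(\<lambda>w. (fst w, snd w)) \<in> N \<Otimes>\<^sub>M M \<rightarrow>\<^sub>M N \<Otimes>\<^sub>M borel"
    by (intro measurable_Pair measurable_fst measurable_compose[OF measurable_snd measurable_ident_restrict[OF assms(1)]])
  from measurable_compose[OF this f] show ?thesis by simp
qed

lemma borel_measurable_pair_swap:
  assumes "f \<in> borel_measurable (M \<Otimes>\<^sub>M N)"
  shows "(\<lambda>w. f (snd w, fst w)) \<in> borel_measurable (N \<Otimes>\<^sub>M M)"
  by (rule measurable_compose[OF measurable_Pair[OF measurable_snd measurable_fst] assms])

text \<open>Write both integrals over a near-optimal coupling and apply the modulus of continuity to each pair of
coupled points. This bounds the left-hand side by the mean distance of coupled points, which is at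
most its mean of order \<open>p\<close>.\<close>

lemma sliced_difference_L1_le:
  fixes h :: "real \<Rightarrow> real"
  assumes \<alpha>: "\<alpha> \<in> borel_probs {-1..1}" and \<beta>: "\<beta> \<in> borel_probs {-1..1}" and p: "p \<ge> 1"
    and h[measurable]: "h \<in> borel_measurable borel" and bnd: "\<And>t. \<bar>h t\<bar> \<le> B" and A: "A \<ge> 0"
    and modulus: "\<And>s s'. (\<integral>\<^sup>+t. ennreal \<bar>h (t - s) - h (t - s')\<bar> \<partial>lborel) \<le> ennreal (A * \<bar>s - s'\<bar>)"
  shows "(\<integral>\<^sup>+t. ennreal \<bar>(LINT s|\<alpha>. h (t - s)) - (LINT s|\<beta>. h (t - s))\<bar> \<partial>lborel)
     \<le> ennreal (A * wasserstein dist p \<alpha> \<beta>)"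
proof -
  let ?D = "\<lambda>t. \<bar>(LINT s|\<alpha>. h (t - s)) - (LINT s|\<beta>. h (t - s))\<bar>"
  have p0: "p > 0" using p by simp
  have le: "(\<integral>\<^sup>+t. ennreal (?D t) \<partial>lborel) \<le> ennreal (A * C)" if C: "wasserstein dist p \<alpha> \<beta> < C" for C
  proof -
    obtain \<pi> where \<pi>: "\<pi> \<in> couplings \<alpha> \<beta>" and cost: "interval.cost p \<pi> \<le> C powr p"
      using interval.near_optimal_coupling[OF \<alpha> \<beta> p0 C] by blast
    have C0: "C > 0" using C interval.wasserstein_nonneg[of p \<alpha> \<beta>] by linarith
    interpret \<pi>: prob_space \<pi> by (rule interval.coupling_prob[OF \<alpha> \<beta> \<pi>])
    have s\<pi>: "sets \<pi> = sets (restrict_space borel {-1..1} \<Otimes>\<^sub>M restrict_space borel {-1..1::real})"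
      by (rule interval.coupling_sets[OF \<alpha> \<beta> \<pi>])
    have sp: "space \<pi> = {-1..1} \<times> {-1..1}" by (rule interval.coupling_space[OF \<alpha> \<beta> \<pi>])
    have idI: "(\<lambda>x. x) \<in> restrict_space borel {-1..1::real} \<rightarrow>\<^sub>M borel"
      by (rule measurable_ident_restrict) simp
    have f1[measurable]: "fst \<in> borel_measurable \<pi>" and f2[measurable]: "snd \<in> borel_measurable \<pi>"
      using measurable_compose[OF measurable_fst idI, of "restrict_space borel {-1..1::real}"]
        measurable_compose[OF measurable_snd idI, of "restrict_space borel {-1..1::real}"]
      by (simp_all add: measurable_cong_sets[OF s\<pi> refl])
    have d1: "distr \<pi> \<alpha> fst = \<alpha>" and d2: "distr \<pi> \<beta> snd = \<beta>" and s': "sets \<pi> = sets (\<alpha> \<Otimes>\<^sub>M \<beta>)"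
      using \<pi> by (auto simp: couplings_def)
    have m1: "fst \<in> \<pi> \<rightarrow>\<^sub>M \<alpha>" "snd \<in> \<pi> \<rightarrow>\<^sub>M \<beta>" by (simp_all add: measurable_cong_sets[OF s' refl])
    have h\<alpha>: "(\<lambda>s. h (t - s)) \<in> borel_measurable \<alpha>" for t
      by (rule borel_probs_measurable[OF \<alpha>]) measurable
    have h\<beta>: "(\<lambda>s. h (t - s)) \<in> borel_measurable \<beta>" for t
      by (rule borel_probs_measurable[OF \<beta>]) measurable
    have i: "integrable \<pi> (\<lambda>w. h (t - fst w))" "integrable \<pi> (\<lambda>w. h (t - snd w))" for t
      using bnd by (auto intro!: \<pi>.integrable_const_bound[where B=B])
    have I1: "(LINT s|\<alpha>. h (t - s)) = (LINT w|\<pi>. h (t - fst w))" for t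
      using integral_distr[OF m1(1) h\<alpha>[of t]] by (simp add: d1)
    have I2: "(LINT s|\<beta>. h (t - s)) = (LINT w|\<pi>. h (t - snd w))" for t
      using integral_distr[OF m1(2) h\<beta>[of t]] by (simp add: d2)
    have "(\<integral>\<^sup>+t. ennreal (?D t) \<partial>lborel) \<le> (\<integral>\<^sup>+t. (\<integral>\<^sup>+w. ennreal \<bar>h (t - fst w) - h (t - snd w)\<bar> \<partial>\<pi>) \<partial>lborel)"
    proof (rule nn_integral_mono)
      fix t :: real
      have "?D t = norm (LINT w|\<pi>. h (t - fst w) - h (t - snd w))"
        using i[of t] by (simp add: I1 I2)
      also have "ennreal \<dots> \<le> (\<integral>\<^sup>+w. norm (h (t - fst w) - h (t - snd w)) \<partial>\<pi>)"
        using i[of t] by (intro integral_norm_bound_ennreal) auto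
      finally show "ennreal (?D t) \<le> (\<integral>\<^sup>+w. ennreal \<bar>h (t - fst w) - h (t - snd w)\<bar> \<partial>\<pi>)" by simp
    qed
    also have "\<dots> = (\<integral>\<^sup>+w. (\<integral>\<^sup>+t. ennreal \<bar>h (t - fst w) - h (t - snd w)\<bar> \<partial>lborel) \<partial>\<pi>)"
    proof -
      interpret P: pair_sigma_finite \<pi> lborel ..
      show ?thesis by (rule P.Fubini') measurable
    qed
    also have "\<dots> \<le> (\<integral>\<^sup>+w. ennreal (A * dist (fst w) (snd w)) \<partial>\<pi>)"
      using modulus by (intro nn_integral_mono) (simp add: dist_real_def)
    also have "\<dots> = ennreal (A * \<pi>.expectation (\<lambda>w. dist (fst w) (snd w)))"
    proof -
      have "integrable \<pi> (\<lambda>w. dist (fst w) (snd w))"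
        by (rule \<pi>.integrable_const_bound[where B=2]) (auto simp: sp dist_real_def intro!: AE_I2)
      then show ?thesis using A by (subst nn_integral_eq_integral) auto
    qed
    also have "\<dots> \<le> ennreal (A * C)"
    proof (intro ennreal_leI mult_left_mono A)
      have "\<pi>.expectation (\<lambda>w. dist (fst w) (snd w)) powr p \<le> C powr p"
        using \<pi>.powr_expectation_le[of "\<lambda>w. dist (fst w) (snd w)" 2 p] cost p
        by (force simp: sp dist_real_def)
      then show "\<pi>.expectation (\<lambda>w. dist (fst w) (snd w)) \<le> C"
        using C0 p0 by (meson less_imp_le linorder_not_le powr_less_mono2)
    qed
    finally show ?thesis .
  qed
  show ?thesis
  proof (rule ennreal_le_epsilon)
    fix e :: real assume "e > 0"
    define \<eta> where "\<eta> = e / (A + 1)"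
    have \<eta>: "\<eta> > 0" "A * \<eta> \<le> e" using A \<open>e > 0\<close> by (auto simp: \<eta>_def field_simps)
    have "(\<integral>\<^sup>+t. ennreal (?D t) \<partial>lborel) \<le> ennreal (A * (wasserstein dist p \<alpha> \<beta> + \<eta>))"
      using \<eta> by (intro le) simp
    also have "\<dots> \<le> ennreal (A * wasserstein dist p \<alpha> \<beta> + e)"
      using \<eta> by (intro ennreal_leI) (simp add: distrib_left)
    also have "\<dots> = ennreal (A * wasserstein dist p \<alpha> \<beta>) + ennreal e"
      using A \<open>e > 0\<close> interval.wasserstein_nonneg[of p \<alpha> \<beta>] by (intro ennreal_plus) auto
    finally show "(\<integral>\<^sup>+t. ennreal (?D t) \<partial>lborel) \<le> ennreal (A * wasserstein dist p \<alpha> \<beta>) + ennreal e" .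
  qed
qed

definition gauss_kernel :: "real \<Rightarrow> 'a::euclidean_space \<Rightarrow> real" where
  "gauss_kernel e z = gauss_density (z /\<^sub>R e) / e ^ DIM('a)"

lemma gauss_kernel_measurable[measurable]: "gauss_kernel e \<in> borel_measurable borel"
  unfolding gauss_kernel_def[abs_def] by measurable

lemma gauss_kernel_pos: "e > 0 \<Longrightarrow> 0 < gauss_kernel e z"
  by (simp add: gauss_kernel_def gauss_density_pos)

lemma gauss_density_le: "gauss_density (z :: 'a::euclidean_space) \<le> gauss_density (0 :: 'a)"
  by (simp add: gauss_density_def divide_right_mono)

lemma gauss_kernel_le: "e > 0 \<Longrightarrow> gauss_kernel e (z :: 'a::euclidean_space) \<le> gauss_density (0 :: 'a) / e ^ DIM('a)"
  by (simp add: gauss_kernel_def divide_right_mono gauss_density_le)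

lemma gauss_kernel_nn_integral:
  fixes y :: "'a::euclidean_space"
  assumes e: "e > 0" and [measurable]: "F \<in> borel_measurable borel"
  shows "(\<integral>\<^sup>+x. F (x - y) * ennreal (gauss_kernel e (x - y)) \<partial>lborel) = (\<integral>\<^sup>+z. F (e *\<^sub>R z) * ennreal (gauss_density z) \<partial>lborel)"
proof -
  have "(\<integral>\<^sup>+x. F (x - y) * ennreal (gauss_kernel e (x - y)) \<partial>lborel)
     = ennreal (e ^ DIM('a)) * (\<integral>\<^sup>+x. F (y + e *\<^sub>R x - y) * ennreal (gauss_kernel e (y + e *\<^sub>R x - y)) \<partial>lborel)"
    by (rule nn_integral_affine_euclidean[OF _ e]) measurable
  also have "\<dots> = (\<integral>\<^sup>+x. ennreal (e ^ DIM('a)) * (F (e *\<^sub>R x) * ennreal (gauss_kernel e (e *\<^sub>R x))) \<partial>lborel)"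
    by (subst nn_integral_cmult) (auto simp del: scaleR_right_diff_distrib)
  also have "\<dots> = (\<integral>\<^sup>+z. F (e *\<^sub>R z) * ennreal (gauss_density z) \<partial>lborel)"
  proof (rule nn_integral_cong)
    fix x :: 'a
    have "ennreal (e ^ DIM('a)) * ennreal (gauss_kernel e (e *\<^sub>R x)) = ennreal (gauss_density x)"
      using e by (simp add: gauss_kernel_def less_imp_le[OF gauss_density_pos] flip: ennreal_mult)
    then show "ennreal (e ^ DIM('a)) * (F (e *\<^sub>R x) * ennreal (gauss_kernel e (e *\<^sub>R x))) = F (e *\<^sub>R x) * ennreal (gauss_density x)"
      by (metis mult.left_commute)
  qed
  finally show ?thesis .
qed

text \<open>From \<open>t \<le> exp (t\<^sup>2 / 4)\<close>: the integrand is at most a multiple of the Gaussian of twice the variance.\<close>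

lemma gauss_first_moment: "(\<integral>\<^sup>+z. ennreal (norm z) * ennreal (gauss_density (z :: 'a::euclidean_space)) \<partial>lborel) \<le> ennreal (sqrt 2 ^ DIM('a))"
proof -
  have "(\<integral>\<^sup>+z. ennreal (norm z) * ennreal (gauss_density (z :: 'a)) \<partial>lborel) \<le> (\<integral>\<^sup>+z. ennreal (gauss_density (z /\<^sub>R sqrt 2)) \<partial>(lborel :: 'a measure))"
  proof (rule nn_integral_mono)
    fix z :: 'a
    let ?t = "norm z"
    have "0 \<le> (?t / 2 - 1)\<^sup>2" by simp
    then have "?t \<le> 1 + ?t\<^sup>2 / 4" by (simp add: power2_eq_square algebra_simps)
    also have "\<dots> \<le> exp (?t\<^sup>2 / 4)" by (rule exp_ge_add_one_self)
    finally have "?t * exp (- ?t\<^sup>2 / 2) \<le> exp (?t\<^sup>2 / 4) * exp (- ?t\<^sup>2 / 2)" by (intro mult_right_mono) auto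
    also have "\<dots> = exp (- (norm (z /\<^sub>R sqrt 2))\<^sup>2 / 2)"
    proof -
      have "(norm (z /\<^sub>R sqrt 2))\<^sup>2 = ?t\<^sup>2 / 2"
      proof -
        have "norm (z /\<^sub>R sqrt 2) = ?t / sqrt 2" by (simp add: divide_inverse)
        then show ?thesis by (simp add: power_divide)
      qed
      moreover have "?t\<^sup>2 / 4 + - ?t\<^sup>2 / 2 = - (?t\<^sup>2 / 2) / 2" by simp
      ultimately show ?thesis by (simp only: exp_add[symmetric] minus_divide_left)
    qed
    finally have "?t * gauss_density z \<le> gauss_density (z /\<^sub>R sqrt 2)"
      by (simp add: gauss_density_def divide_right_mono)
    then show "ennreal ?t * ennreal (gauss_density z) \<le> ennreal (gauss_density (z /\<^sub>R sqrt 2))"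
      by (subst ennreal_mult'[symmetric]) (auto intro: ennreal_leI less_imp_le[OF gauss_density_pos])
  qed
  also have "\<dots> = ennreal (sqrt 2 ^ DIM('a)) * (\<integral>\<^sup>+z. ennreal (gauss_density (((0::'a) + sqrt 2 *\<^sub>R z) /\<^sub>R sqrt 2)) \<partial>lborel)"
    by (rule nn_integral_affine_euclidean) auto
  also have "\<dots> = ennreal (sqrt 2 ^ DIM('a))"
    by (simp add: gauss_density_nn_integral)
  finally show ?thesis .
qed

text \<open>By the ridge decomposition the difference of the smoothed densities at \<open>x\<close> is an average over \<open>\<theta>\<close> of
functions of \<open>x \<bullet> \<theta>\<close>, each a convolution of the profile with the difference of the slices in direction
\<open>\<theta>\<close>. Integrate over \<open>x\<close> first: \<open>slab_nn_integral_le\<close> passes to the variable \<open>x \<bullet> \<theta>\<close>, and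
\<open>sliced_difference_L1_le\<close> bounds the result by the distance of the slices. The mean of these over \<open>\<theta>\<close> is
at most \<^const>\<open>PSW\<close>.\<close>

lemma mollified_difference_le:
  "\<exists>C\<ge>0. \<forall>\<mu>\<in>borel_probs (unit_sphere :: 'a::euclidean_space set). \<forall>\<nu>\<in>borel_probs unit_sphere. \<forall>e>0. \<forall>p\<ge>1.
     (\<integral>\<^sup>+x\<in>cball 0 2. ennreal \<bar>(LINT y|\<mu>. gauss_kernel e (x - y)) - (LINT y|\<nu>. gauss_kernel e (x - y))\<bar> \<partial>lborel)
       \<le> ennreal (C * PSW p \<mu> \<nu> / e ^ DIM('a))"
proof -
  let ?n = "DIM('a)"
  let ?g = "ridge_profile ?n"
  have n: "?n = Suc (?n - 1)" by simp
  obtain K where K: "K > 0" "\<And>x::'a. exp (- (norm x)\<^sup>2 / 2) = K * (LINT \<theta>|sphere_uniform. ?g (x \<bullet> \<theta>))"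
    using gauss_ridge_decomposition[where 'a='a] by blast
  obtain A where A: "A \<ge> 0" "\<And>e s s'. e > 0 \<Longrightarrow> (\<integral>\<^sup>+t. ennreal \<bar>?g ((t - s) / e) - ?g ((t - s') / e)\<bar> \<partial>lborel) \<le> ennreal (A * \<bar>s - s'\<bar>)"
    using ridge_profile_scaled_L1_le[of "?n - 1"] n by auto
  define c where "c = K / sqrt (2 * pi) ^ ?n"
  have c: "c > 0" using K by (simp add: c_def)
  define B where "B = exp 2 * sqrt (2 * pi) ^ ?n"
  have B: "B \<ge> 0" by (simp add: B_def)
  let ?S = "sphere_uniform :: 'a measure"
  interpret S: prob_space ?S by (rule prob_space_sphere_uniform)
  let ?mol = "\<lambda>\<mu> \<nu> e x. \<bar>(LINT y|\<mu>. gauss_kernel e (x - y)) - (LINT y|\<nu>. gauss_kernel e (x - y))\<bar>"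
  let ?W = "\<lambda>p \<mu> \<nu> (\<theta>::'a). wasserstein dist p (sliced \<theta> \<mu>) (sliced \<theta> \<nu>)"
  have "(\<integral>\<^sup>+x\<in>cball 0 2. ennreal (?mol \<mu> \<nu> e x) \<partial>lborel)
       \<le> ennreal (c * B * A * PSW p \<mu> \<nu> / e ^ ?n)"
    if \<mu>: "\<mu> \<in> borel_probs (unit_sphere :: 'a set)" and \<nu>: "\<nu> \<in> borel_probs unit_sphere" and e: "e > 0" and p: "p \<ge> 1"
    for \<mu> \<nu> e p
  proof -
    have p0: "p > 0" using p by simp
    define G where "G M \<theta> t = (LINT y|M. ?g ((t - y \<bullet> \<theta>) / e))" for M :: "'a measure" and \<theta> t
    have mol: "(LINT y|M. gauss_kernel e (x - y)) = c / e ^ ?n * (LINT \<theta>|?S. G M \<theta> (x \<bullet> \<theta>))"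
      and intG: "integrable ?S (\<lambda>\<theta>. G M \<theta> (x \<bullet> \<theta>))"
      and measG: "(\<lambda>w. G M (snd w) (fst w \<bullet> snd w)) \<in> borel_measurable (borel \<Otimes>\<^sub>M borel)"
      and measG1: "G M \<theta> \<in> borel_measurable borel"
      and slG: "\<theta> \<in> unit_sphere \<Longrightarrow> G M \<theta> t = (LINT s|sliced \<theta> M. ?g ((t - s) / e))"
      if M: "M \<in> borel_probs unit_sphere" for M x \<theta> t
    proof -
      have sM: "sets M = sets (restrict_space borel unit_sphere)" using M by (simp add: in_borel_probs_iff)
      interpret M: prob_space M using M by (simp add: in_borel_probs_iff)
      interpret P: pair_prob_space ?S M ..
      have b: "(\<lambda>w. ?g (((x - snd w) \<bullet> fst w) / e)) \<in> borel_measurable (borel \<Otimes>\<^sub>M borel)" by measurable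
      have "(\<lambda>w. ?g (((x - fst w) \<bullet> snd w) / e)) \<in> borel_measurable (M \<Otimes>\<^sub>M ?S)"
      proof (rule measurable_restrict_pair[OF sets_sphere_uniform])
        have "(\<lambda>w. (fst w, snd w)) \<in> M \<Otimes>\<^sub>M borel \<rightarrow>\<^sub>M borel \<Otimes>\<^sub>M borel"
          by (intro measurable_Pair measurable_snd measurable_compose[OF measurable_fst measurable_ident_restrict[OF sM]])
        then have "(\<lambda>w. ?g (((x - fst (fst w, snd w)) \<bullet> snd (fst w, snd w)) / e)) \<in> borel_measurable (M \<Otimes>\<^sub>M borel)"
          by (rule measurable_compose) measurable
        then show "(\<lambda>w. ?g (((x - fst w) \<bullet> snd w) / e)) \<in> borel_measurable (M \<Otimes>\<^sub>M borel)" by simp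
      qed
      then have m1: "(\<lambda>(\<theta>, y). ?g (((x - y) \<bullet> \<theta>) / e)) \<in> borel_measurable (?S \<Otimes>\<^sub>M M)"
        by (auto dest: borel_measurable_pair_swap simp: case_prod_beta')
      have int: "integrable (?S \<Otimes>\<^sub>M M) (\<lambda>(\<theta>, y). ?g (((x - y) \<bullet> \<theta>) / e))"
        by (rule P.integrable_const_bound[where B="?g 0"]) (use m1 ridge_profile_bounded in auto)
      have "(LINT y|M. gauss_kernel e (x - y)) = (LINT y|M. c / e ^ ?n * (LINT \<theta>|?S. ?g (((x - y) \<bullet> \<theta>) / e)))"
      proof (rule Bochner_Integration.integral_cong[OF refl])
        fix y
        have "gauss_kernel e (x - y) = exp (- (norm ((x - y) /\<^sub>R e))\<^sup>2 / 2) / sqrt (2 * pi) ^ ?n / e ^ ?n"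
          by (simp add: gauss_kernel_def gauss_density_def)
        also have "\<dots> = c / e ^ ?n * (LINT \<theta>|?S. ?g (((x - y) /\<^sub>R e) \<bullet> \<theta>))"
          unfolding K(2) by (simp add: c_def)
        finally show "gauss_kernel e (x - y) = c / e ^ ?n * (LINT \<theta>|?S. ?g (((x - y) \<bullet> \<theta>) / e))"
          by (simp add: divide_inverse mult.commute)
      qed
      also have "\<dots> = c / e ^ ?n * (LINT y|M. LINT \<theta>|?S. ?g (((x - y) \<bullet> \<theta>) / e))" by simp
      also have "(LINT y|M. LINT \<theta>|?S. ?g (((x - y) \<bullet> \<theta>) / e)) = (LINT \<theta>|?S. LINT y|M. ?g (((x - y) \<bullet> \<theta>) / e))"
        by (rule P.Fubini_integral[OF int])
      finally show "(LINT y|M. gauss_kernel e (x - y)) = c / e ^ ?n * (LINT \<theta>|?S. G M \<theta> (x \<bullet> \<theta>))"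
        by (simp add: G_def inner_diff_left)
      show "integrable ?S (\<lambda>\<theta>. G M \<theta> (x \<bullet> \<theta>))"
        using P.integrable_fst[OF int] by (simp add: G_def inner_diff_left)
      have "(\<lambda>w. ?g ((fst (fst w) \<bullet> snd (fst w) - snd w \<bullet> snd (fst w)) / e)) \<in> borel_measurable ((borel \<Otimes>\<^sub>M borel) \<Otimes>\<^sub>M M)"
        by (rule measurable_restrict_pair[OF sM]) measurable
      then show "(\<lambda>w. G M (snd w) (fst w \<bullet> snd w)) \<in> borel_measurable (borel \<Otimes>\<^sub>M borel)"
        unfolding G_def by (intro M.borel_measurable_lebesgue_integral) (simp add: case_prod_beta')
      have "(\<lambda>w. ?g ((fst w - snd w \<bullet> \<theta>) / e)) \<in> borel_measurable (borel \<Otimes>\<^sub>M M)"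
        by (rule measurable_restrict_pair[OF sM]) measurable
      then show "G M \<theta> \<in> borel_measurable borel"
        unfolding G_def[abs_def] by (intro M.borel_measurable_lebesgue_integral) (simp add: case_prod_beta')
      show "G M \<theta> t = (LINT s|sliced \<theta> M. ?g ((t - s) / e))" if \<theta>: "\<theta> \<in> unit_sphere"
        unfolding sliced_def
      proof (subst integral_distr[OF slice_measurable[OF \<theta> sM]])
        show "(\<lambda>s. ?g ((t - s) / e)) \<in> borel_measurable (restrict_space borel {-1..1})"
          by (rule measurable_restrict_space1) measurable
      qed (simp add: G_def slice_def)
    qed
    let ?\<Delta> = "\<lambda>\<theta> t. \<bar>G \<mu> \<theta> t - G \<nu> \<theta> t\<bar>"
    have ray: "(\<integral>\<^sup>+x\<in>cball 0 2. ennreal (?\<Delta> \<theta> (x \<bullet> \<theta>)) \<partial>lborel) \<le> ennreal (B * A * ?W p \<mu> \<nu> \<theta>)"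
      if \<theta>: "\<theta> \<in> unit_sphere" for \<theta>
    proof -
      note [measurable] = measG1[OF \<mu>] measG1[OF \<nu>]
      have "(\<integral>\<^sup>+x\<in>cball 0 2. ennreal (?\<Delta> \<theta> (x \<bullet> \<theta>)) \<partial>lborel) \<le> ennreal B * (\<integral>\<^sup>+t. ennreal (?\<Delta> \<theta> t) \<partial>lborel)"
        unfolding B_def using \<theta> by (intro slab_nn_integral_le) auto
      also have "(\<integral>\<^sup>+t. ennreal (?\<Delta> \<theta> t) \<partial>lborel) \<le> ennreal (A * ?W p \<mu> \<nu> \<theta>)"
        unfolding slG[OF \<mu> \<theta>] slG[OF \<nu> \<theta>]
        by (rule sliced_difference_L1_le[where h="\<lambda>t. ?g (t / e)" and B="?g 0"])
           (use sliced_in_borel_probs[OF \<theta> \<mu>] sliced_in_borel_probs[OF \<theta> \<nu>] p A e ridge_profile_bounded in auto)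
      finally show ?thesis
        using B A interval.wasserstein_nonneg by (simp add: mult_left_mono ennreal_mult mult.assoc)
    qed
    have "(\<integral>\<^sup>+x\<in>cball 0 2. ennreal (?mol \<mu> \<nu> e x) \<partial>lborel)
      \<le> (\<integral>\<^sup>+x. (\<integral>\<^sup>+\<theta>. ennreal (c / e ^ ?n) * (ennreal (?\<Delta> \<theta> (x \<bullet> \<theta>)) * indicator (cball 0 2) x) \<partial>?S) \<partial>lborel)"
    proof (rule nn_integral_mono)
      fix x :: 'a
      have m: "(\<lambda>\<theta>. ennreal (?\<Delta> \<theta> (x \<bullet> \<theta>))) \<in> borel_measurable ?S"
        using borel_measurable_integrable[OF intG[OF \<mu>, of x]] borel_measurable_integrable[OF intG[OF \<nu>, of x]] by measurable
      have "(?mol \<mu> \<nu> e x)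
         = c / e ^ ?n * norm (LINT \<theta>|?S. G \<mu> \<theta> (x \<bullet> \<theta>) - G \<nu> \<theta> (x \<bullet> \<theta>))"
        unfolding mol[OF \<mu>] mol[OF \<nu>] right_diff_distrib[symmetric] abs_mult
        using intG[OF \<mu>, of x] intG[OF \<nu>, of x] c e by simp
      also have "ennreal \<dots> \<le> ennreal (c / e ^ ?n) * (\<integral>\<^sup>+\<theta>. norm (G \<mu> \<theta> (x \<bullet> \<theta>) - G \<nu> \<theta> (x \<bullet> \<theta>)) \<partial>?S)"
      proof -
        have "ennreal (norm (LINT \<theta>|?S. G \<mu> \<theta> (x \<bullet> \<theta>) - G \<nu> \<theta> (x \<bullet> \<theta>)))
           \<le> (\<integral>\<^sup>+\<theta>. norm (G \<mu> \<theta> (x \<bullet> \<theta>) - G \<nu> \<theta> (x \<bullet> \<theta>)) \<partial>?S)"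
          by (intro integral_norm_bound_ennreal Bochner_Integration.integrable_diff intG \<mu> \<nu>)
        then show ?thesis using c e by (subst ennreal_mult) (auto intro!: mult_left_mono)
      qed
      also have "\<dots> = (\<integral>\<^sup>+\<theta>. ennreal (c / e ^ ?n) * ennreal (?\<Delta> \<theta> (x \<bullet> \<theta>)) \<partial>?S)"
        using m by (subst nn_integral_cmult) auto
      finally show "ennreal (?mol \<mu> \<nu> e x) * indicator (cball 0 2) x
        \<le> (\<integral>\<^sup>+\<theta>. ennreal (c / e ^ ?n) * (ennreal (?\<Delta> \<theta> (x \<bullet> \<theta>)) * indicator (cball 0 2) x) \<partial>?S)"
        by (auto split: split_indicator)
    qed
    also have "\<dots> = (\<integral>\<^sup>+\<theta>. (\<integral>\<^sup>+x. ennreal (c / e ^ ?n) * (ennreal (?\<Delta> \<theta> (x \<bullet> \<theta>)) * indicator (cball 0 2) x) \<partial>lborel) \<partial>?S)"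
    proof -
      interpret P: pair_sigma_finite ?S lborel ..
      have [measurable]: "cball (0::'a) 2 \<in> sets borel" by simp
      note [measurable] = measG[OF \<mu>] measG[OF \<nu>]
      have "(\<lambda>w. ennreal (c / e ^ ?n) * (ennreal (?\<Delta> (snd w) (fst w \<bullet> snd w)) * indicator (cball 0 2) (fst w))) \<in> borel_measurable (borel \<Otimes>\<^sub>M borel)"
        by measurable
      then have "(\<lambda>w. ennreal (c / e ^ ?n) * (ennreal (?\<Delta> (snd w) (fst w \<bullet> snd w)) * indicator (cball 0 2) (fst w))) \<in> borel_measurable (lborel \<Otimes>\<^sub>M ?S)"
        by (intro measurable_restrict_pair[OF sets_sphere_uniform]) (simp cong: measurable_cong_sets sets_pair_measure_cong)
      then have "(\<lambda>w. ennreal (c / e ^ ?n) * (ennreal (?\<Delta> (fst w) (snd w \<bullet> fst w)) * indicator (cball 0 2) (snd w))) \<in> borel_measurable (?S \<Otimes>\<^sub>M lborel)"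
        by (auto dest: borel_measurable_pair_swap)
      then show ?thesis by (intro P.Fubini') (simp add: case_prod_beta')
    qed
    also have "\<dots> \<le> (\<integral>\<^sup>+\<theta>. ennreal (c / e ^ ?n * (B * A * ?W p \<mu> \<nu> \<theta>)) \<partial>?S)"
    proof (rule nn_integral_mono)
      fix \<theta> assume "\<theta> \<in> space ?S"
      then have \<theta>: "\<theta> \<in> unit_sphere" by (simp add: space_sphere_uniform)
      note [measurable] = measG1[OF \<mu>] measG1[OF \<nu>]
      have [measurable]: "cball (0::'a) 2 \<in> sets borel" by simp
      have "(\<integral>\<^sup>+x. ennreal (c / e ^ ?n) * (ennreal (?\<Delta> \<theta> (x \<bullet> \<theta>)) * indicator (cball 0 2) x) \<partial>lborel)
          = ennreal (c / e ^ ?n) * (\<integral>\<^sup>+x\<in>cball 0 2. ennreal (?\<Delta> \<theta> (x \<bullet> \<theta>)) \<partial>lborel)"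
        by (rule nn_integral_cmult) measurable
      also have "\<dots> \<le> ennreal (c / e ^ ?n) * ennreal (B * A * ?W p \<mu> \<nu> \<theta>)"
        by (intro mult_left_mono ray \<theta>) simp
      also have "\<dots> = ennreal (c / e ^ ?n * (B * A * ?W p \<mu> \<nu> \<theta>))"
        using c e B A interval.wasserstein_nonneg by (intro ennreal_mult[symmetric]) auto
      finally show "(\<integral>\<^sup>+x. ennreal (c / e ^ ?n) * (ennreal (?\<Delta> \<theta> (x \<bullet> \<theta>)) * indicator (cball 0 2) x) \<partial>lborel)
        \<le> ennreal (c / e ^ ?n * (B * A * ?W p \<mu> \<nu> \<theta>))" .
    qed
    also have "\<dots> = ennreal (c / e ^ ?n * (B * A * S.expectation (\<lambda>\<theta>. ?W p \<mu> \<nu> \<theta>)))"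
    proof -
      have "integrable ?S (\<lambda>\<theta>. ?W p \<mu> \<nu> \<theta>)"
        by (rule S.integrable_const_bound[where B=2])
           (use wasserstein_sliced_measurable[OF \<mu> \<nu> p] wasserstein_sliced_bounds[OF \<mu> \<nu> p0] in \<open>auto simp: space_sphere_uniform intro!: AE_I2\<close>)
      then show ?thesis
        using c e B A interval.wasserstein_nonneg by (subst nn_integral_eq_integral) auto
    qed
    also have "\<dots> \<le> ennreal (c / e ^ ?n * (B * A * PSW p \<mu> \<nu>))"
    proof (intro ennreal_leI mult_left_mono)
      have "S.expectation (\<lambda>\<theta>. ?W p \<mu> \<nu> \<theta>) powr p \<le> PSW p \<mu> \<nu> powr p"
        unfolding PSW_powr[OF p0]
        by (rule S.powr_expectation_le[where B=2])
           (use wasserstein_sliced_measurable[OF \<mu> \<nu> p] wasserstein_sliced_bounds[OF \<mu> \<nu> p0] p in \<open>auto simp: space_sphere_uniform\<close>)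
      then show "S.expectation (\<lambda>\<theta>. ?W p \<mu> \<nu> \<theta>) \<le> PSW p \<mu> \<nu>"
        using p0 PSW_nonneg[of p \<mu> \<nu>] by (meson linorder_not_le powr_less_mono2)
    qed (use c e B A in auto)
    finally show ?thesis by (simp add: mult_ac)
  qed
  then show ?thesis using c B A by (intro exI[of _ "c * B * A"]) auto
qed

section \<open>The upper bound\<close>

text \<open>Apply \<open>kernel_coupling\<close> to the Gaussian kernel of width \<open>e\<close>. Each of the two smoothing costs is \<open>e\<close> times
the first moment of the Gaussian. The smoothed densities are compared on the ball of radius 2 by
\<open>mollified_difference_le\<close>; mass outside that ball has moved by at least 1 from the sphere, so there is
no more of it than the smoothing cost. Since geodesic distances are at most \<^const>\<open>pi\<close>, their powers are
bounded by a multiple of the Euclidean distance.\<close>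

lemma wasserstein_powr_le_scale:
  fixes p :: real
  assumes p: "p \<ge> 1"
  shows "\<exists>C>0. \<forall>\<mu>\<in>borel_probs (unit_sphere :: 'a::euclidean_space set). \<forall>\<nu>\<in>borel_probs unit_sphere. \<forall>e>0.
     wasserstein geodesic_dist p \<mu> \<nu> powr p \<le> C * (e + PSW p \<mu> \<nu> / e ^ DIM('a))"
proof -
  let ?n = "DIM('a)"
  have p0: "p > 0" using p by simp
  obtain C where C: "C \<ge> 0" "\<And>\<mu> \<nu> e. \<mu> \<in> borel_probs (unit_sphere :: 'a set) \<Longrightarrow> \<nu> \<in> borel_probs unit_sphere \<Longrightarrow> e > 0 \<Longrightarrow>
     (\<integral>\<^sup>+x\<in>cball 0 2. ennreal \<bar>(LINT y|\<mu>. gauss_kernel e (x - y)) - (LINT y|\<nu>. gauss_kernel e (x - y))\<bar> \<partial>lborel)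
       \<le> ennreal (C * PSW p \<mu> \<nu> / e ^ ?n)"
    using mollified_difference_le[where 'a='a] p by blast
  define M where "M = sqrt 2 ^ ?n"
  have M: "M > 0" by (simp add: M_def)
  define C' where "C' = pi powr p / 2 * (4 * M + 2 * C)"
  have C': "C' > 0" using M C by (simp add: C'_def add_pos_nonneg)
  have "wasserstein geodesic_dist p \<mu> \<nu> powr p \<le> C' * (e + PSW p \<mu> \<nu> / e ^ ?n)"
    if \<mu>: "\<mu> \<in> borel_probs (unit_sphere :: 'a set)" and \<nu>: "\<nu> \<in> borel_probs unit_sphere" and e: "e > 0" for \<mu> \<nu> e
  proof -
    let ?k = "gauss_kernel e :: 'a \<Rightarrow> real"
    let ?q = "\<lambda>x y. ennreal (?k (x - y))"
    let ?b = "\<lambda>x y :: 'a. ennreal (norm (x - y))"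
    let ?\<rho> = "\<lambda>M x. \<integral>\<^sup>+y. ?q x y \<partial>M"
    let ?m = "\<integral>\<^sup>+x. min (?\<rho> \<mu> x) (?\<rho> \<nu> x) \<partial>lborel"
    let ?B = "\<lambda>M. \<integral>\<^sup>+y. (\<integral>\<^sup>+x. ?b x y * ?q x y \<partial>lborel) \<partial>M"
    let ?c = "\<lambda>\<pi> :: ('a \<times> 'a) measure. \<integral>\<^sup>+w. ennreal (norm (fst w - snd w)) \<partial>\<pi>"
    let ?P = "PSW p \<mu> \<nu> / e ^ ?n"
    have P: "?P \<ge> 0" using PSW_nonneg[of p \<mu> \<nu>] e by simp
    have eM: "0 \<le> e * M" and CP: "0 \<le> C * ?P"
      by (intro mult_nonneg_nonneg less_imp_le[OF e] less_imp_le[OF M] C(1) P)+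
    have s: "sets \<mu> = sets (restrict_space borel unit_sphere)" "sets \<nu> = sets (restrict_space borel unit_sphere)"
      and ps: "prob_space \<mu>" "prob_space \<nu>"
      using \<mu> \<nu> by (auto simp: in_borel_probs_iff)
    interpret \<mu>: prob_space \<mu> by fact
    interpret \<nu>: prob_space \<nu> by fact
    have sp: "space \<mu> = unit_sphere" "space \<nu> = unit_sphere"
      using borel_probs_space \<mu> \<nu> by auto
    define R where "R M x = (LINT y|M. ?k (x - y))" for M and x :: 'a
    have kbound: "norm (?k z) \<le> gauss_density (0::'a) / e ^ ?n" for z
      using gauss_kernel_le[OF e, of z] gauss_kernel_pos[OF e, of z] by simp
    have \<rho>: "?\<rho> M x = ennreal (R M x)" "0 < R M x"
      if M: "M \<in> borel_probs unit_sphere" for M and x :: 'a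
    proof -
      interpret M: prob_space M using M by (simp add: in_borel_probs_iff)
      have m: "(\<lambda>y. ?k (x - y)) \<in> borel_measurable M"
        by (rule borel_probs_measurable[OF M]) measurable
      have i: "integrable M (\<lambda>y. ?k (x - y))"
        by (rule M.integrable_const_bound[where B="gauss_density (0::'a) / e ^ ?n"]) (use kbound m in auto)
      show 1: "?\<rho> M x = ennreal (R M x)"
        unfolding R_def using i e by (intro nn_integral_eq_integral) (auto intro!: AE_I2 less_imp_le[OF gauss_kernel_pos])
      have "R M x \<noteq> 0"
      proof
        assume "R M x = 0"
        then have "AE y in M. ?k (x - y) = 0"
          using i e unfolding R_def
          by (subst (asm) integral_nonneg_eq_0_iff_AE) (auto intro!: AE_I2 less_imp_le[OF gauss_kernel_pos])
        moreover have "?k z \<noteq> 0" for z using gauss_kernel_pos[OF e, of z] by simp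
        ultimately have "AE y in M. False" by simp
        then show False using M.AE_False by simp
      qed
      moreover have "R M x \<ge> 0"
        unfolding R_def using e by (intro Bochner_Integration.integral_nonneg) (auto intro: less_imp_le[OF gauss_kernel_pos])
      ultimately show "0 < R M x" by simp
    qed
    have qm: "case_prod ?q \<in> borel_measurable (lborel \<Otimes>\<^sub>M M)" and bm: "case_prod ?b \<in> borel_measurable (lborel \<Otimes>\<^sub>M M)"
      if M: "M \<in> borel_probs unit_sphere" for M :: "'a measure"
    proof -
      have sM: "sets M = sets (restrict_space borel unit_sphere)" using M by (simp add: in_borel_probs_iff)
      show "case_prod ?q \<in> borel_measurable (lborel \<Otimes>\<^sub>M M)"
        unfolding case_prod_beta' by (rule measurable_restrict_pair[OF sM]) measurable
      show "case_prod ?b \<in> borel_measurable (lborel \<Otimes>\<^sub>M M)"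
        unfolding case_prod_beta' by (rule measurable_restrict_pair[OF sM]) measurable
    qed
    have cm: "(\<lambda>(y, z). ennreal (norm (y - z))) \<in> borel_measurable (\<mu> \<Otimes>\<^sub>M \<nu>)"
    proof -
      have "(\<lambda>w. ennreal (norm (snd w - fst w))) \<in> borel_measurable (\<nu> \<Otimes>\<^sub>M \<mu>)"
      proof (rule measurable_restrict_pair[OF s(1)])
        have "(\<lambda>w. ennreal (norm (fst w - snd w))) \<in> borel_measurable (borel \<Otimes>\<^sub>M \<nu>)"
          by (rule measurable_restrict_pair[OF s(2)]) measurable
        from borel_measurable_pair_swap[OF this]
        show "(\<lambda>w. ennreal (norm (snd w - fst w))) \<in> borel_measurable (\<nu> \<Otimes>\<^sub>M borel)" by simp
      qed
      from borel_measurable_pair_swap[OF this] show ?thesis by (simp add: case_prod_beta')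
    qed
    have norm1: "(\<integral>\<^sup>+x. ?q x y \<partial>lborel) = 1" for y :: 'a
      using gauss_kernel_nn_integral[OF e, of "\<lambda>_. 1" y] by (simp add: gauss_density_nn_integral)
    have moment: "(\<integral>\<^sup>+x. ?b x y * ?q x y \<partial>lborel) \<le> ennreal (e * M)" for y :: 'a
    proof -
      have "(\<integral>\<^sup>+x. ?b x y * ?q x y \<partial>lborel) = (\<integral>\<^sup>+z. ennreal (norm (e *\<^sub>R z)) * ennreal (gauss_density (z::'a)) \<partial>lborel)"
        using gauss_kernel_nn_integral[OF e, of "\<lambda>z. ennreal (norm z)" y] by simp
      also have "\<dots> = (\<integral>\<^sup>+z. ennreal e * (ennreal (norm z) * ennreal (gauss_density (z::'a))) \<partial>lborel)"
        using e by (intro nn_integral_cong) (simp add: ennreal_mult mult.assoc)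
      also have "\<dots> = ennreal e * (\<integral>\<^sup>+z. ennreal (norm z) * ennreal (gauss_density (z::'a)) \<partial>lborel)"
        by (rule nn_integral_cmult) measurable
      also have "\<dots> \<le> ennreal e * ennreal M"
        unfolding M_def by (intro mult_left_mono gauss_first_moment) simp
      finally show ?thesis using e M by (simp add: ennreal_mult)
    qed
    have moment_avg: "?B N \<le> ennreal (e * M)" if "prob_space N" for N :: "'a measure"
      using nn_integral_mono[of N, OF moment] prob_space.emeasure_space_1[OF that] by (simp add: order_trans)
    have "\<exists>\<pi>\<in>couplings \<mu> \<nu>. ?c \<pi> \<le> ?B \<mu> + ?B \<nu> + 2 * (1 - ?m)"
    proof (rule kernel_coupling)
      show "sigma_finite_measure (lborel :: 'a measure)" by (rule sigma_finite_lborel)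
      show "0 < ?\<rho> \<mu> x \<and> ?\<rho> \<mu> x < \<top> \<and> 0 < ?\<rho> \<nu> x \<and> ?\<rho> \<nu> x < \<top>" for x
        using \<rho>[OF \<mu>, of x] \<rho>[OF \<nu>, of x] by simp
      show "ennreal (norm (y - z)) \<le> ?b x y + ?b x z" for x y z :: 'a
        using norm_triangle_ineq4[of "x - z" "x - y"] by (simp add: norm_minus_commute add.commute flip: ennreal_plus)
      show "ennreal (norm (y - z)) \<le> 2" if "y \<in> space \<mu>" "z \<in> space \<mu>" for y z
        using that norm_triangle_ineq4[of y z] by (simp add: sp flip: ennreal_numeral)
    qed (use ps s qm[OF \<mu>] bm[OF \<mu>] cm norm1 in auto)
    then obtain \<pi> where \<pi>: "\<pi> \<in> couplings \<mu> \<nu>" and cost: "?c \<pi> \<le> ?B \<mu> + ?B \<nu> + 2 * (1 - ?m)"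
      by blast
    have deficit: "1 - ?m \<le> ennreal (e * M) + ennreal (C * ?P)"
    proof -
      interpret L: pair_sigma_finite lborel \<mu> ..
      let ?in = "\<integral>\<^sup>+x\<in>cball 0 2. ennreal \<bar>R \<mu> x - R \<nu> x\<bar> \<partial>lborel"
      let ?out = "\<integral>\<^sup>+x. ?\<rho> \<mu> x * indicator (- cball 0 2) x \<partial>lborel"
      have Rm: "R N \<in> borel_measurable borel" if N: "N \<in> borel_probs unit_sphere" for N
      proof -
        interpret N: prob_space N using N by (simp add: in_borel_probs_iff)
        have "(\<lambda>w. ?k (fst w - snd w)) \<in> borel_measurable (borel \<Otimes>\<^sub>M N)"
          by (rule measurable_restrict_pair[of _ unit_sphere]) (use N in \<open>simp add: in_borel_probs_iff\<close>, measurable)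
        then show ?thesis unfolding R_def[abs_def]
          by (intro N.borel_measurable_lebesgue_integral) (simp add: case_prod_beta')
      qed
      note [measurable] = Rm[OF \<mu>] Rm[OF \<nu>]
      have [measurable]: "cball (0::'a) 2 \<in> sets borel" "- cball (0::'a) 2 \<in> sets borel" by simp_all
      have "1 = (\<integral>\<^sup>+y. (\<integral>\<^sup>+x. ?q x y \<partial>lborel) \<partial>\<mu>)"
        by (simp add: norm1 \<mu>.emeasure_space_1)
      also have "\<dots> = (\<integral>\<^sup>+x. ?\<rho> \<mu> x \<partial>lborel)"
        by (rule L.Fubini'[OF qm[OF \<mu>]])
      also have "\<dots> \<le> (\<integral>\<^sup>+x. min (?\<rho> \<mu> x) (?\<rho> \<nu> x)
          + (ennreal \<bar>R \<mu> x - R \<nu> x\<bar> * indicator (cball 0 2) x + ?\<rho> \<mu> x * indicator (- cball 0 2) x) \<partial>lborel)"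
      proof (rule nn_integral_mono)
        fix x :: 'a
        show "?\<rho> \<mu> x \<le> min (?\<rho> \<mu> x) (?\<rho> \<nu> x)
          + (ennreal \<bar>R \<mu> x - R \<nu> x\<bar> * indicator (cball 0 2) x + ?\<rho> \<mu> x * indicator (- cball 0 2) x)"
        proof (cases "x \<in> cball 0 2")
          case True
          have "R \<mu> x \<le> min (R \<mu> x) (R \<nu> x) + \<bar>R \<mu> x - R \<nu> x\<bar>" by linarith
          then have "ennreal (R \<mu> x) \<le> ennreal (min (R \<mu> x) (R \<nu> x) + \<bar>R \<mu> x - R \<nu> x\<bar>)"
            by (rule ennreal_leI)
          also have "\<dots> = ennreal (min (R \<mu> x) (R \<nu> x)) + ennreal \<bar>R \<mu> x - R \<nu> x\<bar>"
            using \<rho>(2)[OF \<mu>, of x] \<rho>(2)[OF \<nu>, of x] by (intro ennreal_plus) auto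
          finally have "ennreal (R \<mu> x) \<le> ennreal (min (R \<mu> x) (R \<nu> x)) + ennreal \<bar>R \<mu> x - R \<nu> x\<bar>" .
          moreover have "ennreal (min (R \<mu> x) (R \<nu> x)) = min (ennreal (R \<mu> x)) (ennreal (R \<nu> x))"
            using \<rho>(2)[OF \<mu>, of x] \<rho>(2)[OF \<nu>, of x] by (auto simp: min_def)
          ultimately show ?thesis
            using True by (simp add: \<rho>(1)[OF \<mu>] \<rho>(1)[OF \<nu>])
        qed simp
      qed
      also have "\<dots> = ?m
          + (?in + ?out)"
        unfolding \<rho>(1)[OF \<mu>] \<rho>(1)[OF \<nu>] by (simp add: nn_integral_add)
      finally have "1 - ?m
         \<le> ?in + ?out"
        by (simp add: ennreal_minus_le_iff)
      also have "\<dots> \<le> ennreal (C * ?P) + ennreal (e * M)"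
      proof (rule add_mono)
        show "?in \<le> ennreal (C * ?P)"
          using C(2)[OF \<mu> \<nu> e] by (simp add: R_def)
        have "?out \<le> (\<integral>\<^sup>+x. (\<integral>\<^sup>+y. ?b x y * ?q x y \<partial>\<mu>) \<partial>lborel)"
        proof (rule nn_integral_mono)
          fix x :: 'a
          show "?\<rho> \<mu> x * indicator (- cball 0 2) x \<le> (\<integral>\<^sup>+y. ?b x y * ?q x y \<partial>\<mu>)"
          proof (cases "x \<in> cball 0 2")
            case False
            have "?q x y \<le> ?b x y * ?q x y" if "y \<in> space \<mu>" for y
            proof -
              have "1 \<le> norm (x - y)"
                using that False norm_triangle_ineq2[of x y] by (simp add: sp)
              then have "1 \<le> ?b x y" by simp
              from mult_right_mono[OF this, of "?q x y"] show ?thesis by simp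
            qed
            then show ?thesis using False by (auto intro: nn_integral_mono)
          qed simp
        qed
        also have "\<dots> = ?B \<mu>"
          using qm[OF \<mu>] bm[OF \<mu>] by (intro L.Fubini'[symmetric]) (simp add: case_prod_beta')
        also have "\<dots> \<le> ennreal (e * M)" by (rule moment_avg) (rule ps)
        finally show "?out \<le> ennreal (e * M)" .
      qed
      finally show ?thesis by (simp add: add.commute)
    qed
    have "?c \<pi> \<le> ennreal (e * M) + ennreal (e * M) + 2 * (ennreal (e * M) + ennreal (C * ?P))"
      by (rule order_trans[OF cost]) (intro add_mono mult_left_mono moment_avg ps deficit, simp)
    also have "\<dots> = ennreal (4 * (e * M) + 2 * (C * ?P))"
    proof -
      have "ennreal (e * M) + ennreal (e * M) + ennreal 2 * (ennreal (e * M) + ennreal (C * ?P))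
        = ennreal (e * M + e * M + 2 * (e * M + C * ?P))"
        using eM CP by (simp only: ennreal_plus ennreal_mult add_nonneg_nonneg mult_nonneg_nonneg zero_le_numeral)
      then show ?thesis by (simp add: algebra_simps)
    qed
    finally have nn: "?c \<pi> \<le> ennreal (4 * (e * M) + 2 * (C * ?P))" .
    interpret \<pi>: prob_space \<pi> by (rule sphere.coupling_prob[OF \<mu> \<nu> \<pi>])
    have s\<pi>: "sets \<pi> = sets (\<mu> \<Otimes>\<^sub>M \<nu>)" using \<pi> by (simp add: couplings_def)
    have sp\<pi>: "space \<pi> = unit_sphere \<times> unit_sphere" by (rule sphere.coupling_space[OF \<mu> \<nu> \<pi>])
    have nm: "(\<lambda>w. norm (fst w - snd w)) \<in> borel_measurable \<pi>"
      using measurable_compose[OF cm, of enn2real borel]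
      by (simp add: measurable_cong_sets[OF s\<pi> refl] case_prod_beta')
    have ni: "integrable \<pi> (\<lambda>w. norm (fst w - snd w))"
    proof (rule \<pi>.integrable_const_bound[where B=2])
      show "AE w in \<pi>. norm (norm (fst w - snd w)) \<le> 2"
      proof (rule AE_I2)
        fix w assume "w \<in> space \<pi>"
        then show "norm (norm (fst w - snd w)) \<le> 2"
          using norm_triangle_ineq4[of "fst w" "snd w"] by (auto simp: sp\<pi>)
      qed
    qed (rule nm)
    have E: "\<pi>.expectation (\<lambda>w. norm (fst w - snd w)) \<le> 4 * (e * M) + 2 * (C * ?P)"
    proof -
      have "0 \<le> 4 * (e * M) + 2 * (C * ?P)" using eM CP by linarith
      then show ?thesis using nn ni by (simp add: nn_integral_eq_integral)
    qed
    have "wasserstein geodesic_dist p \<mu> \<nu> powr p \<le> sphere.cost p \<pi>"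
      by (rule sphere.wasserstein_powr_le_cost[OF \<mu> \<nu> \<pi> p0])
    also have "\<dots> \<le> \<pi>.expectation (\<lambda>w. pi powr p / 2 * norm (fst w - snd w))"
    proof (rule integral_mono)
      show "integrable \<pi> (\<lambda>w. geodesic_dist (fst w) (snd w) powr p)"
        using sphere.coupling_integrable[OF \<mu> \<nu> \<pi>] p0 by simp
      fix w assume "w \<in> space \<pi>"
      then have w: "fst w \<in> unit_sphere" "snd w \<in> unit_sphere" by (auto simp: sp\<pi>)
      note g = cos_geodesic_dist[OF w]
      let ?g = "geodesic_dist (fst w) (snd w)"
      show "?g powr p \<le> pi powr p / 2 * norm (fst w - snd w)"
      proof (cases "?g = 0")
        case False
        then have g0: "?g > 0" using g by simp
        have "?g powr p = ?g powr (p - 1) * ?g" using g0 by (simp add: powr_mult_base mult.commute)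
        also have "\<dots> \<le> pi powr (p - 1) * (pi / 2 * dist (fst w) (snd w))"
          using g g0 p sphere.le_dist[OF w] by (intro mult_mono powr_mono2) auto
        also have "\<dots> = (pi powr (p - 1) * pi) / 2 * norm (fst w - snd w)"
          by (simp add: dist_norm)
        also have "pi powr (p - 1) * pi = pi powr p" by (simp add: powr_mult_base mult.commute)
        finally show ?thesis .
      qed simp
    qed (use ni in simp)
    also have "\<dots> = pi powr p / 2 * \<pi>.expectation (\<lambda>w. norm (fst w - snd w))" by simp
    also have "\<dots> \<le> pi powr p / 2 * (4 * (e * M) + 2 * (C * ?P))"
      by (intro mult_left_mono E) simp
    also have "\<dots> \<le> C' * (e + ?P)"
    proof -
      have "4 * (e * M) + 2 * (C * ?P) \<le> (4 * M + 2 * C) * (e + ?P)"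
      proof -
        have "0 \<le> 4 * M * ?P" "0 \<le> 2 * C * e"
          by (intro mult_nonneg_nonneg zero_le_numeral less_imp_le[OF e] less_imp_le[OF M] C(1) P)+
        moreover have "(4 * M + 2 * C) * (e + ?P) = 4 * (e * M) + 2 * (C * ?P) + 4 * M * ?P + 2 * C * e"
          by (simp only: distrib_left distrib_right mult_ac add_ac)
        ultimately show ?thesis by linarith
      qed
      from mult_left_mono[OF this, of "pi powr p / 2"] show ?thesis
        by (simp add: C'_def mult.assoc)
    qed
    finally show ?thesis .
  qed
  then show ?thesis using C' by blast
qed

lemma wasserstein_le_PSW_powr:
  fixes p :: real
  assumes p: "p \<ge> 1"
  shows "\<exists>C>0. \<forall>\<mu>\<in>borel_probs (unit_sphere :: 'a::euclidean_space set). \<forall>\<nu>\<in>borel_probs unit_sphere.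
     wasserstein geodesic_dist p \<mu> \<nu> \<le> C * PSW p \<mu> \<nu> powr (1 / (p * (real DIM('a) + 1)))"
proof -
  let ?n = "DIM('a)"
  have p0: "p > 0" using p by simp
  obtain C where C: "C > 0" "\<And>\<mu> \<nu> e. \<mu> \<in> borel_probs (unit_sphere :: 'a set) \<Longrightarrow> \<nu> \<in> borel_probs unit_sphere \<Longrightarrow> e > 0 \<Longrightarrow>
     wasserstein geodesic_dist p \<mu> \<nu> powr p \<le> C * (e + PSW p \<mu> \<nu> / e ^ ?n)"
    using wasserstein_powr_le_scale[OF p, where 'a='a] by blast
  have "wasserstein geodesic_dist p \<mu> \<nu> \<le> (2 * C) powr (1 / p) * PSW p \<mu> \<nu> powr (1 / (p * (real ?n + 1)))"
    if \<mu>: "\<mu> \<in> borel_probs (unit_sphere :: 'a set)" and \<nu>: "\<nu> \<in> borel_probs unit_sphere" for \<mu> \<nu>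
  proof (cases "PSW p \<mu> \<nu> = 0")
    case True
    have "wasserstein geodesic_dist p \<mu> \<nu> powr p \<le> 0 + e" if "e > 0" for e
      using C(2)[OF \<mu> \<nu>, of "e / C"] C(1) that True by simp
    then have "wasserstein geodesic_dist p \<mu> \<nu> powr p \<le> 0" by (rule field_le_epsilon)
    then show ?thesis using True by simp
  next
    case False
    define P where "P = PSW p \<mu> \<nu>"
    have P: "P > 0" using False PSW_nonneg[of p \<mu> \<nu>] by (simp add: P_def)
    \<comment> \<open>At this scale both terms of the bound are equal.\<close>
    define e where "e = P powr (1 / (real ?n + 1))"
    have e: "e > 0" using P by (simp add: e_def)
    have "e ^ Suc ?n = e powr real (Suc ?n)" by (rule powr_realpow[OF e, symmetric])
    also have "\<dots> = P powr (1 / (real ?n + 1) * real (Suc ?n))" by (simp only: e_def powr_powr)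
    also have "1 / (real ?n + 1) * real (Suc ?n) = 1" by simp
    finally have "e ^ Suc ?n = P" using P by simp
    then have "P / e ^ ?n = e" using e by (auto simp: field_simps)
    then have "wasserstein geodesic_dist p \<mu> \<nu> powr p \<le> 2 * C * e"
      using C(2)[OF \<mu> \<nu> e] by (simp add: P_def)
    also have "\<dots> = ((2 * C) powr (1 / p) * P powr (1 / (p * (real ?n + 1)))) powr p"
      using C P p0 by (simp add: powr_mult powr_powr e_def mult.commute)
    finally show ?thesis
      unfolding P_def[symmetric] using p0 sphere.wasserstein_nonneg[of p \<mu> \<nu>] C
      by (meson linorder_not_le powr_less_mono2 mult_nonneg_nonneg powr_ge_zero)
  qed
  moreover have "(2 * C) powr (1 / p) > 0" using C by simp
  ultimately show ?thesis by blast
qed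

section \<open>Rotations\<close>

text \<open>The image of Lebesgue measure under \<open>f\<close> is again invariant under translations, hence a multiple of
Lebesgue measure, and the unit ball shows that the factor is 1. The proof makes this direct: with \<open>b\<close>
the indicator of the unit ball, the double integral of \<open>b (f y) * h x\<close> is computed in two ways, by
translations and Tonelli's theorem.\<close>

lemma lborel_orthogonal_invariant:
  fixes f :: "'a::euclidean_space \<Rightarrow> 'a"
  assumes f: "orthogonal_transformation f" and h[measurable]: "h \<in> borel_measurable borel"
  shows "(\<integral>\<^sup>+x. h (f x) \<partial>lborel) = (\<integral>\<^sup>+x. h x \<partial>lborel)"
proof -
  have lin: "linear f" using f by (rule orthogonal_transformation_linear)
  have nf: "norm (f x) = norm x" for x using f by (simp add: orthogonal_transformation)
  have surj: "surj f" using f by (rule orthogonal_transformation_surj)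
  have [measurable]: "f \<in> borel_measurable borel"
    using lin by (intro borel_measurable_continuous_onI linear_continuous_on linear_conv_bounded_linear[THEN iffD1])
  have shift: "(\<integral>\<^sup>+x. F x \<partial>lborel) = (\<integral>\<^sup>+x. F (x + a) \<partial>lborel)" if "F \<in> borel_measurable borel" for F and a :: 'a
    using nn_integral_affine_euclidean[OF that, of 1 a] by (simp add: add.commute)
  let ?b = "\<lambda>x::'a. indicator (ball 0 1) x :: ennreal"
  have [measurable]: "ball (0::'a) 1 \<in> sets borel" by simp
  let ?V = "emeasure lborel (ball (0::'a) 1)"
  have V: "?V \<noteq> 0" "?V \<noteq> \<top>"
    using unit_ball_vol_pos[of "real DIM('a)"] by (simp_all add: emeasure_ball less_imp_neq[symmetric])
  have b: "(\<integral>\<^sup>+x. ?b x \<partial>lborel) = ?V" by simp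
  have "(\<integral>\<^sup>+x. h x \<partial>lborel) * ?V = (\<integral>\<^sup>+y. (\<integral>\<^sup>+x. ?b (f y) * h x \<partial>lborel) \<partial>lborel)"
  proof -
    have "(\<integral>\<^sup>+y. ?b (f y) \<partial>lborel) = ?V"
      unfolding b[symmetric] by (intro nn_integral_cong) (simp add: nf indicator_def)
    then show ?thesis by (simp add: nn_integral_cmult nn_integral_multc mult.commute)
  qed
  also have "\<dots> = (\<integral>\<^sup>+y. (\<integral>\<^sup>+x. ?b (f y) * h (x + f y) \<partial>lborel) \<partial>lborel)"
    by (intro nn_integral_cong shift) measurable
  also have "\<dots> = (\<integral>\<^sup>+x. (\<integral>\<^sup>+y. ?b (f y) * h (x + f y) \<partial>lborel) \<partial>lborel)"
    by (rule lborel_pair.Fubini') measurable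
  also have "\<dots> = (\<integral>\<^sup>+x. (\<integral>\<^sup>+y. ?b (f y - x) * h (f y) \<partial>lborel) \<partial>lborel)"
  proof (rule nn_integral_cong)
    fix x :: 'a
    obtain u where u: "f u = x" using surj by (metis surjD)
    have "(\<integral>\<^sup>+y. ?b (f y - x) * h (f y) \<partial>lborel) = (\<integral>\<^sup>+y. ?b (f (y + u) - x) * h (f (y + u)) \<partial>lborel)"
      by (rule shift) measurable
    also have "\<dots> = (\<integral>\<^sup>+y. ?b (f y) * h (x + f y) \<partial>lborel)"
      using lin u by (simp add: linear_add add.commute)
    finally show "(\<integral>\<^sup>+y. ?b (f y) * h (x + f y) \<partial>lborel) = (\<integral>\<^sup>+y. ?b (f y - x) * h (f y) \<partial>lborel)" ..
  qed
  also have "\<dots> = (\<integral>\<^sup>+y. (\<integral>\<^sup>+x. ?b (f y - x) * h (f y) \<partial>lborel) \<partial>lborel)"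
    by (rule lborel_pair.Fubini') measurable
  also have "\<dots> = (\<integral>\<^sup>+y. ?V * h (f y) \<partial>lborel)"
  proof (rule nn_integral_cong)
    fix y :: 'a
    have "(\<integral>\<^sup>+x. ?b (f y - x) \<partial>lborel) = (\<integral>\<^sup>+x. ?b (f y - (x + f y)) \<partial>lborel)"
      by (rule shift) measurable
    also have "\<dots> = ?V" unfolding b[symmetric] by (intro nn_integral_cong) (simp add: indicator_def)
    finally show "(\<integral>\<^sup>+x. ?b (f y - x) * h (f y) \<partial>lborel) = ?V * h (f y)"
      by (simp add: nn_integral_multc)
  qed
  also have "\<dots> = (\<integral>\<^sup>+y. h (f y) \<partial>lborel) * ?V"
    unfolding mult.commute[of _ ?V] by (rule nn_integral_cmult) measurable
  finally show ?thesis
    using V by (simp add: ennreal_mult_cancel_left mult.commute[of _ ?V])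
qed

text \<open>Orthogonal maps commute with \<^const>\<open>sgn\<close> and preserve both the ball and Lebesgue measure.\<close>

lemma sphere_uniform_orthogonal_invariant:
  fixes f :: "'a::euclidean_space \<Rightarrow> 'a"
  assumes f: "orthogonal_transformation f"
  shows "f \<in> sphere_uniform \<rightarrow>\<^sub>M sphere_uniform" and "distr sphere_uniform sphere_uniform f = sphere_uniform"
proof -
  let ?R = "restrict_space borel (unit_sphere :: 'a set)"
  have lin: "linear f" using f by (rule orthogonal_transformation_linear)
  have nf: "norm (f x) = norm x" for x using f by (simp add: orthogonal_transformation)
  have fb[measurable]: "f \<in> borel_measurable borel"
    using lin by (intro borel_measurable_continuous_onI linear_continuous_on linear_conv_bounded_linear[THEN iffD1])
  have fR: "f \<in> ?R \<rightarrow>\<^sub>M ?R"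
    by (intro measurable_restrict_space2 measurable_restrict_space1 fb) (auto simp: space_restrict_space nf)
  then show meas: "f \<in> (sphere_uniform :: 'a measure) \<rightarrow>\<^sub>M sphere_uniform"
    by (simp add: measurable_cong_sets[OF sets_sphere_uniform sets_sphere_uniform])
  show "distr sphere_uniform sphere_uniform f = sphere_uniform"
  proof (rule measure_eqI)
    fix A assume "A \<in> sets (distr sphere_uniform sphere_uniform f)"
    then have A: "A \<in> sets (sphere_uniform :: 'a measure)" by simp
    then have AR: "A \<in> sets ?R" by (simp add: sets_sphere_uniform)
    then have [measurable]: "A \<in> sets borel" by (auto simp: sets_restrict_space_iff)
    have [measurable]: "cball (0::'a) 1 - {0} \<in> sets borel" by simp
    have iA: "indicator A \<in> borel_measurable ?R" using AR by simp
    have "emeasure (distr sphere_uniform sphere_uniform f) A = (\<integral>\<^sup>+\<theta>. indicator A \<theta> \<partial>distr sphere_uniform sphere_uniform f)"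
      using A by simp
    also have "\<dots> = (\<integral>\<^sup>+\<theta>. indicator A (f \<theta>) \<partial>sphere_uniform)"
      using A by (intro nn_integral_distr[OF meas]) simp
    also have "\<dots> = (\<integral>\<^sup>+\<xi>. indicator A (f (sgn \<xi>)) * indicator (cball 0 1 - {0}) \<xi> \<partial>lborel) / ennreal (unit_ball_vol DIM('a))"
      by (rule nn_integral_sphere_uniform) (rule measurable_compose[OF fR iA])
    also have "(\<integral>\<^sup>+\<xi>. indicator A (f (sgn \<xi>)) * indicator (cball 0 1 - {0}) \<xi> \<partial>lborel)
        = (\<integral>\<^sup>+\<xi>. indicator A (sgn (f \<xi>)) * indicator (cball 0 1 - {0}) (f \<xi>) \<partial>lborel)"
    proof (rule nn_integral_cong)
      fix \<xi>
      have "f (sgn \<xi>) = sgn (f \<xi>)" using lin by (simp add: sgn_div_norm linear_scale nf)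
      moreover have "f \<xi> \<in> cball 0 1 - {0} \<longleftrightarrow> \<xi> \<in> cball 0 1 - {0}" using nf[of \<xi>] by auto
      ultimately show "indicator A (f (sgn \<xi>)) * indicator (cball 0 1 - {0}) \<xi>
        = (indicator A (sgn (f \<xi>)) * indicator (cball 0 1 - {0}) (f \<xi>) :: ennreal)"
        by (simp add: indicator_def)
    qed
    also have "\<dots> = (\<integral>\<^sup>+\<xi>. indicator A (sgn \<xi>) * indicator (cball 0 1 - {0}) \<xi> \<partial>lborel)"
      by (rule lborel_orthogonal_invariant[OF f]) measurable
    also have "\<dots> / ennreal (unit_ball_vol DIM('a)) = (\<integral>\<^sup>+\<theta>. indicator A \<theta> \<partial>sphere_uniform)"
      by (rule nn_integral_sphere_uniform[symmetric, OF iA])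
    also have "\<dots> = emeasure sphere_uniform A" using A by simp
    finally show "emeasure (distr sphere_uniform sphere_uniform f) A = emeasure sphere_uniform A" .
  qed simp
qed

text \<open>\<open>B \<mapsto> \<mu> (Q B)\<close> is the image of \<open>\<mu>\<close> under the inverse of \<open>Q\<close>, which is its transpose.\<close>

lemma rotated_eq_distr:
  fixes Q :: "real ^ 'n ^ 'n"
  assumes \<mu>: "\<mu> \<in> borel_probs (unit_sphere :: (real ^ 'n) set)" and Q: "orthogonal_matrix Q"
  shows "(\<lambda>x. transpose Q *v x) \<in> \<mu> \<rightarrow>\<^sub>M \<mu>" and "rotated \<mu> Q = distr \<mu> \<mu> (\<lambda>x. transpose Q *v x)"
proof -
  let ?f = "\<lambda>x. transpose Q *v x"
  have inv: "transpose Q *v (Q *v x) = x" "Q *v (transpose Q *v x) = x" for x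
    using Q by (simp_all only: orthogonal_matrix_def matrix_vector_mul_assoc matrix_vector_mul_lid)
  have "orthogonal_transformation ?f"
    unfolding orthogonal_transformation_matrix matrix_of_matrix_vector_mul
    using Q by (simp add: orthogonal_matrix_transpose matrix_vector_mul_linear del: transpose_matrix_vector)
  then have nf: "norm (?f x) = norm x" for x by (simp add: orthogonal_transformation)
  have nQ: "norm (Q *v x) = norm x" for x using nf[of "Q *v x"] inv by simp
  have s: "sets \<mu> = sets (restrict_space borel unit_sphere)" using \<mu> by (simp add: in_borel_probs_iff)
  have sp: "space \<mu> = unit_sphere" by (rule borel_probs_space[OF \<mu>])
  have fb: "?f \<in> borel_measurable borel"
    by (intro borel_measurable_continuous_onI matrix_vector_mult_linear_continuous_on)
  have fR: "?f \<in> restrict_space borel unit_sphere \<rightarrow>\<^sub>M restrict_space borel unit_sphere"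
    by (intro measurable_restrict_space2 measurable_restrict_space1 fb)
      (auto simp: space_restrict_space nf simp del: transpose_matrix_vector)
  then show meas: "?f \<in> \<mu> \<rightarrow>\<^sub>M \<mu>" by (simp add: measurable_cong_sets[OF s s])
  have eq: "emeasure \<mu> ((\<lambda>x. Q *v x) ` B) = emeasure (distr \<mu> \<mu> ?f) B" if B: "B \<in> sets \<mu>" for B
  proof -
    have "B \<subseteq> unit_sphere" using sets.sets_into_space[OF B] sp by simp
    have "(\<lambda>x. Q *v x) ` B = ?f -` B \<inter> space \<mu>"
    proof (intro subset_antisym subsetI)
      fix y assume "y \<in> (\<lambda>x. Q *v x) ` B"
      then obtain x where "x \<in> B" "y = Q *v x" by blast
      then show "y \<in> ?f -` B \<inter> space \<mu>"
        using \<open>B \<subseteq> unit_sphere\<close> inv(1)[of x] nQ[of x] by (auto simp: sp simp del: transpose_matrix_vector)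
    next
      fix y assume "y \<in> ?f -` B \<inter> space \<mu>"
      then have "?f y \<in> B" by blast
      then show "y \<in> (\<lambda>x. Q *v x) ` B" using inv(2)[of y, symmetric] by (rule rev_image_eqI)
    qed
    then show ?thesis using B meas by (simp add: emeasure_distr)
  qed
  have "rotated \<mu> Q = measure_of (space \<mu>) (sets \<mu>) (emeasure (distr \<mu> \<mu> ?f))"
    unfolding rotated_def
    by (rule measure_of_eq) (use sets.space_closed eq in \<open>auto simp: sets.sigma_sets_eq\<close>)
  also have "\<dots> = distr \<mu> \<mu> ?f"
    using measure_of_of_measure[of "distr \<mu> \<mu> ?f"] by simp
  finally show "rotated \<mu> Q = distr \<mu> \<mu> ?f" .
qed

text \<open>The slice of \<open>rotated \<mu> Q\<close> in direction \<open>\<psi>\<close> is the slice of \<open>\<mu>\<close> in direction \<open>Q *v \<psi>\<close>, and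
\<open>Q *v \<psi>\<close> is uniformly distributed if \<open>\<psi>\<close> is.\<close>

lemma PSW_rotated:
  fixes Q :: "real ^ 'n ^ 'n" and \<mu> \<nu> :: "(real ^ 'n) measure"
  assumes \<mu>: "\<mu> \<in> borel_probs unit_sphere" and \<nu>: "\<nu> \<in> borel_probs unit_sphere"
    and Q: "orthogonal_matrix Q" and p: "p \<ge> 1"
  shows "PSW p (rotated \<mu> Q) (rotated \<nu> Q) = PSW p \<mu> \<nu>"
proof -
  have sl: "sliced \<psi> (rotated M Q) = sliced (Q *v \<psi>) M"
    if M: "M \<in> borel_probs unit_sphere" and \<psi>: "\<psi> \<in> unit_sphere" for M :: "(real ^ 'n) measure" and \<psi>
  proof -
    have s: "sets M = sets (restrict_space borel unit_sphere)" using M by (simp add: in_borel_probs_iff)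
    have "sliced \<psi> (rotated M Q) = distr M (restrict_space borel {-1..1}) (slice \<psi> \<circ> (\<lambda>x. transpose Q *v x))"
      unfolding sliced_def rotated_eq_distr(2)[OF M Q]
      by (rule distr_distr[OF slice_measurable[OF \<psi> s] rotated_eq_distr(1)[OF M Q]])
    also have "slice \<psi> \<circ> (\<lambda>x. transpose Q *v x) = slice (Q *v \<psi>)"
      by (auto simp: slice_def fun_eq_iff transpose_matrix_vector dot_lmul_matrix)
    finally show ?thesis by (simp add: sliced_def)
  qed
  have ot: "orthogonal_transformation (\<lambda>x. Q *v x)"
    unfolding orthogonal_transformation_matrix matrix_of_matrix_vector_mul
    using Q by (simp add: matrix_vector_mul_linear)
  let ?H = "\<lambda>\<psi>. wasserstein dist p (sliced \<psi> \<mu>) (sliced \<psi> \<nu>) powr p"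
  have "(LINT \<psi>|sphere_uniform. wasserstein dist p (sliced \<psi> (rotated \<mu> Q)) (sliced \<psi> (rotated \<nu> Q)) powr p)
     = (LINT \<psi>|sphere_uniform. ?H (Q *v \<psi>))"
    using sl[OF \<mu>] sl[OF \<nu>] by (intro Bochner_Integration.integral_cong) (auto simp: space_sphere_uniform)
  also have "\<dots> = (LINT \<psi>|distr sphere_uniform sphere_uniform (\<lambda>x. Q *v x). ?H \<psi>)"
    using wasserstein_sliced_measurable[OF \<mu> \<nu> p]
    by (intro integral_distr[symmetric] sphere_uniform_orthogonal_invariant(1)[OF ot]) auto
  also have "\<dots> = (LINT \<psi>|sphere_uniform. ?H \<psi>)"
    by (simp add: sphere_uniform_orthogonal_invariant(2)[OF ot])
  finally show ?thesis by (simp add: PSW_def)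
qed

section \<open>Metric and topology\<close>

lemma mtopology_eq_if_powr_comparable:
  assumes "Metric_space M d1" "Metric_space M d2" and a: "a > 0" and C: "C > 0"
    and le: "\<And>x y. x \<in> M \<Longrightarrow> y \<in> M \<Longrightarrow> d1 x y \<le> d2 x y"
    and ge: "\<And>x y. x \<in> M \<Longrightarrow> y \<in> M \<Longrightarrow> d2 x y \<le> C * d1 x y powr a"
  shows "Metric_space.mtopology M d1 = Metric_space.mtopology M d2"
proof -
  interpret M1: Metric_space M d1 by fact
  interpret M2: Metric_space M d2 by fact
  have sub2: "M2.mball x r \<subseteq> M1.mball x r" for x r
    using le by (auto simp: M1.mball_def M2.mball_def intro: le_less_trans)
  have sub1: "M1.mball x ((r / C) powr (1 / a)) \<subseteq> M2.mball x r" if "r > 0" for x r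
  proof
    fix y assume "y \<in> M1.mball x ((r / C) powr (1 / a))"
    then have xy: "x \<in> M" "y \<in> M" and lt: "d1 x y < (r / C) powr (1 / a)" by auto
    have "d1 x y powr a < ((r / C) powr (1 / a)) powr a"
      using lt a by (intro powr_less_mono2) auto
    also have "\<dots> = r / C" using a C that by (simp add: powr_powr)
    finally have "C * d1 x y powr a < r" using C by (simp add: field_simps)
    then show "y \<in> M2.mball x r" using ge[OF xy] xy by auto
  qed
  have "openin M1.mtopology U = openin M2.mtopology U" for U
  proof
    assume "openin M1.mtopology U"
    then show "openin M2.mtopology U"
      unfolding M1.openin_mtopology M2.openin_mtopology using sub2 by (meson order_trans)
  next
    assume U: "openin M2.mtopology U"
    show "openin M1.mtopology U"
      unfolding M1.openin_mtopology
    proof (intro conjI allI impI)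
      show "U \<subseteq> M" using U by (simp add: M2.openin_mtopology)
      fix x assume "x \<in> U"
      then obtain r where r: "r > 0" "M2.mball x r \<subseteq> U" using U by (auto simp: M2.openin_mtopology)
      then have "M1.mball x ((r / C) powr (1 / a)) \<subseteq> U" using sub1[OF r(1)] by blast
      moreover have "(r / C) powr (1 / a) > 0" using r C by simp
      ultimately show "\<exists>r>0. M1.mball x r \<subseteq> U" by blast
    qed
  qed
  then show ?thesis by (simp add: topology_eq)
qed

lemma Metric_space_PSW:
  assumes p: "p \<ge> 1"
  shows "Metric_space (borel_probs (unit_sphere :: 'a::euclidean_space set)) (PSW p)"
proof
  show "0 \<le> PSW p \<mu> \<nu>" for \<mu> \<nu> :: "'a measure" by (rule PSW_nonneg)
  show "PSW p \<mu> \<nu> = PSW p \<nu> \<mu>" for \<mu> \<nu> :: "'a measure" by (rule PSW_commute)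
  show "(PSW p \<mu> \<nu> = 0) = (\<mu> = \<nu>)"
    if \<mu>: "\<mu> \<in> borel_probs (unit_sphere :: 'a set)" and \<nu>: "\<nu> \<in> borel_probs unit_sphere" for \<mu> \<nu>
  proof
    assume "PSW p \<mu> \<nu> = 0"
    then have "wasserstein geodesic_dist p \<mu> \<nu> \<le> 0"
      using wasserstein_le_PSW_powr[OF p, where 'a='a] \<mu> \<nu> by force
    then have "wasserstein geodesic_dist p \<mu> \<nu> = 0"
      using sphere.wasserstein_nonneg[of p \<mu> \<nu>] by simp
    then show "\<mu> = \<nu>" using p by (intro sphere.wasserstein_eq_0D[OF \<mu> \<nu>, of p]) auto
  qed (use PSW_self[OF \<mu>] p in auto)
  show "PSW p \<mu> \<rho> \<le> PSW p \<mu> \<nu> + PSW p \<nu> \<rho>"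
    if "\<mu> \<in> borel_probs (unit_sphere :: 'a set)" "\<nu> \<in> borel_probs unit_sphere" "\<rho> \<in> borel_probs unit_sphere" for \<mu> \<nu> \<rho>
    using PSW_triangle that p by blast
qed

theorem theorem3p7:
  fixes p :: real
  assumes "CARD('n::finite) \<ge> 3" and "p \<ge> 1"
  shows
    "Metric_space (borel_probs (unit_sphere :: (real ^ 'n) set)) (PSW p) \<and>
     Metric_space.mtopology (borel_probs (unit_sphere :: (real ^ 'n) set)) (PSW p) =
       Metric_space.mtopology (borel_probs (unit_sphere :: (real ^ 'n) set))
         (wasserstein geodesic_dist p) \<and>
     (\<exists>c C :: real. c > 0 \<and> C > 0 \<and>
       (\<forall>\<mu> \<in> borel_probs (unit_sphere :: (real ^ 'n) set).
         \<forall>\<nu> \<in> borel_probs (unit_sphere :: (real ^ 'n) set).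
           c * PSW p \<mu> \<nu> \<le> wasserstein geodesic_dist p \<mu> \<nu> \<and>
           wasserstein geodesic_dist p \<mu> \<nu>
             \<le> C * PSW p \<mu> \<nu> powr (1 / (p * (real CARD('n) + 1))))) \<and>
     (\<forall>\<mu> \<in> borel_probs (unit_sphere :: (real ^ 'n) set).
       \<forall>\<nu> \<in> borel_probs (unit_sphere :: (real ^ 'n) set).
         \<forall>Q :: real ^ 'n ^ 'n. rotation_matrix Q \<longrightarrow>
           PSW p \<mu> \<nu> = PSW p (rotated \<mu> Q) (rotated \<nu> Q))"
proof -
  note p = assms(2)
  let ?M = "borel_probs (unit_sphere :: (real ^ 'n) set)"
  let ?a = "1 / (p * (real CARD('n) + 1))"
  obtain C where C: "C > 0" "\<And>\<mu> \<nu>. \<mu> \<in> ?M \<Longrightarrow> \<nu> \<in> ?M \<Longrightarrow> wasserstein geodesic_dist p \<mu> \<nu> \<le> C * PSW p \<mu> \<nu> powr ?a"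
    using wasserstein_le_PSW_powr[OF p, where 'a="real ^ 'n"] by auto
  have le: "PSW p \<mu> \<nu> \<le> wasserstein geodesic_dist p \<mu> \<nu>" if "\<mu> \<in> ?M" "\<nu> \<in> ?M" for \<mu> \<nu>
    using PSW_le_wasserstein that p by blast
  have a: "?a > 0" using p by simp
  have metric: "Metric_space ?M (PSW p)" by (rule Metric_space_PSW[OF p])
  have topology: "Metric_space.mtopology ?M (PSW p) = Metric_space.mtopology ?M (wasserstein geodesic_dist p)"
    using mtopology_eq_if_powr_comparable[OF metric sphere.Metric_space_wasserstein[OF p] a C(1)] le C(2) by blast
  have bounds: "\<exists>c C :: real. c > 0 \<and> C > 0 \<and>
       (\<forall>\<mu> \<in> ?M. \<forall>\<nu> \<in> ?M. c * PSW p \<mu> \<nu> \<le> wasserstein geodesic_dist p \<mu> \<nu> \<and>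
           wasserstein geodesic_dist p \<mu> \<nu> \<le> C * PSW p \<mu> \<nu> powr ?a)"
    using le C by (intro exI[of _ 1] exI[of _ C]) auto
  have rotation: "\<forall>\<mu> \<in> ?M. \<forall>\<nu> \<in> ?M. \<forall>Q :: real ^ 'n ^ 'n. rotation_matrix Q \<longrightarrow>
           PSW p \<mu> \<nu> = PSW p (rotated \<mu> Q) (rotated \<nu> Q)"
    by (intro ballI allI impI PSW_rotated[symmetric] p) (auto simp: rotation_matrix_def)
  show ?thesis using metric topology bounds rotation by blast
qed

end
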